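(* Let $s\ge 1$ be an integer and $c>0$ a real number. With the random matrices $U_r^{(N)},G_r^{(N)},W_r^{(M,N)}$ and the non-commutative random variables $U_r,G_r,W_r$ ($1\le r\le s$) described in the context, the following hold as $M,N\to\infty$ with $M/N\to c$: (1) the families $(U_r^{(N)},G_r^{(N)})_{r=1}^s$ converge in $*$-distribution to $(U_r,G_r)_{r=1}^s$; (2) the families $(U_r^{(N)},W_r^{(M,N)})_{r=1}^s$ converge in $*$-distribution to $(U_r,W_r)_{r=1}^s$. That is, for every pair of strictly increasing sequences of positive integers $(M_q)_{q\ge1}$, $(N_q)_{q\ge1}$ with $\lim_{q\to\infty}M_q/N_q=c$, and for every monomial $\alpha$ in the elements $U_r,G_r$ ($1\le r\le s$) and their adjoints, or in the elements $U_r,W_r$ ($1\le r\le s$) and their adjoints, $$\lim_{q\to\infty}\mathbb E\left(\mathrm{tr}^{(N_q)}\alpha^{(M_q,N_q)}\right)=\varphi(\alpha).$$ In particular, the families $(U_r^{(N)},G_r^{(N)})_{r=1}^s$ and the families $(U_r^{(N)},W_r^{(M,N)})_{r=1}^s$ are asymptotically $*$-free.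
   Context: Random matrices. All random variables live on a fixed probability space $(\Omega,\mathcal F,P)$ with expectation $\mathbb E$. A complex standard Gaussian is a complex random variable whose real and imaginary parts are independent real Gaussians of mean $0$ and variance $1/2$. Fix an independent family $(f_{r;i,j})_{1\le r\le s,\ i,j\ge1}$ of complex standard Gaussian random variables and let $G_r^{(M,N)}=[f_{r;i,j}]_{1\le i\le M,1\le j\le N}$ (a random $M\times N$ matrix), $G_r^{(N)}=\frac1{\sqrt N}G_r^{(N,N)}$, and $W_r^{(M,N)}=\frac1N (G_r^{(M,N)})^*G_r^{(M,N)}$ (a complex Wishart matrix, of size $N\times N$). For every $N\ge1$ let $U_1^{(N)},\dots,U_s^{(N)}$ be random $N\times N$ permutation matrices, each uniformly distributed on the $N!$ permutation matrices of size $N$. It is assumed that for every $N$ the $2s$ random matrices $U_1^{(N)},G_1^{(N)},\dots,U_s^{(N)},G_s^{(N)}$ are independent, and that for every $M,N$ the $2s$ random matrices $U_1^{(N)},W_1^{(M,N)},\dots,U_s^{(N)},W_s^{(M,N)}$ are independent. For an $N\times N$ matrix $A$, $\mathrm{tr}^{(N)}A=\frac1N\sum_{i=1}^N A_{ii}$. Limit variables. $(\mathcal A,\varphi)$ is a tracial non-commutative $*$-probability space (a unital $*$-algebra with a unital, tracial, positive linear functional $\varphi$). The non-crossing (free) cumulants $k_n:\mathcal A^n\to\mathbb C$ are the multilinear functionals determined by the moment-cumulant formula $\varphi(A_1\cdots A_n)=\sum_{\pi\in NC(n)}\prod_{V\in\pi}k_{|V|}(A_i: i\in V)$, summing over non-crossing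 partitions, with arguments in increasing order of index. $U\in\mathcal A$ is a Haar unitary if $U^*U=UU^*=I$ and $\varphi(U^n)=0$ for all $n\in\mathbb Z\setminus\{0\}$. $G\in\mathcal A$ is standard circular if the only non-zero cumulants with arguments in $\{G,G^*\}$ are $k_2(G,G^* )=k_2(G^*,G)=1$. $W\in\mathcal A$ is free Poisson of parameter $c$ if $W^*=W$ and $k_n(W,\dots,W)=c$ for all $n\ge1$. A family of elements (or of subsets) of $\mathcal A$ is $*$-free if the unital $*$-subalgebras they generate are free with respect to $\varphi$. The family $(U_r,G_r,W_r)_{r=1}^s$ in $(\mathcal A,\varphi)$ is such that each $U_r$ is a Haar unitary, each $G_r$ is standard circular, each $W_r$ is free Poisson of parameter $c$, and the families $U_1,G_1,\dots,U_s,G_s$ and $U_1,W_1,\dots,U_s,W_s$ are each $*$-free. For a monomial $\alpha$ in the $U_r,G_r,W_r$ and their adjoints, $\alpha^{(M,N)}$ denotes the random $N\times N$ matrix obtained by replacing each $U_r$ by $U_r^{(N)}$, each $G_r$ by $G_r^{(N)}$, each $W_r$ by $W_r^{(M,N)}$ (and adjoints by adjoints). Families of random matrices are called asymptotically $*$-free (as $M,N\to\infty$ with $M/N\to c$) if they converge in $*$-distribution, in the sense displayed in the claim, to a $*$-free family. *)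

theory Defs
  imports
    "HOL-Probability.Probability"
    "Jordan_Normal_Form.Schur_Decomposition"
begin

section \<open>Random matrices\<close>

text \<open>The Borel sigma-algebra on complex m by n matrices, generated by the entries.\<close>

definition mat_borel :: "nat \<Rightarrow> nat \<Rightarrow> complex Matrix.mat measure" where
  "mat_borel m n = vimage_algebra (carrier_mat m n)
     (\<lambda>A. \<lambda>ij \<in> {..<m} \<times> {..<n}. A $$ ij) (\<Pi>\<^sub>M ij \<in> {..<m} \<times> {..<n}. borel)"

definition normalized_trace :: "complex Matrix.mat \<Rightarrow> complex" where
  "normalized_trace A = (\<Sum>i<dim_row A. A $$ (i, i)) / of_nat (dim_row A)"

definition complex_standard_gaussian :: "'w measure \<Rightarrow> ('w \<Rightarrow> complex) \<Rightarrow> bool" where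
  "complex_standard_gaussian P Z \<longleftrightarrow>
     prob_space.indep_var P borel (\<lambda>\<omega>. Re (Z \<omega>)) borel (\<lambda>\<omega>. Im (Z \<omega>)) \<and>
     distributed P lborel (\<lambda>\<omega>. Re (Z \<omega>)) (normal_density 0 (sqrt (1 / 2))) \<and>
     distributed P lborel (\<lambda>\<omega>. Im (Z \<omega>)) (normal_density 0 (sqrt (1 / 2)))"

text \<open>
  The matrix index r runs through 1, ..., s, while rows and columns are numbered from 0, as always
  for the matrices of \<^theory>\<open>Jordan_Normal_Form.Matrix\<close>; so \<open>f r i j\<close> is the entry
  in row \<open>i + 1\<close> and column \<open>j + 1\<close> of the usual numbering.
\<close>

definition gaussian_mat ::
  "(nat \<Rightarrow> nat \<Rightarrow> nat \<Rightarrow> 'w \<Rightarrow> complex) \<Rightarrow> nat \<Rightarrow> nat \<Rightarrow> nat \<Rightarrow> 'w \<Rightarrow> complex Matrix.mat" where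
  "gaussian_mat f M N r \<omega> = Matrix.mat M N (\<lambda>(i, j). f r i j \<omega>)"

definition ginibre_mat ::
  "(nat \<Rightarrow> nat \<Rightarrow> nat \<Rightarrow> 'w \<Rightarrow> complex) \<Rightarrow> nat \<Rightarrow> nat \<Rightarrow> 'w \<Rightarrow> complex Matrix.mat" where
  "ginibre_mat f N r \<omega> = complex_of_real (1 / sqrt (real N)) \<cdot>\<^sub>m gaussian_mat f N N r \<omega>"

definition wishart_mat ::
  "(nat \<Rightarrow> nat \<Rightarrow> nat \<Rightarrow> 'w \<Rightarrow> complex) \<Rightarrow> nat \<Rightarrow> nat \<Rightarrow> nat \<Rightarrow> 'w \<Rightarrow> complex Matrix.mat" where
  "wishart_mat f M N r \<omega> = complex_of_real (1 / real N) \<cdot>\<^sub>m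
     (mat_adjoint (gaussian_mat f M N r \<omega>) * gaussian_mat f M N r \<omega>)"

definition permutation_mat :: "nat \<Rightarrow> (nat \<Rightarrow> nat) \<Rightarrow> complex Matrix.mat" where
  "permutation_mat N p = Matrix.mat N N (\<lambda>(i, j). if i = p j then 1 else 0)"

definition permutation_mats :: "nat \<Rightarrow> complex Matrix.mat set" where
  "permutation_mats N = permutation_mat N ` {p. p permutes {..<N}}"

definition uniform_permutation_mat ::
  "'w measure \<Rightarrow> nat \<Rightarrow> ('w \<Rightarrow> complex Matrix.mat) \<Rightarrow> bool" where
  "uniform_permutation_mat P N X \<longleftrightarrow>
     X \<in> measurable P (count_space (permutation_mats N)) \<and>
     distr P (count_space (permutation_mats N)) X = uniform_count_measure (permutation_mats N)"

section \<open>Non-commutative *-probability spaces\<close>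

text \<open>
  The requirement \<open>0 \<noteq> 1\<close> of the class \<^class>\<open>ring_1\<close> is no restriction,
  because a unital linear functional cannot exist on the zero algebra.
\<close>

locale nc_star_probability_space = Vector_Spaces.linear cscale "(*)" \<phi>
  for cscale :: "complex \<Rightarrow> 'a::ring_1 \<Rightarrow> 'a" and \<phi> :: "'a \<Rightarrow> complex" +
  fixes star :: "'a \<Rightarrow> 'a"
  assumes cscale_mult_left: "cscale z a * b = cscale z (a * b)"
    and cscale_mult_right: "a * cscale z b = cscale z (a * b)"
    and star_add: "star (a + b) = star a + star b"
    and star_cscale: "star (cscale z a) = cscale (cnj z) (star a)"
    and star_mult: "star (a * b) = star b * star a"
    and star_star: "star (star a) = a"
    and unital: "\<phi> 1 = 1"
    and tracial: "\<phi> (a * b) = \<phi> (b * a)"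
    and positive: "\<phi> (star a * a) \<in> \<real>\<^sub>\<ge>\<^sub>0"

subsection \<open>Free cumulants\<close>

definition noncrossing_partitions :: "nat \<Rightarrow> nat set set set" where
  "noncrossing_partitions n = {\<pi>. partition_on {..<n} \<pi> \<and>
     (\<forall>V\<in>\<pi>. \<forall>W\<in>\<pi>. V \<noteq> W \<longrightarrow>
        \<not> (\<exists>i\<in>V. \<exists>j\<in>W. \<exists>k\<in>V. \<exists>l\<in>W. i < j \<and> j < k \<and> k < l))}"

lemma length_nths_proper_block:
  assumes "\<pi> \<in> noncrossing_partitions n - {{{..<n}}}" "V \<in> \<pi>" "length xs = n"
  shows "length (nths xs V) < n"
proof -
  have p: "partition_on {..<n} \<pi>" and ne: "\<pi> \<noteq> {{..<n}}"
    using assms(1) unfolding noncrossing_partitions_def by blast+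
  have sub: "V \<subseteq> {..<n}"
    using partition_onD1[OF p] assms(2) by blast
  have "V \<noteq> {..<n}"
  proof
    assume V: "V = {..<n}"
    have "W = V" if "W \<in> \<pi>" for W
    proof (rule ccontr)
      assume "W \<noteq> V"
      then have "W \<inter> V = {}"
        using partition_onD2[OF p] that assms(2) by (simp add: disjointD)
      moreover have "W \<noteq> {}"
        using partition_onD3[OF p] that by blast
      moreover have "W \<subseteq> {..<n}"
        using partition_onD1[OF p] that by blast
      ultimately show False using V by blast
    qed
    then have "\<pi> = {V}" using assms(2) by blast
    then show False using ne V by simp
  qed
  then have "V \<subset> {..<n}" using sub by blast
  then have "card V < n"
    using psubset_card_mono[of "{..<n}" V] by simp
  moreover have "{i. i < length xs \<and> i \<in> V} = V"
    using sub assms(3) by blast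
  ultimately show ?thesis by (simp add: length_nths)
qed

text \<open>
  The moment-cumulant formula, solved for the summand of the one-block partition; \<open>nths xs V\<close>
  lists the entries of \<open>xs\<close> at the (0-based) positions in \<open>V\<close>, in increasing order.
\<close>

function free_cumulant :: "('a::ring_1 \<Rightarrow> complex) \<Rightarrow> 'a list \<Rightarrow> complex" where
  "free_cumulant \<phi> xs = \<phi> (prod_list xs) -
     (\<Sum>\<pi> \<in> noncrossing_partitions (length xs) - {{{..<length xs}}}.
        \<Prod>V\<in>\<pi>. free_cumulant \<phi> (nths xs V))"
  by auto
termination
proof (relation "Wellfounded.measure (\<lambda>(\<phi>, xs). length xs)", goal_cases)
  case 1
  show ?case by simp
next
  case (2 \<phi> xs \<pi> V)
  then show ?case
    using length_nths_proper_block[OF 2 refl] by simp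
qed

declare free_cumulant.simps [simp del]

lemma finite_noncrossing_partitions: "finite (noncrossing_partitions n)"
  by (rule finite_subset[of _ "Pow (Pow {..<n})"])
     (auto simp: noncrossing_partitions_def partition_on_def)

lemma one_block_noncrossing: "n > 0 \<Longrightarrow> {{..<n}} \<in> noncrossing_partitions n"
  by (auto simp: noncrossing_partitions_def partition_on_def)

lemma moment_cumulant:
  assumes "xs \<noteq> []"
  shows "\<phi> (prod_list xs) =
    (\<Sum>\<pi> \<in> noncrossing_partitions (length xs). \<Prod>V\<in>\<pi>. free_cumulant \<phi> (nths xs V))"
proof -
  have *: "nths xs {..<length xs} = xs"
    by (subst nths_upt_eq_take) simp
  have "(\<Sum>\<pi> \<in> noncrossing_partitions (length xs). \<Prod>V\<in>\<pi>. free_cumulant \<phi> (nths xs V)) =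
    (\<Prod>V\<in>{{..<length xs}}. free_cumulant \<phi> (nths xs V)) +
    (\<Sum>\<pi> \<in> noncrossing_partitions (length xs) - {{{..<length xs}}}.
        \<Prod>V\<in>\<pi>. free_cumulant \<phi> (nths xs V))"
    using assms
    by (intro sum.remove finite_noncrossing_partitions one_block_noncrossing) simp
  also have "\<dots> = \<phi> (prod_list xs)"
    using free_cumulant.simps[of \<phi> xs] * by simp
  finally show ?thesis by simp
qed

lemma free_cumulant_unique:
  assumes "\<And>xs. xs \<noteq> [] \<Longrightarrow> \<phi> (prod_list xs) =
    (\<Sum>\<pi> \<in> noncrossing_partitions (length xs). \<Prod>V\<in>\<pi>. k (nths xs V))"
  shows "xs \<noteq> [] \<Longrightarrow> k xs = free_cumulant \<phi> xs"
proof (induction "length xs" arbitrary: xs rule: less_induct)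
  case less
  let ?n = "length xs"
  have *: "nths xs {..<?n} = xs"
    by (subst nths_upt_eq_take) simp
  have "(\<Prod>V\<in>\<pi>. k (nths xs V)) = (\<Prod>V\<in>\<pi>. free_cumulant \<phi> (nths xs V))"
    if \<pi>: "\<pi> \<in> noncrossing_partitions ?n - {{{..<?n}}}" for \<pi>
  proof (rule prod.cong[OF refl])
    fix V assume V: "V \<in> \<pi>"
    have "V \<noteq> {}" "V \<subseteq> {..<?n}"
      using \<pi> V by (auto simp: noncrossing_partitions_def partition_on_def)
    then obtain i where "i \<in> V" "i < length xs" by auto
    then have "xs ! i \<in> set (nths xs V)" by (auto simp: set_nths)
    then have "nths xs V \<noteq> []" by auto
    then show "k (nths xs V) = free_cumulant \<phi> (nths xs V)"
      using less.hyps[OF length_nths_proper_block[OF \<pi> V refl]] by simp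
  qed
  then have eq: "(\<Sum>\<pi> \<in> noncrossing_partitions ?n - {{{..<?n}}}. \<Prod>V\<in>\<pi>. k (nths xs V)) =
      (\<Sum>\<pi> \<in> noncrossing_partitions ?n - {{{..<?n}}}. \<Prod>V\<in>\<pi>. free_cumulant \<phi> (nths xs V))"
    by (rule sum.cong[OF refl])
  have "\<phi> (prod_list xs) =
      (\<Sum>\<pi> \<in> noncrossing_partitions ?n. \<Prod>V\<in>\<pi>. k (nths xs V))"
    by (rule assms[OF less.prems])
  also have "\<dots> = (\<Prod>V\<in>{{..<?n}}. k (nths xs V)) +
      (\<Sum>\<pi> \<in> noncrossing_partitions ?n - {{{..<?n}}}. \<Prod>V\<in>\<pi>. k (nths xs V))"
    using less.prems
    by (intro sum.remove finite_noncrossing_partitions one_block_noncrossing) simp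
  also have "(\<Prod>V\<in>{{..<?n}}. k (nths xs V)) = k xs"
    using * by simp
  finally have "k xs = \<phi> (prod_list xs) -
      (\<Sum>\<pi> \<in> noncrossing_partitions ?n - {{{..<?n}}}.
         \<Prod>V\<in>\<pi>. free_cumulant \<phi> (nths xs V))"
    unfolding eq by (simp only: add_diff_cancel_right')
  then show ?case
    by (simp only: free_cumulant.simps[of \<phi> xs])
qed

subsection \<open>The limit variables\<close>

text \<open>For a unitary, the power with exponent \<open>-n\<close> is the \<open>n\<close>-th power of the adjoint.\<close>

definition haar_unitary :: "('a::ring_1 \<Rightarrow> complex) \<Rightarrow> ('a \<Rightarrow> 'a) \<Rightarrow> 'a \<Rightarrow> bool" where
  "haar_unitary \<phi> star u \<longleftrightarrow> star u * u = 1 \<and> u * star u = 1 \<and>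
     (\<forall>n::nat. n > 0 \<longrightarrow> \<phi> (u ^ n) = 0 \<and> \<phi> (star u ^ n) = 0)"

text \<open>
  In a list of booleans, \<^const>\<open>False\<close> stands for \<open>g\<close> and \<^const>\<open>True\<close> for its
  adjoint. Quantifying over such formal words, instead of over lists with entries in the set
  \<open>{g, star g}\<close>, makes the cumulant of \<open>[g, g]\<close> vanish even when \<open>g\<close> is self-adjoint, and so
  rules out self-adjoint \<open>g\<close>.
\<close>

definition standard_circular :: "('a::ring_1 \<Rightarrow> complex) \<Rightarrow> ('a \<Rightarrow> 'a) \<Rightarrow> 'a \<Rightarrow> bool" where
  "standard_circular \<phi> star g \<longleftrightarrow>
     (\<forall>bs. bs \<noteq> [] \<longrightarrow> free_cumulant \<phi> (map (\<lambda>b. if b then star g else g) bs) =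
        (if bs = [False, True] \<or> bs = [True, False] then 1 else 0))"

definition free_poisson :: "('a::ring_1 \<Rightarrow> complex) \<Rightarrow> ('a \<Rightarrow> 'a) \<Rightarrow> real \<Rightarrow> 'a \<Rightarrow> bool" where
  "free_poisson \<phi> star c w \<longleftrightarrow> star w = w \<and>
     (\<forall>n\<ge>1. free_cumulant \<phi> (replicate n w) = complex_of_real c)"

inductive_set star_subalgebra ::
  "(complex \<Rightarrow> 'a::ring_1 \<Rightarrow> 'a) \<Rightarrow> ('a \<Rightarrow> 'a) \<Rightarrow> 'a set \<Rightarrow> 'a set"
  for cscale star S where
  gen: "a \<in> S \<Longrightarrow> a \<in> star_subalgebra cscale star S"
| one: "1 \<in> star_subalgebra cscale star S"
| add: "a \<in> star_subalgebra cscale star S \<Longrightarrow> b \<in> star_subalgebra cscale star S \<Longrightarrow>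
    a + b \<in> star_subalgebra cscale star S"
| scale: "a \<in> star_subalgebra cscale star S \<Longrightarrow> cscale z a \<in> star_subalgebra cscale star S"
| mult: "a \<in> star_subalgebra cscale star S \<Longrightarrow> b \<in> star_subalgebra cscale star S \<Longrightarrow>
    a * b \<in> star_subalgebra cscale star S"
| star: "a \<in> star_subalgebra cscale star S \<Longrightarrow> star a \<in> star_subalgebra cscale star S"

text \<open>
  Freeness: \<open>\<phi>\<close> vanishes on alternating products of centred elements; a pair \<open>(i, a)\<close> is an
  element \<open>a\<close> taken from the subalgebra with index \<open>i\<close>.
\<close>

definition free_subalgebras ::
  "('a::ring_1 \<Rightarrow> complex) \<Rightarrow> 'i set \<Rightarrow> ('i \<Rightarrow> 'a set) \<Rightarrow> bool" where
  "free_subalgebras \<phi> I B \<longleftrightarrow>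
     (\<forall>ps. ps \<noteq> [] \<longrightarrow> distinct_adj (map fst ps) \<longrightarrow>
        (\<forall>(i, a) \<in> set ps. i \<in> I \<and> a \<in> B i \<and> \<phi> a = 0) \<longrightarrow>
        \<phi> (prod_list (map snd ps)) = 0)"

definition star_free ::
  "(complex \<Rightarrow> 'a::ring_1 \<Rightarrow> 'a) \<Rightarrow> ('a \<Rightarrow> complex) \<Rightarrow> ('a \<Rightarrow> 'a) \<Rightarrow> 'i set \<Rightarrow> ('i \<Rightarrow> 'a) \<Rightarrow> bool"
  where
  "star_free cscale \<phi> star I x \<longleftrightarrow>
     free_subalgebras \<phi> I (\<lambda>i. star_subalgebra cscale star {x i})"

section \<open>Convergence in *-distribution\<close>

text \<open>
  A monomial is a list of letters \<open>(i, b)\<close>, where \<open>b\<close> says whether the adjoint of the variable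
  with index \<open>i\<close> is meant.
\<close>

definition eval_monomial :: "('a::ring_1 \<Rightarrow> 'a) \<Rightarrow> ('i \<Rightarrow> 'a) \<Rightarrow> ('i \<times> bool) list \<Rightarrow> 'a" where
  "eval_monomial star x \<alpha> = prod_list (map (\<lambda>(i, b). if b then star (x i) else x i) \<alpha>)"

definition eval_monomial_mat ::
  "nat \<Rightarrow> ('i \<Rightarrow> complex Matrix.mat) \<Rightarrow> ('i \<times> bool) list \<Rightarrow> complex Matrix.mat" where
  "eval_monomial_mat N X \<alpha> =
     foldr (\<lambda>(i, b) A. (if b then mat_adjoint (X i) else X i) * A) \<alpha> (1\<^sub>m N)"

text \<open>
  Here \<open>X M N i\<close> is a random N by N matrix. Integrability is stated because
  \<^const>\<open>lebesgue_integral\<close> is 0 by convention for a function that is not integrable.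
\<close>

definition converges_in_star_distribution ::
  "'w measure \<Rightarrow> real \<Rightarrow> 'i set \<Rightarrow> (nat \<Rightarrow> nat \<Rightarrow> 'i \<Rightarrow> 'w \<Rightarrow> complex Matrix.mat) \<Rightarrow>
   ('a::ring_1 \<Rightarrow> complex) \<Rightarrow> ('a \<Rightarrow> 'a) \<Rightarrow> ('i \<Rightarrow> 'a) \<Rightarrow> bool" where
  "converges_in_star_distribution P c I X \<phi> star x \<longleftrightarrow>
     (\<forall>M N :: nat \<Rightarrow> nat.
        strict_mono M \<and> strict_mono N \<and> (\<forall>q. M q \<ge> 1) \<and> (\<forall>q. N q \<ge> 1) \<and>
        (\<lambda>q. real (M q) / real (N q)) \<longlonglongrightarrow> c \<longrightarrow>
        (\<forall>\<alpha> :: ('i \<times> bool) list. fst ` set \<alpha> \<subseteq> I \<longrightarrow>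
           (\<forall>q. integrable P (\<lambda>\<omega>. normalized_trace
              (eval_monomial_mat (N q) (\<lambda>i. X (M q) (N q) i \<omega>) \<alpha>))) \<and>
           (\<lambda>q. prob_space.expectation P (\<lambda>\<omega>. normalized_trace
              (eval_monomial_mat (N q) (\<lambda>i. X (M q) (N q) i \<omega>) \<alpha>)))
             \<longlonglongrightarrow> \<phi> (eval_monomial star x \<alpha>)))"

definition asymptotically_star_free ::
  "'w measure \<Rightarrow> real \<Rightarrow> 'i set \<Rightarrow> (nat \<Rightarrow> nat \<Rightarrow> 'i \<Rightarrow> 'w \<Rightarrow> complex Matrix.mat) \<Rightarrow>
   (complex \<Rightarrow> 'a::ring_1 \<Rightarrow> 'a) \<Rightarrow> ('a \<Rightarrow> complex) \<Rightarrow> ('a \<Rightarrow> 'a) \<Rightarrow> bool" where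
  "asymptotically_star_free P c I X cscale \<phi> star \<longleftrightarrow>
     (\<exists>x. star_free cscale \<phi> star I x \<and> converges_in_star_distribution P c I X \<phi> star x)"

end

theory Submission
  imports Defs
begin

text \<open>
  Integration by parts for the Gaussian entries gives Schwinger-Dyson equations for the expected
  products of normalized traces of words. For a Ginibre matrix \<open>G\<close> of size \<open>N\<close>,
  \<open>E (tr (G w) \<Prod>\<^sub>j tr w\<^sub>j)\<close> is the sum of \<open>E (tr u tr v \<Prod>\<^sub>j tr w\<^sub>j)\<close> over the decompositions
  \<open>w = u G\<^sup>* v\<close>, up to \<open>1 / N\<^sup>2\<close> times terms in which \<open>w\<close> is merged with some \<open>w\<^sub>j\<close>; for a Wishart
  matrix, \<open>E (tr (W w) \<dots>)\<close> is \<open>(M / N) E (tr w \<dots>)\<close> plus the sum of \<open>E (tr u tr (W v) \<dots>)\<close> over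
  \<open>w = u W v\<close>. By induction on the number of Gaussian letters this reduces the limit to words in
  the permutation matrices. A non-trivial reduced word in independent uniform permutations has
  few fixed points in expectation, since a path that closes up can be switched to end at almost any
  other point instead. The limit variables satisfy the same equations: for words in one variable
  they are the decomposition of a non-crossing partition according to its first block, and freeness
  extends them to all words.
\<close>

section \<open>Non-crossing partitions\<close>

text \<open>A cut at a Gaussian letter turns one trace into two, so the recursion closes only on
  products of traces. The limit of such a product factorizes without any variance estimate: in the
  base case a word in the permutations either reduces to the empty word, with trace 1, or its mean
  trace tends to 0, and as all fractions of fixed points lie between 0 and 1, one word of the second
  kind forces the whole product to 0. On the side of the limit algebra the obstacle is that the
  elements of a star-subalgebra may satisfy unknown relations, so a derivation on it need not be
  well defined. The derivative is therefore attached to a way of building the element, as a list of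
  tensors. On the random side, too, derivatives are relations between polynomial functions. The
  Gaussian equations are derived with the permutations frozen, and averaged afterwards. Products of
  traces occur only in this averaged model; independence is used once, to identify its single-trace
  moments with those of the random matrices.\<close>

definition nc_on :: "nat set \<Rightarrow> nat set set set" where
  "nc_on A = {\<pi>. partition_on A \<pi> \<and>
     (\<forall>V\<in>\<pi>. \<forall>W\<in>\<pi>. V \<noteq> W \<longrightarrow>
        \<not> (\<exists>i\<in>V. \<exists>j\<in>W. \<exists>k\<in>V. \<exists>l\<in>W. i < j \<and> j < k \<and> k < l))}"

text \<open>The weight depends on the block as a set of positions, and the ground set is arbitrary:
  the recursion below passes to subintervals without renumbering and changes the weight of one
  block. With free cumulants as weights the value is a moment.\<close>

definition ncsum :: "(nat set \<Rightarrow> complex) \<Rightarrow> nat set \<Rightarrow> complex" where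
  "ncsum \<kappa> A = (\<Sum>\<pi>\<in>nc_on A. \<Prod>V\<in>\<pi>. \<kappa> V)"

lemma noncrossing_partitions_eq_nc_on: "noncrossing_partitions n = nc_on {0..<n}"
  by (simp add: noncrossing_partitions_def nc_on_def lessThan_atLeast0)

lemma finite_nc_on: "finite A \<Longrightarrow> finite (nc_on A)"
  by (rule finite_subset[of _ "Pow (Pow A)"]) (auto simp: nc_on_def partition_on_def)

lemma nc_onD:
  assumes "\<pi> \<in> nc_on A"
  shows "\<Union>\<pi> = A" "\<And>V. V \<in> \<pi> \<Longrightarrow> V \<noteq> {}" "\<And>V W x. V \<in> \<pi> \<Longrightarrow> W \<in> \<pi> \<Longrightarrow> x \<in> V \<Longrightarrow> x \<in> W \<Longrightarrow> V = W"
    "\<And>V W i j k l. V \<in> \<pi> \<Longrightarrow> W \<in> \<pi> \<Longrightarrow> i \<in> V \<Longrightarrow> j \<in> W \<Longrightarrow> k \<in> V \<Longrightarrow> l \<in> W \<Longrightarrow>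
       i < j \<Longrightarrow> j < k \<Longrightarrow> k < l \<Longrightarrow> V = W"
    "\<And>V. V \<in> \<pi> \<Longrightarrow> V \<subseteq> A"
proof -
  show "\<Union>\<pi> = A" "\<And>V. V \<in> \<pi> \<Longrightarrow> V \<noteq> {}"
    using assms by (auto simp: nc_on_def partition_on_def)
  show "V = W" if "V \<in> \<pi>" "W \<in> \<pi>" "x \<in> V" "x \<in> W" for V W x
    using assms that unfolding nc_on_def partition_on_def disjoint_def by blast
  show "V = W" if "V \<in> \<pi>" "W \<in> \<pi>" "i \<in> V" "j \<in> W" "k \<in> V" "l \<in> W" "i < j" "j < k" "k < l" for V W i j k l
    using assms that unfolding nc_on_def by blast
  show "\<And>V. V \<in> \<pi> \<Longrightarrow> V \<subseteq> A"
    using assms by (auto simp: nc_on_def partition_on_def)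
qed

lemma nc_onI:
  assumes "\<Union>\<pi> = A" "\<And>V. V \<in> \<pi> \<Longrightarrow> V \<noteq> {}" "\<And>V W x. V \<in> \<pi> \<Longrightarrow> W \<in> \<pi> \<Longrightarrow> x \<in> V \<Longrightarrow> x \<in> W \<Longrightarrow> V = W"
    "\<And>V W i j k l. V \<in> \<pi> \<Longrightarrow> W \<in> \<pi> \<Longrightarrow> i \<in> V \<Longrightarrow> j \<in> W \<Longrightarrow> k \<in> V \<Longrightarrow> l \<in> W \<Longrightarrow>
       i < j \<Longrightarrow> j < k \<Longrightarrow> k < l \<Longrightarrow> V = W"
  shows "\<pi> \<in> nc_on A"
proof -
  have "partition_on A \<pi>"
    unfolding partition_on_def disjoint_def using assms(1-3) by blast
  then show ?thesis
    unfolding nc_on_def using assms(4) by blast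
qed

lemma nc_on_empty: "nc_on {} = {{}}"
  by (auto simp: nc_on_def partition_on_def)

lemma ncsum_empty [simp]: "ncsum \<kappa> {} = 1"
  by (simp add: ncsum_def nc_on_empty)

lemma ncsum_cong:
  assumes "\<And>V. V \<noteq> {} \<Longrightarrow> V \<subseteq> A \<Longrightarrow> \<kappa> V = \<kappa>' V"
  shows "ncsum \<kappa> A = ncsum \<kappa>' A"
  unfolding ncsum_def
  by (intro sum.cong prod.cong refl assms) (auto dest: nc_onD)

text \<open>Needed to identify the sum over an interval of positions with the moment of the
  corresponding subword, whose positions are numbered from 0.\<close>

lemma ncsum_shift: "ncsum \<kappa> ((+) m ` A) = ncsum (\<lambda>V. \<kappa> ((+) m ` V)) A"
proof -
  have inj: "inj ((+) m)" by simp
  have 1: "(`) ((+) m) ` \<pi> \<in> nc_on ((+) m ` A)" if "\<pi> \<in> nc_on A" for \<pi>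
  proof (rule nc_onI)
    show "\<Union>((`) ((+) m) ` \<pi>) = (+) m ` A" using nc_onD(1)[OF that] by blast
    show "V = W" if h: "V \<in> (`) ((+) m) ` \<pi>" "W \<in> (`) ((+) m) ` \<pi>" "x \<in> V" "x \<in> W" for V W x
    proof -
      obtain V' W' where *: "V = (+) m ` V'" "W = (+) m ` W'" "V' \<in> \<pi>" "W' \<in> \<pi>" using h by auto
      obtain x' where "x' \<in> V'" "x' \<in> W'" using h * by auto
      then have "V' = W'" using nc_onD(3)[OF \<open>\<pi> \<in> nc_on A\<close> *(3,4)] by blast
      then show ?thesis using * by simp
    qed
    show "V = W" if h: "V \<in> (`) ((+) m) ` \<pi>" "W \<in> (`) ((+) m) ` \<pi>" "i \<in> V" "j \<in> W" "k \<in> V" "l \<in> W"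
         "i < j" "j < k" "k < l" for V W i j k l
    proof -
      obtain V' W' where *: "V = (+) m ` V'" "W = (+) m ` W'" "V' \<in> \<pi>" "W' \<in> \<pi>" using h by auto
      obtain i' j' k' l' where "i' \<in> V'" "j' \<in> W'" "k' \<in> V'" "l' \<in> W'"
        "i = m + i'" "j = m + j'" "k = m + k'" "l = m + l'" using h * by blast
      then have "V' = W'"
        using nc_onD(4)[OF \<open>\<pi> \<in> nc_on A\<close> *(3,4), of i' j' k' l'] h by simp
      then show ?thesis using * by simp
    qed
  qed (use nc_onD(2)[OF that] in auto)
  have 2: "(`) ((+) m) -` \<pi> \<in> nc_on A \<and> (`) ((+) m) ` ((`) ((+) m) -` \<pi>) = \<pi>"
    if \<pi>: "\<pi> \<in> nc_on ((+) m ` A)" for \<pi>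
  proof -
    have ex: "\<exists>V'. V = (+) m ` V'" if "V \<in> \<pi>" for V
      using nc_onD(5)[OF \<pi> that] by (metis subset_imageE)
    then have *: "(`) ((+) m) ` ((`) ((+) m) -` \<pi>) = \<pi>"
      by (auto simp: image_iff)
    have U: "\<Union> ((`) ((+) m) -` \<pi>) = A"
    proof -
      have "(+) m ` \<Union> ((`) ((+) m) -` \<pi>) = \<Union> ((`) ((+) m) ` ((`) ((+) m) -` \<pi>))" by blast
      also have "\<dots> = (+) m ` A" using * nc_onD(1)[OF \<pi>] by simp
      finally show ?thesis by (simp add: inj_image_eq_iff)
    qed
    have "(`) ((+) m) -` \<pi> \<in> nc_on A"
    proof (rule nc_onI[OF U])
      show "V \<noteq> {}" if "V \<in> (`) ((+) m) -` \<pi>" for V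
        using nc_onD(2)[OF \<pi>] that by auto
      show "V = W" if "V \<in> (`) ((+) m) -` \<pi>" "W \<in> (`) ((+) m) -` \<pi>" "x \<in> V" "x \<in> W" for V W x
      proof -
        have "(+) m ` V = (+) m ` W" by (rule nc_onD(3)[OF \<pi>, where x="m+x"]) (use that in auto)
        then show ?thesis by (simp add: inj_image_eq_iff)
      qed
      show "V = W" if "V \<in> (`) ((+) m) -` \<pi>" "W \<in> (`) ((+) m) -` \<pi>" "i \<in> V" "j \<in> W" "k \<in> V" "l \<in> W"
         "i < j" "j < k" "k < l" for V W i j k l
      proof -
        have "(+) m ` V = (+) m ` W"
          by (rule nc_onD(4)[OF \<pi>, where i="m+i" and j="m+j" and k="m+k" and l="m+l"]) (use that in auto)
        then show ?thesis by (simp add: inj_image_eq_iff)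
      qed
    qed
    with * show ?thesis by blast
  qed
  have injim: "inj ((`) ((+) m))" by (simp add: inj_image_eq_iff inj_def)
  show ?thesis unfolding ncsum_def
  proof (rule sum.reindex_bij_witness[where i="\<lambda>\<pi>. (`) ((+) m) ` \<pi>" and j="\<lambda>\<pi>. (`) ((+) m) -` \<pi>"])
    fix \<pi> assume "\<pi> \<in> nc_on A"
    show "(`) ((+) m) -` ((`) ((+) m) ` \<pi>) = \<pi>"
      using injim by (simp add: inj_vimage_image_eq)
  next
    fix \<pi> assume \<pi>: "\<pi> \<in> nc_on ((+) m ` A)"
    have "(\<Prod>V\<in>\<pi>. \<kappa> V) = (\<Prod>V\<in>(`) ((+) m) ` ((`) ((+) m) -` \<pi>). \<kappa> V)"
      using 2[OF \<pi>] by simp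
    also have "\<dots> = (\<Prod>V\<in>(`) ((+) m) -` \<pi>. \<kappa> ((+) m ` V))"
      using injim by (subst prod.reindex) (auto intro: inj_on_subset)
    finally show "(\<Prod>V\<in>(`) ((+) m) -` \<pi>. \<kappa> ((+) m ` V)) = (\<Prod>V\<in>\<pi>. \<kappa> V)" by simp
  qed (use 1 2 in auto)
qed

lemma nc_on_singleton_iff:
  assumes "a < b"
  shows "{\<pi> \<in> nc_on {a..<b}. {a} \<in> \<pi>} = insert {a} ` nc_on {Suc a..<b}"
proof (intro equalityI subsetI)
  fix \<pi> assume "\<pi> \<in> {\<pi> \<in> nc_on {a..<b}. {a} \<in> \<pi>}"
  then have \<pi>: "\<pi> \<in> nc_on {a..<b}" and a: "{a} \<in> \<pi>" by auto
  have ab: "{a..<b} = insert a {Suc a..<b}" using assms by auto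
  have *: "a \<notin> V" if "V \<in> \<pi> - {{a}}" for V
    using nc_onD(3)[OF \<pi> _ a, of V a] that by auto
  have "\<pi> - {{a}} \<in> nc_on {Suc a..<b}"
  proof (rule nc_onI)
    show "\<Union>(\<pi> - {{a}}) = {Suc a..<b}"
    proof -
      have "\<Union>(\<pi> - {{a}}) = \<Union>\<pi> - {a}" using * a by blast
      also have "\<dots> = {Suc a..<b}" unfolding nc_onD(1)[OF \<pi>] by auto
      finally show ?thesis .
    qed
    show "V = W" if h: "V \<in> \<pi> - {{a}}" "W \<in> \<pi> - {{a}}" "x \<in> V" "x \<in> W" for V W x
      by (rule nc_onD(3)[OF \<pi>, of V W x]) (use h in auto)
    show "V = W" if h: "V \<in> \<pi> - {{a}}" "W \<in> \<pi> - {{a}}" "i \<in> V" "j \<in> W" "k \<in> V" "l \<in> W"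
         "i < j" "j < k" "k < l" for V W i j k l
      by (rule nc_onD(4)[OF \<pi>, of V W i j k l]) (use h in auto)
  qed (use nc_onD(2)[OF \<pi>] in auto)
  moreover have "\<pi> = insert {a} (\<pi> - {{a}})" using a by auto
  ultimately show "\<pi> \<in> insert {a} ` nc_on {Suc a..<b}" by blast
next
  fix \<pi> assume "\<pi> \<in> insert {a} ` nc_on {Suc a..<b}"
  then obtain \<rho> where \<rho>: "\<rho> \<in> nc_on {Suc a..<b}" and \<pi>: "\<pi> = insert {a} \<rho>" by auto
  have "\<pi> \<in> nc_on {a..<b}"
  proof (rule nc_onI)
    show "\<Union>\<pi> = {a..<b}" using nc_onD(1)[OF \<rho>] \<pi> assms by auto
    have na: "a \<notin> V" if "V \<in> \<rho>" for V using nc_onD(5)[OF \<rho> that] by auto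
    show "V = W" if "V \<in> \<pi>" "W \<in> \<pi>" "x \<in> V" "x \<in> W" for V W x
      using that na nc_onD(3)[OF \<rho>] unfolding \<pi> by auto
    show "V = W" if h: "V \<in> \<pi>" "W \<in> \<pi>" "i \<in> V" "j \<in> W" "k \<in> V" "l \<in> W"
         "i < j" "j < k" "k < l" for V W i j k l
    proof -
      have "V \<noteq> {a}" using h(3,5,7,8) by auto
      moreover have "W \<noteq> {a}" using h(4,6,8,9) by auto
      ultimately have "V \<in> \<rho>" "W \<in> \<rho>" using h(1,2) \<pi> by auto
      then show ?thesis by (rule nc_onD(4)[OF \<rho>, of V W i j k l]) (use h in auto)
    qed
  qed (use \<pi> nc_onD(2)[OF \<rho>] in auto)
  then show "\<pi> \<in> {\<pi> \<in> nc_on {a..<b}. {a} \<in> \<pi>}" using \<pi> by auto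
qed

section \<open>Splitting a non-crossing partition at the successor of its least point\<close>

definition nc_next :: "nat \<Rightarrow> nat \<Rightarrow> nat \<Rightarrow> nat set set set" where
  "nc_next a b k = {\<pi> \<in> nc_on {a..<b}. \<exists>V\<in>\<pi>. a \<in> V \<and> k \<in> V \<and> V \<inter> {a<..<k} = {}}"

lemma nc_on_decomp:
  assumes "a < b"
  shows "nc_on {a..<b} = {\<pi> \<in> nc_on {a..<b}. {a} \<in> \<pi>} \<union> (\<Union>k\<in>{a<..<b}. nc_next a b k)"
proof (intro equalityI subsetI)
  fix \<pi> assume \<pi>: "\<pi> \<in> nc_on {a..<b}"
  then obtain V where V: "V \<in> \<pi>" "a \<in> V" using nc_onD(1)[OF \<pi>] assms by (metis UnionE atLeastLessThan_iff le_refl)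
  show "\<pi> \<in> {\<pi> \<in> nc_on {a..<b}. {a} \<in> \<pi>} \<union> (\<Union>k\<in>{a<..<b}. nc_next a b k)"
  proof (cases "V = {a}")
    case True then show ?thesis using V \<pi> by auto
  next
    case False
    have sub: "V \<subseteq> {a..<b}" using nc_onD(5)[OF \<pi> V(1)] .
    then have fin: "finite V" using finite_subset by blast
    define k where "k = Min (V - {a})"
    have ne: "V - {a} \<noteq> {}" using False V by auto
    have k: "k \<in> V - {a}" using Min_in[of "V - {a}"] fin ne k_def by auto
    have le: "k \<le> x" if "x \<in> V - {a}" for x using fin that k_def by auto
    have "V \<inter> {a<..<k} = {}" using le by force
    then have "\<pi> \<in> nc_next a b k" using \<pi> V k unfolding nc_next_def by auto
    moreover have "k \<in> {a<..<b}" using k sub by force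
    ultimately show ?thesis by blast
  qed
qed (auto simp: nc_next_def)

text \<open>No block connects the gap between \<open>a\<close> and its successor \<open>k\<close>
  with the outside, so the gap carries a partition of its own. The rest lives on the points from
  \<open>k\<close> on once \<open>a\<close> is deleted; it can be put back, because it belongs to
  the block of \<open>k\<close>, and the changed weight accounts for it.\<close>

lemma sum_nc_next:
  assumes k: "a < k" "k < b"
  shows "(\<Sum>\<pi>\<in>nc_next a b k. \<Prod>V\<in>\<pi>. \<kappa> V) =
     ncsum \<kappa> {Suc a..<k} * ncsum (\<lambda>V. if k \<in> V then \<kappa> (insert a V) else \<kappa> V) {k..<b}"
proof -
  define g where "g V = (if k \<in> V then insert a V else V)" for V
  define glue where "glue = (\<lambda>(\<pi>1, \<pi>2). \<pi>1 \<union> g ` \<pi>2)"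
  define cut where "cut \<pi> = ({V \<in> \<pi>. V \<subseteq> {a<..<k}}, (\<lambda>V. V - {a}) ` {V \<in> \<pi>. \<not> V \<subseteq> {a<..<k}})" for \<pi> :: "nat set set"
  have I1: "{Suc a..<k} = {a<..<k}" by auto
  have glue: "glue (\<pi>1, \<pi>2) \<in> nc_next a b k" "cut (glue (\<pi>1, \<pi>2)) = (\<pi>1, \<pi>2)"
     "(\<Prod>V\<in>glue (\<pi>1, \<pi>2). \<kappa> V) = (\<Prod>V\<in>\<pi>1. \<kappa> V) * (\<Prod>V\<in>\<pi>2. \<kappa> (g V))"
    if p1: "\<pi>1 \<in> nc_on {a<..<k}" and p2: "\<pi>2 \<in> nc_on {k..<b}" for \<pi>1 \<pi>2
  proof -
    have s1: "V \<subseteq> {a<..<k}" "V \<noteq> {}" if "V \<in> \<pi>1" for V using nc_onD(2)[OF p1 that] nc_onD(5)[OF p1 that] by auto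
    have s2: "V \<subseteq> {k..<b}" "V \<noteq> {}" if "V \<in> \<pi>2" for V using nc_onD(2)[OF p2 that] nc_onD(5)[OF p2 that] by auto
    have na: "a \<notin> V" if "V \<in> \<pi>2" for V using s2[OF that] k by auto
    have g1: "x \<in> g V \<longleftrightarrow> x \<in> V \<or> (x = a \<and> k \<in> V)" for x V by (auto simp: g_def)
    obtain V0 where V0: "V0 \<in> \<pi>2" "k \<in> V0" using nc_onD(1)[OF p2] k
      by (metis UnionE atLeastLessThan_iff le_refl)
    \<comment> \<open>Reinserting \<open>a\<close> creates no crossing: one that starts at
      \<open>a\<close> yields a crossing that starts at \<open>k\<close>, or else \<open>k\<close>
      is a common point of both blocks.\<close>
    have nc2: "V = W" if "V \<in> \<pi>2" "W \<in> \<pi>2" "i \<in> g V" "j \<in> g W" "l \<in> g V" "m \<in> g W" "i < j" "j < l" "l < m" for V W i j l m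
    proof -
      have "a \<le> i" using that(1,3) s2(1)[OF that(1)] k by (auto simp: g1)
      then have "j \<in> W" "l \<in> V" "m \<in> W" using that by (auto simp: g1)
      then have jb: "k \<le> j" using s2[OF that(2)] by auto
      show ?thesis
      proof (cases "i = a")
        case True
        then have kV: "k \<in> V" using na that g1 by blast
        show ?thesis
        proof (cases "j = k")
          case True then show ?thesis using nc_onD(3)[OF p2 that(1,2) kV] \<open>j \<in> W\<close> by simp
        next
          case False
          then show ?thesis using nc_onD(4)[OF p2 that(1,2) kV \<open>j \<in> W\<close> \<open>l \<in> V\<close> \<open>m \<in> W\<close>] jb that by simp
        qed
      next
        case False
        then have "i \<in> V" using that g1 by blast
        then show ?thesis using nc_onD(4)[OF p2 that(1,2) _ \<open>j \<in> W\<close> \<open>l \<in> V\<close> \<open>m \<in> W\<close>] that by simp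
      qed
    qed
    have dj2: "V = W" if "V \<in> \<pi>2" "W \<in> \<pi>2" "x \<in> g V" "x \<in> g W" for V W x
      using that nc_onD(3)[OF p2 that(1,2)] na g1 by metis
    have out: "x \<notin> {a<..<k}" if "V \<in> \<pi>2" "x \<in> g V" for V x
      using that s2[OF that(1)] k g1[of x V] by auto
    have "glue (\<pi>1, \<pi>2) \<in> nc_on {a..<b}"
    proof (rule nc_onI)
      have "\<Union>(g ` \<pi>2) = insert a (\<Union>\<pi>2)" using V0 by (auto simp: g1)
      then show "\<Union>(glue (\<pi>1, \<pi>2)) = {a..<b}"
        unfolding glue_def using nc_onD(1)[OF p1] nc_onD(1)[OF p2] k by auto
      show "V \<noteq> {}" if "V \<in> glue (\<pi>1, \<pi>2)" for V
        using that s1(2) s2(2) unfolding glue_def g_def by (auto split: if_splits)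
      show "V = W" if h: "V \<in> glue (\<pi>1, \<pi>2)" "W \<in> glue (\<pi>1, \<pi>2)" "x \<in> V" "x \<in> W" for V W x
      proof -
        consider "V \<in> \<pi>1" "W \<in> \<pi>1" | "V \<in> \<pi>1" "W \<in> g ` \<pi>2" | "V \<in> g ` \<pi>2" "W \<in> \<pi>1" | "V \<in> g ` \<pi>2" "W \<in> g ` \<pi>2"
          using h(1,2) unfolding glue_def by auto
        then show ?thesis
        proof cases
          case 1 show ?thesis by (rule nc_onD(3)[OF p1 1, of x]) (use h in auto)
        next
          case 2 then show ?thesis using s1 out h by blast
        next
          case 3 then show ?thesis using s1 out h by blast
        next
          case 4
          then obtain V' W' where "V = g V'" "W = g W'" "V' \<in> \<pi>2" "W' \<in> \<pi>2" by auto
          then show ?thesis using dj2[of V' W' x] h by simp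
        qed
      qed
      show "V = W" if h: "V \<in> glue (\<pi>1, \<pi>2)" "W \<in> glue (\<pi>1, \<pi>2)" "i \<in> V" "j \<in> W" "l \<in> V" "m \<in> W"
         "i < j" "j < l" "l < m" for V W i j l m
      proof -
        consider "V \<in> \<pi>1" "W \<in> \<pi>1" | "V \<in> \<pi>1" "W \<in> g ` \<pi>2" | "V \<in> g ` \<pi>2" "W \<in> \<pi>1" | "V \<in> g ` \<pi>2" "W \<in> g ` \<pi>2"
          using h(1,2) unfolding glue_def by auto
        then show ?thesis
        proof cases
          case 1 show ?thesis by (rule nc_onD(4)[OF p1 1, of i j l m]) (use h in auto)
        next
          case 2
          then have "i \<in> {a<..<k}" "l \<in> {a<..<k}" using s1 that by blast+
          then have "j \<in> {a<..<k}" using that by auto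
          then show ?thesis using 2 out that by blast
        next
          case 3
          then have "j \<in> {a<..<k}" "m \<in> {a<..<k}" using s1 that by blast+
          then have "l \<in> {a<..<k}" using that by auto
          then show ?thesis using 3 out that by blast
        next
          case 4
          then obtain V' W' where "V = g V'" "W = g W'" "V' \<in> \<pi>2" "W' \<in> \<pi>2" by auto
          then show ?thesis using nc2[of V' W' i j l m] h by simp
        qed
      qed
    qed
    moreover have "g V0 \<in> glue (\<pi>1, \<pi>2)" "a \<in> g V0" "k \<in> g V0" "g V0 \<inter> {a<..<k} = {}"
      using V0 out by (auto simp: glue_def g1)
    ultimately show "glue (\<pi>1, \<pi>2) \<in> nc_next a b k" unfolding nc_next_def by blast
    have notin: "\<not> g V \<subseteq> {a<..<k}" if "V \<in> \<pi>2" for V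
      using s2[OF that] out[OF that] g1 by blast
    have gm: "g V - {a} = V" if "V \<in> \<pi>2" for V
      using na[OF that] by (auto simp: g_def)
    have c1: "{V \<in> \<pi>1 \<union> g ` \<pi>2. V \<subseteq> {a<..<k}} = \<pi>1" using s1 notin by auto
    have c2: "{V \<in> \<pi>1 \<union> g ` \<pi>2. \<not> V \<subseteq> {a<..<k}} = g ` \<pi>2" using s1 notin by auto
    have c3: "(\<lambda>V. V - {a}) ` g ` \<pi>2 = \<pi>2" using gm by (simp add: image_image)
    show "cut (glue (\<pi>1, \<pi>2)) = (\<pi>1, \<pi>2)"
      unfolding cut_def glue_def using c1 c2 c3 by simp
    have "finite \<pi>1" "finite \<pi>2" 
      using finite_UnionD[of \<pi>1] finite_UnionD[of \<pi>2] nc_onD(1)[OF p1] nc_onD(1)[OF p2] by simp_all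
    moreover have "\<pi>1 \<inter> g ` \<pi>2 = {}" using s1 notin by blast
    moreover have "inj_on g \<pi>2" using gm by (metis inj_onI)
    ultimately show "(\<Prod>V\<in>glue (\<pi>1, \<pi>2). \<kappa> V) = (\<Prod>V\<in>\<pi>1. \<kappa> V) * (\<Prod>V\<in>\<pi>2. \<kappa> (g V))"
      unfolding glue_def by (simp add: prod.union_disjoint prod.reindex)
  qed
  have cut: "cut \<pi> \<in> nc_on {a<..<k} \<times> nc_on {k..<b} \<and> glue (cut \<pi>) = \<pi>" if h: "\<pi> \<in> nc_next a b k" for \<pi>
  proof -
    have \<pi>: "\<pi> \<in> nc_on {a..<b}" using that by (auto simp: nc_next_def)
    obtain V0 where V0: "V0 \<in> \<pi>" "a \<in> V0" "k \<in> V0" "V0 \<inter> {a<..<k} = {}" using h by (auto simp: nc_next_def)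
    \<comment> \<open>A block with a point in the gap and another outside has the latter beyond
      \<open>k\<close>, since \<open>a\<close> and \<open>k\<close> are taken by \<open>V0\<close>;
      then it crosses \<open>V0\<close>.\<close>
    have inout: "V \<inter> {a<..<k} = {}" if V: "V \<in> \<pi>" "\<not> V \<subseteq> {a<..<k}" for V
    proof (rule ccontr)
      assume "V \<inter> {a<..<k} \<noteq> {}"
      then obtain i where i: "i \<in> V" "a < i" "i < k" by auto
      then have "V \<noteq> V0" using V0 by auto
      obtain l where l: "l \<in> V" "l \<notin> {a<..<k}" using V by blast
      then have "l \<noteq> a" "l \<noteq> k" using nc_onD(3)[OF \<pi> V(1) V0(1)] V0 \<open>V \<noteq> V0\<close> by auto
      moreover have "a \<le> l" using nc_onD(5)[OF \<pi> V(1)] l by auto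
      ultimately have "k < l" using l by auto
      then show False using nc_onD(4)[OF \<pi> V0(1) V(1) V0(2) i(1) V0(3) l(1)] i \<open>V \<noteq> V0\<close> by auto
    qed
    have aV: "k \<in> V" if "V \<in> \<pi>" "a \<in> V" for V
      using nc_onD(3)[OF \<pi> that(1) V0(1) that(2) V0(2)] V0 by simp
    have kV: "a \<in> V" if "V \<in> \<pi>" "k \<in> V" for V
      using nc_onD(3)[OF \<pi> that(1) V0(1) that(2) V0(3)] V0 by simp
    let ?p1 = "{V \<in> \<pi>. V \<subseteq> {a<..<k}}" and ?q = "{V \<in> \<pi>. \<not> V \<subseteq> {a<..<k}}"
    have U: "\<Union>\<pi> = {a..<b}" using nc_onD(1)[OF \<pi>] .
    have p1: "?p1 \<in> nc_on {a<..<k}"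
    proof (rule nc_onI)
      show "\<Union>?p1 = {a<..<k}"
      proof (intro equalityI subsetI)
        fix x assume x: "x \<in> {a<..<k}"
        then have "x \<in> \<Union>\<pi>" using U k by auto
        then obtain V where "V \<in> \<pi>" "x \<in> V" by auto
        then show "x \<in> \<Union>?p1" using inout x by blast
      qed auto
      show "V = W" if "V \<in> ?p1" "W \<in> ?p1" "i \<in> V" "j \<in> W" "l \<in> V" "m \<in> W" "i < j" "j < l" "l < m" for V W i j l m
        by (rule nc_onD(4)[OF \<pi>, of V W i j l m]) (use that in auto)
    qed (use nc_onD[OF \<pi>] in auto)
    have p2: "(\<lambda>V. V - {a}) ` ?q \<in> nc_on {k..<b}"
    proof (rule nc_onI)
      show "\<Union>((\<lambda>V. V - {a}) ` ?q) = {k..<b}"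
      proof (intro equalityI subsetI)
        fix x assume "x \<in> \<Union>((\<lambda>V. V - {a}) ` ?q)"
        then obtain V where V: "V \<in> ?q" "x \<in> V" "x \<noteq> a" by auto
        then have "x \<notin> {a<..<k}" using inout by blast
        moreover have "x \<in> {a..<b}" using V U by blast
        ultimately show "x \<in> {k..<b}" using V by auto
      next
        fix x assume x: "x \<in> {k..<b}"
        then have "x \<in> \<Union>\<pi>" using U k by auto
        then obtain V where V: "V \<in> \<pi>" "x \<in> V" by auto
        have "x \<notin> {a<..<k}" "x \<noteq> a" using x k by auto
        then show "x \<in> \<Union>((\<lambda>V. V - {a}) ` ?q)" using V by blast
      qed
      show "V \<noteq> {}" if "V \<in> (\<lambda>V. V - {a}) ` ?q" for V
        using that aV nc_onD(2)[OF \<pi>] k by auto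
      show "V = W" if h: "V \<in> (\<lambda>V. V - {a}) ` ?q" "W \<in> (\<lambda>V. V - {a}) ` ?q" "x \<in> V" "x \<in> W" for V W x
      proof -
        obtain V' W' where VW: "V = V' - {a}" "W = W' - {a}" "V' \<in> \<pi>" "W' \<in> \<pi>" using h(1,2) by auto
        have "V' = W'"
          by (rule nc_onD(3)[OF \<pi> VW(3,4), of x]) (use h VW in auto)
        then show ?thesis using VW by simp
      qed
      show "V = W" if h: "V \<in> (\<lambda>V. V - {a}) ` ?q" "W \<in> (\<lambda>V. V - {a}) ` ?q" "i \<in> V" "j \<in> W" "l \<in> V" "m \<in> W"
         "i < j" "j < l" "l < m" for V W i j l m
      proof -
        obtain V' W' where VW: "V = V' - {a}" "W = W' - {a}" "V' \<in> \<pi>" "W' \<in> \<pi>" using h(1,2) by auto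
        have "V' = W'"
          by (rule nc_onD(4)[OF \<pi> VW(3,4), of i j l m]) (use h VW in auto)
        then show ?thesis using VW by simp
      qed
    qed
    have "g ` (\<lambda>V. V - {a}) ` ?q = ?q"
    proof -
      have "g (V - {a}) = V" if "V \<in> \<pi>" for V
        using aV[OF that] kV[OF that] k by (auto simp: g_def)
      then show ?thesis by (simp add: image_image)
    qed
    then have "glue (cut \<pi>) = ?p1 \<union> ?q" unfolding cut_def glue_def by simp
    also have "\<dots> = \<pi>" by auto
    finally show ?thesis using p1 p2 unfolding cut_def by simp
  qed
  have "(\<Sum>\<pi>\<in>nc_next a b k. \<Prod>V\<in>\<pi>. \<kappa> V) =
     (\<Sum>(\<pi>1,\<pi>2)\<in>nc_on {a<..<k} \<times> nc_on {k..<b}. (\<Prod>V\<in>\<pi>1. \<kappa> V) * (\<Prod>V\<in>\<pi>2. \<kappa> (g V)))"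
  proof (rule sum.reindex_bij_witness[where i=glue and j=cut])
    fix \<pi> assume \<pi>: "\<pi> \<in> nc_next a b k"
    obtain \<pi>1 \<pi>2 where c: "cut \<pi> = (\<pi>1, \<pi>2)" by force
    then have "\<pi>1 \<in> nc_on {a<..<k}" "\<pi>2 \<in> nc_on {k..<b}" "glue (\<pi>1, \<pi>2) = \<pi>" using cut[OF \<pi>] by auto
    then show "(case cut \<pi> of (\<pi>1, \<pi>2) \<Rightarrow> (\<Prod>V\<in>\<pi>1. \<kappa> V) * (\<Prod>V\<in>\<pi>2. \<kappa> (g V))) = (\<Prod>V\<in>\<pi>. \<kappa> V)"
      using glue(3) c by auto
  qed (use cut glue in auto)
  also have "\<dots> = ncsum \<kappa> {a<..<k} * ncsum (\<lambda>V. \<kappa> (g V)) {k..<b}"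
    unfolding ncsum_def by (simp add: sum_product sum.cartesian_product)
  finally show ?thesis unfolding I1 g_def by (simp add: if_distrib cong: if_cong)
qed

text \<open>Sorts the partitions by the successor of \<open>a\<close> in its block; the first
  summand belongs to those in which there is none.\<close>

lemma ncsum_rec:
  assumes "a < b"
  shows "ncsum \<kappa> {a..<b} = \<kappa> {a} * ncsum \<kappa> {Suc a..<b} +
    (\<Sum>k\<in>{a<..<b}. ncsum \<kappa> {Suc a..<k} * ncsum (\<lambda>V. if k \<in> V then \<kappa> (insert a V) else \<kappa> V) {k..<b})"
proof -
  have nn: "{a} \<notin> \<pi>" if "\<pi> \<in> nc_on {Suc a..<b}" for \<pi>
    using nc_onD(5)[OF that] by force
  have fin: "finite \<pi>" if "\<pi> \<in> nc_on {Suc a..<b}" for \<pi>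
    using nc_onD(1)[OF that] finite_UnionD[of \<pi>] by simp
  have inj: "inj_on (insert {a}) (nc_on {Suc a..<b})"
  proof (rule inj_onI)
    fix x y assume "x \<in> nc_on {Suc a..<b}" "y \<in> nc_on {Suc a..<b}" "insert {a} x = insert {a} y"
    then show "x = y" using insert_ident[OF nn nn] by simp
  qed
  have 1: "(\<Sum>\<pi>\<in>{\<pi> \<in> nc_on {a..<b}. {a} \<in> \<pi>}. \<Prod>V\<in>\<pi>. \<kappa> V) = \<kappa> {a} * ncsum \<kappa> {Suc a..<b}"
    unfolding nc_on_singleton_iff[OF assms] ncsum_def
    using nn fin by (subst sum.reindex[OF inj]) (auto simp: sum_distrib_left intro!: sum.cong)
  have dis1: "{\<pi> \<in> nc_on {a..<b}. {a} \<in> \<pi>} \<inter> (\<Union>k\<in>{a<..<b}. nc_next a b k) = {}"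
  proof -
    have False if h: "\<pi> \<in> nc_on {a..<b}" "{a} \<in> \<pi>" "k \<in> {a<..<b}" "\<pi> \<in> nc_next a b k" for \<pi> k
    proof -
      obtain V where "V \<in> \<pi>" "a \<in> V" "k \<in> V" using h(4) by (auto simp: nc_next_def)
      then have "V = {a}" using nc_onD(3)[OF h(1)] h(2) by blast
      then show False using \<open>k \<in> V\<close> h(3) by auto
    qed
    then show ?thesis by blast
  qed
  have dis2: "nc_next a b k \<inter> nc_next a b l = {}" if "k \<in> {a<..<b}" "l \<in> {a<..<b}" "k \<noteq> l" for k l
  proof -
    have L: False if kl: "\<pi> \<in> nc_next a b k" "\<pi> \<in> nc_next a b l" "a < k" "k < l" for \<pi> k l
    proof -
      have \<pi>: "\<pi> \<in> nc_on {a..<b}" using kl by (auto simp: nc_next_def)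
      obtain V where V: "V \<in> \<pi>" "a \<in> V" "k \<in> V" using kl(1) by (auto simp: nc_next_def)
      obtain W where W: "W \<in> \<pi>" "a \<in> W" "l \<in> W" "W \<inter> {a<..<l} = {}" using kl(2) by (auto simp: nc_next_def)
      have "V = W" using nc_onD(3)[OF \<pi>] V W by blast
      then show False using V W kl by auto
    qed
    show ?thesis
    proof (cases "k < l")
      case True then show ?thesis using L[of _ k l] that by auto
    next
      case False then show ?thesis using L[of _ l k] that by auto
    qed
  qed
  have fin2: "finite (nc_next a b k)" for k
    using finite_nc_on[of "{a..<b}"] by (auto simp: nc_next_def)
  have "ncsum \<kappa> {a..<b} = (\<Sum>\<pi>\<in>{\<pi> \<in> nc_on {a..<b}. {a} \<in> \<pi>}. \<Prod>V\<in>\<pi>. \<kappa> V)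
     + (\<Sum>\<pi>\<in>(\<Union>k\<in>{a<..<b}. nc_next a b k). \<Prod>V\<in>\<pi>. \<kappa> V)"
    unfolding ncsum_def
    by (subst nc_on_decomp[OF assms], subst sum.union_disjoint) (use finite_nc_on fin2 dis1 in auto)
  also have "(\<Sum>\<pi>\<in>(\<Union>k\<in>{a<..<b}. nc_next a b k). \<Prod>V\<in>\<pi>. \<kappa> V) =
     (\<Sum>k\<in>{a<..<b}. \<Sum>\<pi>\<in>nc_next a b k. \<Prod>V\<in>\<pi>. \<kappa> V)"
    using fin2 dis2 by (intro sum.UNION_disjoint) auto
  also have "\<dots> = (\<Sum>k\<in>{a<..<b}. ncsum \<kappa> {Suc a..<k} * ncsum (\<lambda>V. if k \<in> V then \<kappa> (insert a V) else \<kappa> V) {k..<b})"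
    by (intro sum.cong refl sum_nc_next) auto
  finally show ?thesis unfolding 1 .
qed

text \<open>Some block contains the least point \<open>a\<close>, so every product has a vanishing
  factor.\<close>

lemma ncsum_zero:
  assumes "a < b" "\<And>V. a \<in> V \<Longrightarrow> V \<subseteq> {a..<b} \<Longrightarrow> \<kappa> V = 0"
  shows "ncsum \<kappa> {a..<b} = 0"
  unfolding ncsum_def
proof (rule sum.neutral, rule ballI)
  fix \<pi> assume \<pi>: "\<pi> \<in> nc_on {a..<b}"
  then obtain V where "V \<in> \<pi>" "a \<in> V"
    using nc_onD(1)[OF \<pi>] assms(1) by (metis UnionE atLeastLessThan_iff le_refl)
  moreover have "finite \<pi>" using nc_onD(1)[OF \<pi>] finite_UnionD[of \<pi>] by simp
  ultimately show "(\<Prod>V\<in>\<pi>. \<kappa> V) = 0"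
    using assms(2) nc_onD(5)[OF \<pi>] by (auto simp: prod_zero_iff)
qed

section \<open>Moment recursions for circular and free Poisson elements\<close>

lemma nths_take_subset:
  assumes "V \<subseteq> {..<n}"
  shows "nths (take n xs) V = nths xs V"
proof -
  have "nths xs V = nths (take n xs @ drop n xs) V" by simp
  also have "\<dots> = nths (take n xs) V @ nths (drop n xs) {j. j + length (take n xs) \<in> V}"
    by (rule nths_append)
  also have "nths (drop n xs) {j. j + length (take n xs) \<in> V} = []"
  proof (cases "n \<le> length xs")
    case True
    then have "{j. j + length (take n xs) \<in> V} = {}" using assms by auto
    then show ?thesis by simp
  qed simp
  finally show ?thesis by simp
qed

lemma nths_sing_nth: "i < length xs \<Longrightarrow> nths xs {i} = [xs ! i]"
proof (induction xs arbitrary: i)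
  case (Cons x xs)
  show ?case
  proof (cases i)
    case 0 then show ?thesis by (simp add: nths_Cons)
  next
    case (Suc j)
    then have "{m. Suc m \<in> {i}} = {j}" by auto
    then show ?thesis using Cons Suc by (simp add: nths_Cons)
  qed
qed simp

lemma length_nths_card: "V \<subseteq> {..<length xs} \<Longrightarrow> length (nths xs V) = card V"
proof -
  assume "V \<subseteq> {..<length xs}"
  then have "{i. i < length xs \<and> i \<in> V} = V" by auto
  then show ?thesis by (simp add: length_nths)
qed

text \<open>Turns the intervals produced by \<open>ncsum_rec\<close> back into moments of subwords.
  The empty interval is where \<open>\<phi> 1 = 1\<close> enters, since the moment-cumulant formula
  speaks of non-empty words.\<close>

lemma ncsum_segment:
  fixes \<phi> :: "'a::ring_1 \<Rightarrow> complex"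
  assumes "\<phi> 1 = 1" "a \<le> b" "b \<le> length xs"
  shows "ncsum (\<lambda>V. free_cumulant \<phi> (nths xs V)) {a..<b} = \<phi> (prod_list (take (b - a) (drop a xs)))"
proof (cases "a = b")
  case False
  let ?ys = "take (b - a) (drop a xs)"
  have len: "length ?ys = b - a" using assms by simp
  have "{a..<b} = (+) a ` {0..<b - a}" using assms(2) by (simp add: image_add_atLeastLessThan)
  then have "ncsum (\<lambda>V. free_cumulant \<phi> (nths xs V)) {a..<b} =
      ncsum (\<lambda>V. free_cumulant \<phi> (nths (drop a xs) V)) {0..<b - a}"
    by (simp only: ncsum_shift nths_drop)
  also have "\<dots> = ncsum (\<lambda>V. free_cumulant \<phi> (nths ?ys V)) {0..<b - a}"
    by (intro ncsum_cong arg_cong[where f="free_cumulant \<phi>"] nths_take_subset[symmetric])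
       (simp add: lessThan_atLeast0)
  also have "\<dots> = \<phi> (prod_list ?ys)"
  proof -
    have "?ys \<noteq> []" using False assms by auto
    then show ?thesis
      using moment_cumulant[of ?ys \<phi>] len
      by (simp add: noncrossing_partitions_eq_nc_on ncsum_def del: take_eq_Nil take_eq_Nil2)
  qed
  finally show ?thesis .
qed (simp add: assms)

text \<open>Only blocks of two elements contribute, so the successor of the first letter completes
  its block. The word splits into the part enclosed by this pair and the part after it.\<close>

lemma circular_moment_rec:
  fixes \<phi> :: "'a::ring_1 \<Rightarrow> complex" and g :: 'a and star :: "'a \<Rightarrow> 'a"
  defines "el \<equiv> \<lambda>b. if b then star g else g"
  assumes one: "\<phi> 1 = 1" and circ: "standard_circular \<phi> star g"
  shows "\<phi> (prod_list (map el (b # bs))) =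
    (\<Sum>k<length bs. if bs ! k = (\<not> b)
       then \<phi> (prod_list (map el (take k bs))) * \<phi> (prod_list (map el (drop (Suc k) bs))) else 0)"
proof -
  let ?B = "b # bs"
  define n where "n = length ?B"
  define \<kappa> where "\<kappa> V = free_cumulant \<phi> (nths (map el ?B) V)" for V
  define m where "m i j = ncsum \<kappa> {i..<j}" for i j
  have seg: "m i j = \<phi> (prod_list (map el (take (j - i) (drop i ?B))))" if "i \<le> j" "j \<le> n" for i j
  proof -
    have "map el (take (j - i) (drop i ?B)) = take (j - i) (drop i (map el ?B))"
      by (simp only: take_map drop_map)
    then show ?thesis
      unfolding m_def \<kappa>_def using that one by (simp only:) (subst ncsum_segment, simp_all add: n_def)
  qed
  have fc: "free_cumulant \<phi> (map el xs) = (if xs = [False, True] \<or> xs = [True, False] then 1 else 0)"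
    if "xs \<noteq> []" for xs
    using circ that unfolding standard_circular_def el_def by blast
  have kap: "\<kappa> V = (if nths ?B V = [False, True] \<or> nths ?B V = [True, False] then 1 else 0)"
    if "V \<noteq> {}" "V \<subseteq> {..<n}" for V
  proof -
    have "length (nths ?B V) = card V" using that by (intro length_nths_card) (simp add: n_def)
    moreover have "card V > 0" using that finite_subset by (auto simp: card_gt_0_iff)
    ultimately have "nths ?B V \<noteq> []" by auto
    then show ?thesis unfolding \<kappa>_def nths_map by (rule fc)
  qed
  have kap0: "\<kappa> V = 0" if "card V \<noteq> 2" "V \<noteq> {}" "V \<subseteq> {..<n}" for V
  proof -
    have "length (nths ?B V) = card V" using that by (intro length_nths_card) (simp add: n_def)
    then show ?thesis using kap[OF that(2,3)] that(1) by (auto split: if_splits)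
  qed
  have kap2: "\<kappa> {0, Suc k} = (if bs ! k = (\<not> b) then 1 else 0)" if "k < length bs" for k
  proof -
    have "{j. Suc j \<in> {0, Suc k}} = {k}" by auto
    then have "nths ?B {0, Suc k} = [b, bs ! k]" using nths_sing_nth[OF that] by (simp add: nths_Cons)
    then show ?thesis using kap[of "{0, Suc k}"] that by (auto simp: n_def)
  qed
  have inner: "ncsum (\<lambda>V. if k \<in> V then \<kappa> (insert 0 V) else \<kappa> V) {k..<n} = \<kappa> {0, k} * m (Suc k) n"
    if k: "k \<in> {0<..<n}" for k
  proof -
    let ?\<kappa>' = "\<lambda>V. if k \<in> V then \<kappa> (insert 0 V) else \<kappa> V"
    \<comment> \<open>A third point \<open>l\<close> in the block of \<open>0\<close> and
      \<open>k\<close> makes its weight zero.\<close>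
    have z: "ncsum (\<lambda>V. if l \<in> V then ?\<kappa>' (insert k V) else ?\<kappa>' V) {l..<n} = 0" if l: "l \<in> {k<..<n}" for l
    proof (rule ncsum_zero)
      fix V assume V: "l \<in> V" "V \<subseteq> {l..<n}"
      have "\<kappa> (insert 0 (insert k V)) = 0"
      proof (rule kap0)
        have "finite V" using V finite_subset by blast
        moreover have "{0, k, l} \<subseteq> insert 0 (insert k V)" using V by auto
        ultimately have "card {0, k, l} \<le> card (insert 0 (insert k V))" by (intro card_mono) auto
        then show "card (insert 0 (insert k V)) \<noteq> 2" using k l by simp
        show "insert 0 (insert k V) \<subseteq> {..<n}" using k V by auto
      qed simp
      then show "(if l \<in> V then ?\<kappa>' (insert k V) else ?\<kappa>' V) = 0" using V by simp
    qed (use l in auto)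
    have c: "ncsum ?\<kappa>' {Suc k..<n} = m (Suc k) n"
      unfolding m_def by (rule ncsum_cong) auto
    have "ncsum ?\<kappa>' {k..<n} = ?\<kappa>' {k} * ncsum ?\<kappa>' {Suc k..<n}"
      using k by (subst ncsum_rec) (use z in \<open>auto intro!: sum.neutral\<close>)
    then show ?thesis unfolding c by simp
  qed
  have "\<phi> (prod_list (map el ?B)) = m 0 n" using seg[of 0 n] by (simp add: n_def)
  also have "\<dots> = \<kappa> {0} * m (Suc 0) n + (\<Sum>k\<in>{0<..<n}. m (Suc 0) k * (\<kappa> {0, k} * m (Suc k) n))"
    unfolding m_def using inner unfolding m_def
    by (subst ncsum_rec) (auto simp: n_def intro!: sum.cong)
  also have "\<kappa> {0} = 0" by (rule kap0) (auto simp: n_def)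
  \<comment> \<open>Passes from positions in \<open>b # bs\<close> to positions in
    \<open>bs\<close>.\<close>
  also have "(\<Sum>k\<in>{0<..<n}. m (Suc 0) k * (\<kappa> {0, k} * m (Suc k) n)) =
     (\<Sum>k<length bs. m (Suc 0) (Suc k) * (\<kappa> {0, Suc k} * m (Suc (Suc k)) n))"
    by (rule sum.reindex_bij_witness[where i=Suc and j="\<lambda>k. k - 1"]) (auto simp: n_def)
  also have "\<dots> = (\<Sum>k<length bs. if bs ! k = (\<not> b)
       then \<phi> (prod_list (map el (take k bs))) * \<phi> (prod_list (map el (drop (Suc k) bs))) else 0)"
    by (intro sum.cong refl) (simp add: kap2 seg n_def)
  finally show ?thesis by simp
qed

text \<open>All cumulants are equal, so deleting the first letter from a block with at least two
  elements does not change its weight. The modified sum over the points from \<open>k\<close> on is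
  thus an ordinary moment, with the letter at \<open>k\<close> retained; the factor \<open>c\<close>
  is the weight of the singleton block.\<close>

lemma free_poisson_moment_rec:
  fixes \<phi> :: "'a::ring_1 \<Rightarrow> complex" and w :: 'a and star :: "'a \<Rightarrow> 'a"
  assumes one: "\<phi> 1 = 1" and poi: "free_poisson \<phi> star c w"
  shows "\<phi> (w ^ Suc n) = c * \<phi> (w ^ n) + (\<Sum>k<n. \<phi> (w ^ k) * \<phi> (w ^ (n - k)))"
proof -
  let ?B = "replicate (Suc n) w"
  define \<kappa> where "\<kappa> V = free_cumulant \<phi> (nths ?B V)" for V
  define m where "m i j = ncsum \<kappa> {i..<j}" for i j
  have seg: "m i j = \<phi> (w ^ (j - i))" if "i \<le> j" "j \<le> Suc n" for i j
    unfolding m_def \<kappa>_def using that one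
    by (subst ncsum_segment) (simp_all add: min_def del: replicate_Suc)
  have kap: "\<kappa> V = c" if "V \<noteq> {}" "V \<subseteq> {..<Suc n}" for V
  proof -
    have len: "length (nths ?B V) = card V" using that by (intro length_nths_card) simp
    have "set (nths ?B V) \<subseteq> {w}" using set_nths_subset[of ?B V] by auto
    then have "nths ?B V = replicate (card V) w"
      using len by (metis replicate_length_same singletonD subsetD)
    moreover have "card V \<ge> 1" using that finite_subset[of V] by (simp add: Suc_le_eq card_gt_0_iff)
    ultimately show ?thesis using poi unfolding \<kappa>_def free_poisson_def by simp
  qed
  have inner: "ncsum (\<lambda>V. if k \<in> V then \<kappa> (insert 0 V) else \<kappa> V) {k..<Suc n} = m k (Suc n)" for k
    unfolding m_def
  proof (rule ncsum_cong)
    fix V assume V: "V \<noteq> {}" "V \<subseteq> {k..<Suc n}"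
    have "V \<subseteq> {..<Suc n}" "insert 0 V \<subseteq> {..<Suc n}" using V by auto
    then show "(if k \<in> V then \<kappa> (insert 0 V) else \<kappa> V) = \<kappa> V"
      using kap[of V] kap[of "insert 0 V"] V by simp
  qed
  have "\<phi> (w ^ Suc n) = m 0 (Suc n)" using seg[of 0 "Suc n"] by simp
  also have "\<dots> = \<kappa> {0} * m (Suc 0) (Suc n) + (\<Sum>k\<in>{0<..<Suc n}. m (Suc 0) k * m k (Suc n))"
    unfolding m_def using inner unfolding m_def by (subst ncsum_rec) auto
  also have "(\<Sum>k\<in>{0<..<Suc n}. m (Suc 0) k * m k (Suc n)) =
     (\<Sum>k<n. m (Suc 0) (Suc k) * m (Suc k) (Suc n))"
    by (rule sum.reindex_bij_witness[where i=Suc and j="\<lambda>k. k - 1"]) auto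
  finally show ?thesis by (simp add: kap seg)
qed

section \<open>Schwinger-Dyson equations from freeness\<close>

definition letter_val :: "('a \<Rightarrow> 'a) \<Rightarrow> ('i \<Rightarrow> 'a) \<Rightarrow> 'i \<times> bool \<Rightarrow> 'a" where
  "letter_val star x l = (if snd l then star (x (fst l)) else x (fst l))"

lemma eval_monomial_Nil [simp]: "eval_monomial star x [] = 1"
  by (simp add: eval_monomial_def)

lemma eval_monomial_Cons [simp]:
  "eval_monomial star x (l # w) = letter_val star x l * eval_monomial star x w"
  by (simp add: eval_monomial_def letter_val_def split: prod.splits)

lemma eval_monomial_append [simp]:
  "eval_monomial star x (v @ w) = eval_monomial star x v * eval_monomial star x w"
  by (simp add: eval_monomial_def)

definition alternating :: "('a::ring_1 \<Rightarrow> complex) \<Rightarrow> 'i set \<Rightarrow> ('i \<Rightarrow> 'a set) \<Rightarrow> ('i \<times> 'a) list \<Rightarrow> bool" where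
  "alternating \<phi> I B ps \<longleftrightarrow> distinct_adj (map fst ps) \<and> (\<forall>(i, a)\<in>set ps. i \<in> I \<and> a \<in> B i \<and> \<phi> a = 0)"

lemma diff_scale_combine:
  "a * (b - z * c) + (d - z * e) = a * b + d - z * (a * c + e)" for a b c d e z :: complex
  by (simp add: algebra_simps)

context nc_star_probability_space
begin

lemma phi_add: "\<phi> (a + b) = \<phi> a + \<phi> b" by (rule add)
lemma phi_scale: "\<phi> (cscale z a) = z * \<phi> a" by (rule scale)
lemma phi_diff: "\<phi> (a - b) = \<phi> a - \<phi> b"
  using phi_add[of "a - b" b] by (simp add: algebra_simps)

abbreviation centre :: "'a \<Rightarrow> 'a" where
  "centre a \<equiv> a - cscale (\<phi> a) 1"

lemma phi_centre [simp]: "\<phi> (centre a) = 0"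
  by (simp add: phi_diff phi_scale unital)

lemma phi_mult_centre:
  "\<phi> (p * centre a * q) = \<phi> (p * a * q) - \<phi> a * \<phi> (p * q)"
  by (simp add: algebra_simps phi_diff phi_scale cscale_mult_left cscale_mult_right)

lemma star_subalgebra_centre:
  assumes "a \<in> star_subalgebra cscale star S"
  shows "a - cscale z 1 \<in> star_subalgebra cscale star S"
proof -
  have "a - cscale z 1 = a + cscale (- z) 1" by (simp add: vs1.scale_minus_left)
  then show ?thesis
    by (simp only:) (intro star_subalgebra.add star_subalgebra.scale star_subalgebra.one assms)
qed

end

locale star_free_family = nc_star_probability_space cscale \<phi> star
  for cscale :: "complex \<Rightarrow> 'a::ring_1 \<Rightarrow> 'a" and \<phi> :: "'a \<Rightarrow> complex" and star :: "'a \<Rightarrow> 'a" +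
  fixes I :: "'i set" and x :: "'i \<Rightarrow> 'a"
  assumes star_free: "star_free cscale \<phi> star I x"
begin

abbreviation "B i \<equiv> star_subalgebra cscale star {x i}"
abbreviation "evm \<equiv> eval_monomial star x"
abbreviation "el \<equiv> letter_val star x"
abbreviation "alt \<equiv> alternating \<phi> I B"

lemma el_in: "el l \<in> B (fst l)"
  by (auto simp: letter_val_def intro: star_subalgebra.intros)

lemma alt_zero: "alt ps \<Longrightarrow> ps \<noteq> [] \<Longrightarrow> \<phi> (prod_list (map snd ps)) = 0"
  using star_free unfolding star_free_def free_subalgebras_def alternating_def by blast

text \<open>The factor \<open>b\<close> may fail to be centred: its centred part prolongs the
  alternating product, its scalar part leaves the product as it was, and \<open>\<phi>\<close>
  vanishes on both.\<close>

lemma alt_snoc_mult: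
  assumes "alt ps" "ps \<noteq> []" "fst (last ps) \<noteq> j" "j \<in> I" "b \<in> B j"
  shows "\<phi> (prod_list (map snd ps) * b) = 0"
proof -
  have "alt (ps @ [(j, centre b)])"
    using assms star_subalgebra_centre[OF assms(5)]
    by (auto simp: alternating_def distinct_adj_append_iff last_map)
  then have "\<phi> (prod_list (map snd ps) * centre b * 1) = 0"
    using alt_zero[of "ps @ [(j, centre b)]"] by simp
  then show ?thesis
    using alt_zero[OF assms(1,2)] unfolding phi_mult_centre by simp
qed

lemma alt_Cons_mult:
  assumes "alt ps" "ps \<noteq> []" "fst (hd ps) \<noteq> j" "j \<in> I" "b \<in> B j"
  shows "\<phi> (b * prod_list (map snd ps)) = 0"
proof -
  have "alt ((j, centre b) # ps)"
    using assms star_subalgebra_centre[OF assms(5)]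
    by (cases ps) (auto simp: alternating_def)
  then have "\<phi> (1 * centre b * prod_list (map snd ps)) = 0"
    using alt_zero[of "(j, centre b) # ps"] by simp
  then show ?thesis
    using alt_zero[OF assms(1,2)] unfolding phi_mult_centre by simp
qed

end

text \<open>
  A Schwinger-Dyson equation \<open>\<phi> (y v) = \<Sum> \<phi> (v\<^sub>1) \<phi> (t v\<^sub>2)\<close>, the sum being over the decompositions
  \<open>v = v\<^sub>1 l v\<^sub>2\<close> at an admissible letter \<open>l\<close>, extends from the words in \<open>x i0\<close> and its adjoint to
  all words by freeness.
\<close>

locale schwinger_dyson = star_free_family cscale \<phi> star I x
  for cscale :: "complex \<Rightarrow> 'a::ring_1 \<Rightarrow> 'a" and \<phi> :: "'a \<Rightarrow> complex" and star :: "'a \<Rightarrow> 'a"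
    and I :: "'i set" and x :: "'i \<Rightarrow> 'a" +
  fixes i0 :: 'i and y t :: 'a and ok :: "'i \<times> bool \<Rightarrow> bool"
  assumes i0: "i0 \<in> I" and y: "y \<in> star_subalgebra cscale star {x i0}" and t: "t \<in> star_subalgebra cscale star {x i0}"
    and ok: "ok l \<Longrightarrow> fst l = i0"
    and single: "fst ` set v \<subseteq> {i0} \<Longrightarrow> \<phi> (y * eval_monomial star x v) =
      (\<Sum>k<length v. if ok (v ! k)
         then \<phi> (eval_monomial star x (take k v)) * \<phi> (t * eval_monomial star x (drop (Suc k) v)) else 0)"
begin

text \<open>The free difference quotient of the word \<open>v\<close>, evaluated by
  \<open>\<phi>\<close> in both tensor factors, with \<open>t\<close> in place of the removed
  letter; \<open>p\<close> gathers what stands to the left of \<open>v\<close>.\<close>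

definition dersum :: "'a \<Rightarrow> ('i \<times> bool) list \<Rightarrow> complex" where
  "dersum p v = (\<Sum>k<length v. if ok (v ! k) then \<phi> (p * evm (take k v)) * \<phi> (t * evm (drop (Suc k) v)) else 0)"

lemma dersum_one:
  "dersum 1 v = (\<Sum>k<length v. if ok (v ! k) then \<phi> (evm (take k v)) * \<phi> (t * evm (drop (Suc k) v)) else 0)"
  by (simp add: dersum_def cong: if_cong)

lemma dersum_Nil [simp]: "dersum p [] = 0"
  by (simp add: dersum_def)

lemma dersum_Cons: "dersum p (l # v) = (if ok l then \<phi> p * \<phi> (t * evm v) else 0) + dersum (p * el l) v"
  unfolding dersum_def by (simp add: sum.lessThan_Suc_shift mult.assoc del: sum.lessThan_Suc cong: if_cong)

lemma mult_centre_left: "p * centre a = p * a - cscale (\<phi> a) p"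
  by (simp add: right_diff_distrib cscale_mult_right)

lemma mult_centre_right: "centre a * q = a * q - cscale (\<phi> a) q"
  by (simp add: left_diff_distrib cscale_mult_left)

lemma dersum_centre: "dersum (p * centre a) v = dersum (p * a) v - \<phi> a * dersum p v"
  unfolding mult_centre_left dersum_def sum_distrib_left sum_subtractf[symmetric]
  by (intro sum.cong refl) (simp add: left_diff_distrib cscale_mult_left phi_diff phi_scale)

definition tsum :: "('a \<times> 'a) list \<Rightarrow> 'a \<Rightarrow> 'a \<Rightarrow> complex" where
  "tsum ts p q = (\<Sum>(r, s)\<leftarrow>ts. \<phi> (p * r) * \<phi> (s * q))"

text \<open>Leibniz rule for right multiplication by a letter: the letter acts on the second
  component of the tensors at hand, and its own derivative, \<open>1\<close> tensor \<open>t\<close>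
  if it is admissible, is multiplied by \<open>a\<close> from the left.\<close>

definition tmul :: "('a \<times> 'a) list \<Rightarrow> 'a \<Rightarrow> 'i \<times> bool \<Rightarrow> ('a \<times> 'a) list" where
  "tmul ts a l = map (\<lambda>(r, s). (r, s * el l)) ts @ (if ok l then [(a, t)] else [])"

lemma tsum_Nil [simp]: "tsum [] p q = 0"
  by (simp add: tsum_def)

lemma tsum_tmul: "tsum (tmul ts a l) p q = tsum ts p (el l * q) + (if ok l then \<phi> (p * a) * \<phi> (t * q) else 0)"
  by (simp add: tsum_def tmul_def o_def case_prod_unfold mult.assoc)

lemma tsum_Cons: "tsum ((a, b) # ts) p q = \<phi> (p * a) * \<phi> (b * q) + tsum ts p q"
  by (simp add: tsum_def)

lemma tsum_diff_scale: "tsum ts p (q - cscale z r) = tsum ts p q - z * tsum ts p r"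
proof (induction ts)
  case (Cons c ts)
  obtain a b where c: "c = (a, b)" by (cases c)
  have eq: "\<phi> (b * (q - cscale z r)) = \<phi> (b * q) - z * \<phi> (b * r)"
    by (simp only: right_diff_distrib cscale_mult_right phi_diff phi_scale)
  show ?case unfolding c tsum_Cons Cons.IH eq by (rule diff_scale_combine)
qed simp

lemma tsum_zero: "(\<And>r s. (r, s) \<in> set ts \<Longrightarrow> \<phi> (p * r) * \<phi> (s * q) = 0) \<Longrightarrow> tsum ts p q = 0"
  by (induction ts) (auto simp: tsum_def)

lemma tsum_centre: "tsum ts p (q * (centre a * r)) = tsum ts p (q * (a * r)) - \<phi> a * tsum ts p (q * r)"
  by (simp only: mult_centre_right right_diff_distrib cscale_mult_right tsum_diff_scale)

text \<open>\<open>ts\<close> lists the terms of the derivative of \<open>a\<close> in the tensor square of \<open>B i0\<close>.\<close>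

inductive Der :: "'a \<Rightarrow> ('a \<times> 'a) list \<Rightarrow> bool" where
  Der_one: "Der 1 []"
| Der_mult: "Der a ts \<Longrightarrow> fst l = i0 \<Longrightarrow> Der (a * el l) (tmul ts a l)"
| Der_centre: "Der a ts \<Longrightarrow> Der (centre a) ts"

lemma Der_in: "Der a ts \<Longrightarrow> a \<in> B i0 \<and> (\<forall>(r, s)\<in>set ts. r \<in> B i0 \<and> s \<in> B i0)"
proof (induction rule: Der.induct)
  case Der_one
  then show ?case by (auto intro: star_subalgebra.intros)
next
  case (Der_mult a ts l)
  have "el l \<in> B i0" using el_in[of l] Der_mult by simp
  then show ?case using Der_mult t by (auto simp: tmul_def intro: star_subalgebra.intros)
next
  case (Der_centre a ts)
  then show ?case by (auto intro: star_subalgebra_centre)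
qed

text \<open>Carries the equation from words to all elements with a recorded derivative, by induction
  on how they are built. Centring subtracts a scalar, which has derivative zero; the resulting terms
  are matched by the equation for the word \<open>v\<close> alone.\<close>

lemma Der_single:
  assumes "Der a ts" "fst ` set v \<subseteq> {i0}"
  shows "\<phi> (y * a * evm v) = tsum ts 1 (evm v) + dersum a v"
  using assms
proof (induction arbitrary: v rule: Der.induct)
  case Der_one
  then show ?case using single by (simp add: dersum_one)
next
  case (Der_mult a ts l)
  have "\<phi> (y * (a * el l) * evm v) = \<phi> (y * a * evm (l # v))" by (simp add: mult.assoc)
  also have "\<dots> = tsum ts 1 (evm (l # v)) + dersum a (l # v)"
    by (rule Der_mult.IH) (use Der_mult in auto)
  finally show ?case by (simp add: tsum_tmul dersum_Cons)
next
  case (Der_centre a ts)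
  have "\<phi> (y * centre a * evm v) = \<phi> (y * a * evm v) - \<phi> a * \<phi> (y * evm v)"
    by (rule phi_mult_centre)
  also have "\<phi> (y * evm v) = dersum 1 v"
    using single[OF Der_centre.prems] by (simp add: dersum_one)
  finally show ?case using Der_centre.IH[OF Der_centre.prems] dersum_centre[of 1 a v] by simp
qed

text \<open>Product rule for the factors in \<open>C\<close> followed by the word \<open>w\<close>,
  evaluated as in \<open>dersum\<close>: each factor contributes its tensors, with all that precedes
  it gathered in \<open>p\<close> and all that follows it on the right.\<close>

fun Csum :: "'a \<Rightarrow> ('i \<times> 'a \<times> ('a \<times> 'a) list) list \<Rightarrow> ('i \<times> bool) list \<Rightarrow> complex" where
  "Csum p [] w = dersum p w"
| "Csum p ((j, a, ts) # C) w = tsum ts p (prod_list (map (\<lambda>c. fst (snd c)) C) * evm w) + Csum (p * a) C w"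

abbreviation pl :: "('i \<times> 'a \<times> ('a \<times> 'a) list) list \<Rightarrow> 'a" where
  "pl C \<equiv> prod_list (map (\<lambda>c. fst (snd c)) C)"

text \<open>The right-hand side of the equation when a letter moves from the word into the last
  factor and the new factor is centred: the scalar that splits off multiplies the expression for the
  shorter list \<open>C\<close>.\<close>

lemma Csum_merge:
  fixes a l defines "a' \<equiv> a * el l"
  assumes "j \<noteq> i0 \<Longrightarrow> ts = []" "j = fst l"
  shows "Csum p (C @ [(j, a, ts)]) (l # w) =
    Csum p (C @ [(j, centre a', if j = i0 then tmul ts a l else [])]) w + \<phi> a' * Csum p C w"
proof (induction C arbitrary: p)
  case Nil
  show ?case
    using assms ok[of l] dersum_centre[of p a' w]
    by (auto simp: dersum_Cons tsum_tmul a'_def mult.assoc)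
next
  case (Cons c C)
  obtain i b us where c: "c = (i, b, us)" by (cases c)
  have "tsum us p (pl C * (a * (el l * evm w))) =
     tsum us p (pl C * (centre a' * evm w)) + \<phi> a' * tsum us p (pl C * evm w)"
    by (simp add: tsum_centre a'_def mult.assoc)
  then show ?case using Cons.IH[of "p * b"] by (simp add: c algebra_simps)
qed

lemma Csum_append_one: "Csum p (C @ [(j, 1, [])]) w = Csum p C w"
  by (induction C arbitrary: p) (auto simp: mult.assoc)

text \<open>The alternating centred products of freeness with their derivatives recorded. A factor
  with an index other than \<open>i0\<close> is a constant for the derivation, hence the empty
  list.\<close>

definition good :: "('i \<times> 'a \<times> ('a \<times> 'a) list) list \<Rightarrow> bool" where
  "good C \<longleftrightarrow> alt (map (\<lambda>(j, a, ts). (j, a)) C) \<and>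
     (\<forall>(j, a, ts)\<in>set C. if j = i0 then Der a ts else ts = [])"

lemma pl_eq: "pl C = prod_list (map snd (map (\<lambda>(j, a, ts). (j, a)) C))"
  by (simp add: o_def case_prod_unfold)

lemma alt_Cons: "alt (p # ps) \<longleftrightarrow> fst p \<in> I \<and> snd p \<in> B (fst p) \<and> \<phi> (snd p) = 0 \<and> alt ps \<and> (ps \<noteq> [] \<longrightarrow> fst p \<noteq> fst (hd ps))"
  by (cases ps) (auto simp: alternating_def)

lemma alt_snoc: "alt (ps @ [p]) \<longleftrightarrow> alt ps \<and> fst p \<in> I \<and> snd p \<in> B (fst p) \<and> \<phi> (snd p) = 0 \<and>
    (ps \<noteq> [] \<longrightarrow> fst (last ps) \<noteq> fst p)"
  by (cases p) (auto simp: alternating_def distinct_adj_append_iff last_map)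

lemma good_snoc: "good (C @ [(j, a, ts)]) \<longleftrightarrow> good C \<and> j \<in> I \<and> a \<in> B j \<and> \<phi> a = 0 \<and>
    (C \<noteq> [] \<longrightarrow> fst (last C) \<noteq> j) \<and> (if j = i0 then Der a ts else ts = [])"
proof -
  have "C \<noteq> [] \<Longrightarrow> fst (last (map (\<lambda>(j, a, ts). (j, a)) C)) = fst (last C)"
    by (simp add: last_map case_prod_unfold)
  then show ?thesis unfolding good_def by (auto simp: alt_snoc)
qed

text \<open>Every tensor from a factor of \<open>C\<close> has its first component in the algebra of
  \<open>i0\<close>, while the product before it ends in another algebra; so
  \<open>alt_snoc_mult\<close> kills the first of the two moments.\<close>

lemma Csum_zero:
  assumes "alt (ps @ map (\<lambda>(j, a, ts). (j, a)) C)" "ps \<noteq> []"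
    "\<forall>(j, a, ts)\<in>set C. if j = i0 then Der a ts else ts = []"
  shows "Csum (prod_list (map snd ps)) C [] = 0"
  using assms
proof (induction C arbitrary: ps)
  case (Cons c C)
  obtain j a ts where c: "c = (j, a, ts)" by (cases c)
  have "tsum ts (prod_list (map snd ps)) (pl C * evm []) = 0"
  proof (cases "j = i0")
    case True
    then have "Der a ts" using Cons.prems(3) c by auto
    then have r: "\<forall>(r, s)\<in>set ts. r \<in> B i0" using Der_in by fastforce
    have "alt ps" "fst (last ps) \<noteq> i0"
      using Cons.prems(1,2) c True
      by (auto simp: alternating_def distinct_adj_append_iff last_map)
    then have "\<phi> (prod_list (map snd ps) * r) = 0" if "(r, s) \<in> set ts" for r s
      using that r by (intro alt_snoc_mult[OF _ Cons.prems(2) _ i0]) auto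
    then show ?thesis by (intro tsum_zero) auto
  next
    case False
    then show ?thesis using Cons.prems(3) c by auto
  qed
  moreover have "Csum (prod_list (map snd (ps @ [(j, a)]))) C [] = 0"
    by (rule Cons.IH) (use Cons.prems c in auto)
  ultimately show ?case by (simp add: c)
qed auto

lemma phi_y: "\<phi> y = 0"
  using single[of "[]"] by simp

text \<open>Freeness makes both sides zero, except for a single factor with index \<open>i0\<close>,
  where \<open>Der_single\<close> applies. If the first of several factors has index
  \<open>i0\<close>, it is merged with \<open>y\<close>, or replaced by a second tensor component,
  in front of an alternating product.\<close>

lemma good_Nil_formula:
  assumes "good C"
  shows "\<phi> (y * pl C) = Csum 1 C []"
proof (cases C)
  case Nil
  then show ?thesis by (simp add: phi_y)
next
  case (Cons c C')
  obtain j a ts where c: "c = (j, a, ts)" by (cases c)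
  let ?f = "\<lambda>(j, a, ts). (j, a)"
  have aC: "alt ((j, a) # map ?f C')" using assms by (simp add: good_def Cons c)
  have jI: "j \<in> I" "a \<in> B j" "\<phi> a = 0" and aC': "alt (map ?f C')"
    and hd: "C' \<noteq> [] \<Longrightarrow> fst (hd (map ?f C')) \<noteq> j"
    using aC unfolding alt_Cons by auto
  have ts: "if j = i0 then Der a ts else ts = []" using assms by (auto simp: good_def Cons c)
  have rest: "Csum a C' [] = 0"
    using Csum_zero[of "[(j, a)]" C'] aC assms by (auto simp: good_def Cons c)
  show ?thesis
  proof (cases "j = i0")
    case False
    have "alt ((i0, y) # (j, a) # map ?f C')"
      using aC i0 y phi_y False unfolding alt_Cons by auto
    then have "\<phi> (y * pl C) = 0" using alt_zero[of "(i0, y) # (j, a) # map ?f C'"] by (simp add: Cons c pl_eq)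
    then show ?thesis using rest ts False by (simp add: Cons c)
  next
    case True
    then have D: "Der a ts" using ts by simp
    show ?thesis
    proof (cases "C' = []")
      case True
      then show ?thesis using Der_single[OF D, of "[]"] by (simp add: Cons c)
    next
      case False
      have z: "\<phi> (b * pl C') = 0" if "b \<in> B i0" for b
        using alt_Cons_mult[OF aC' _ _ i0 that] hd False True by (simp add: pl_eq)
      have "y * a \<in> B i0" using y jI True by (auto intro: star_subalgebra.intros)
      then have "\<phi> (y * pl C) = 0" using z[of "y * a"] by (simp add: Cons c mult.assoc)
      moreover have "tsum ts 1 (pl C' * evm []) = 0"
        using Der_in[OF D] z by (intro tsum_zero) auto
      ultimately show ?thesis using rest by (simp add: Cons c)
    qed
  qed
qed

text \<open>The letters of \<open>w\<close> are absorbed one by one into the alternating product: a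
  letter with the index of the last factor multiplies that factor, any other opens a new one.
  Centring leaves a scalar times a shorter product, to which the induction hypothesis applies as
  well.\<close>

lemma good_formula:
  assumes "good C" "fst ` set w \<subseteq> I"
  shows "\<phi> (y * pl C * evm w) = Csum 1 C w"
  using assms
proof (induction w arbitrary: C)
  case Nil
  then show ?case using good_Nil_formula by simp
next
  case (Cons l w)
  define j where "j = fst l"
  have jI: "j \<in> I" using Cons.prems by (simp add: j_def)
  have wI: "fst ` set w \<subseteq> I" using Cons.prems by simp
  have step: "\<phi> (y * pl (C @ [(j, a, ts)]) * evm (l # w)) = Csum 1 (C @ [(j, a, ts)]) (l # w)"
    if C: "good C" and last: "C \<noteq> [] \<Longrightarrow> fst (last C) \<noteq> j" and a: "a \<in> B j"
      and ts: "if j = i0 then Der a ts else ts = []" for C a ts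
  proof -
    define a' where "a' = a * el l"
    define ts' where "ts' = (if j = i0 then tmul ts a l else [])"
    have a'B: "a' \<in> B j" using a el_in[of l] by (auto simp: a'_def j_def intro: star_subalgebra.intros)
    have g: "good (C @ [(j, centre a', ts')])"
    proof -
      have "if j = i0 then Der (centre a') ts' else ts' = []"
      proof (cases "j = i0")
        case True
        then have "Der a ts" "fst l = i0" using ts by (simp_all add: j_def)
        then have "Der (centre (a * el l)) (tmul ts a l)" by (intro Der_centre Der_mult)
        then show ?thesis using True by (simp add: a'_def ts'_def)
      qed (simp add: ts'_def)
      then show ?thesis
        unfolding good_snoc using C last jI star_subalgebra_centre[OF a'B] phi_centre by blast
    qed
    have "\<phi> (y * pl (C @ [(j, a, ts)]) * evm (l # w)) = \<phi> (y * pl C * a' * evm w)"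
      by (simp add: a'_def mult.assoc)
    also have "\<dots> = \<phi> (y * pl C * centre a' * evm w) + \<phi> a' * \<phi> (y * pl C * evm w)"
      by (simp only: phi_mult_centre) simp
    also have "\<phi> (y * pl C * centre a' * evm w) = Csum 1 (C @ [(j, centre a', ts')]) w"
      using Cons.IH[OF g wI] by (simp add: mult.assoc)
    also have "\<phi> (y * pl C * evm w) = Csum 1 C w" by (rule Cons.IH[OF C wI])
    also have "Csum 1 (C @ [(j, centre a', ts')]) w + \<phi> a' * Csum 1 C w = Csum 1 (C @ [(j, a, ts)]) (l # w)"
      unfolding a'_def ts'_def by (rule Csum_merge[symmetric]) (use ts in \<open>auto simp: j_def\<close>)
    finally show ?thesis .
  qed
  show ?case
  proof (cases "C \<noteq> [] \<and> fst (last C) = j")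
    case True
    obtain a ts where la: "last C = (j, a, ts)" using True by (cases "last C") auto
    define C' where "C' = butlast C"
    have CC: "C = C' @ [(j, a, ts)]" using True append_butlast_last_id[of C] unfolding la C'_def by simp
    have "good C'" "C' \<noteq> [] \<Longrightarrow> fst (last C') \<noteq> j" "a \<in> B j" "if j = i0 then Der a ts else ts = []"
      using Cons.prems(1) unfolding CC good_snoc by blast+
    then show ?thesis unfolding CC by (rule step)
  next
    case False
    \<comment> \<open>The new factor starts as the unit, which is not centred. This is harmless:
      \<open>step\<close> asks for goodness of the factors before it and centres the last one after
      the multiplication.\<close>
    have "\<phi> (y * pl (C @ [(j, 1, [])]) * evm (l # w)) = Csum 1 (C @ [(j, 1, [])]) (l # w)"
      by (rule step) (use False Cons.prems(1) in \<open>auto intro: star_subalgebra.one Der_one\<close>)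
    then show ?thesis by (simp add: Csum_append_one)
  qed
qed

theorem moment_rec:
  assumes "fst ` set v \<subseteq> I"
  shows "\<phi> (y * evm v) =
      (\<Sum>k<length v. if ok (v ! k) then \<phi> (evm (take k v)) * \<phi> (t * evm (drop (Suc k) v)) else 0)"
proof -
  have "good []" by (simp add: good_def alternating_def)
  from good_formula[OF this assms] show ?thesis
    unfolding dersum_one[symmetric] by simp
qed

end

section \<open>Reduced words, and the equations of the limit variables\<close>

definition cancels :: "'i \<times> bool \<Rightarrow> 'i \<times> bool \<Rightarrow> bool" where
  "cancels l l' \<longleftrightarrow> fst l = fst l' \<and> snd l \<noteq> snd l'"

definition reduced :: "('i \<times> bool) list \<Rightarrow> bool" where
  "reduced w \<longleftrightarrow> successively (\<lambda>l l'. \<not> cancels l l') w"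

lemma reduced_Nil [simp]: "reduced []"
  by (simp add: reduced_def)

lemma reduced_Cons: "reduced (l # w) \<longleftrightarrow> reduced w \<and> (w \<noteq> [] \<longrightarrow> \<not> cancels l (hd w))"
  by (cases w) (auto simp: reduced_def)

lemma not_reduced_split: "\<not> reduced w \<Longrightarrow> \<exists>u l l' v. w = u @ l # l' # v \<and> cancels l l'"
proof (induction w)
  case (Cons l w)
  show ?case
  proof (cases "reduced w")
    case True
    then obtain l' v where "w = l' # v" "cancels l l'"
      using Cons.prems by (cases w) (auto simp: reduced_Cons)
    then have "l # w = [] @ l # l' # v \<and> cancels l l'" by simp
    then show ?thesis by blast
  next
    case False
    then obtain u a b v where "w = u @ a # b # v" "cancels a b" using Cons.IH by blast
    then have "l # w = (l # u) @ a # b # v \<and> cancels a b" by simp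
    then show ?thesis by blast
  qed
qed simp

context star_free_family
begin

text \<open>A circular letter pairs with its adjoint only, and the pair disappears, hence
  \<open>t = 1\<close>.\<close>

lemma circular_schwinger_dyson:
  assumes i: "i \<in> I" and circ: "standard_circular \<phi> star (x i)" and v: "fst ` set v \<subseteq> I"
  shows "\<phi> (evm ((i, b) # v)) =
    (\<Sum>k<length v. if v ! k = (i, \<not> b) then \<phi> (evm (take k v)) * \<phi> (evm (drop (Suc k) v)) else 0)"
proof -
  have evm: "evm u = prod_list (map (\<lambda>b. if b then star (x i) else x i) (map snd u))"
    if "fst ` set u \<subseteq> {i}" for u
    using that by (induction u) (auto simp: letter_val_def)
  interpret schwinger_dyson cscale \<phi> star I x i "el (i, b)" 1 "\<lambda>l. l = (i, \<not> b)"
  proof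
    show "el (i, b) \<in> B i" using el_in[of "(i, b)"] by simp
    show "1 \<in> B i" by (rule star_subalgebra.one)
    fix u :: "('i \<times> bool) list" assume u: "fst ` set u \<subseteq> {i}"
    have sub: "fst ` set (take k u) \<subseteq> {i}" "fst ` set (drop k u) \<subseteq> {i}" for k
      using u set_take_subset[of k u] set_drop_subset[of k u] by blast+
    have nth: "u ! k = (i, \<not> b) \<longleftrightarrow> map snd u ! k = (\<not> b)" if "k < length u" for k
    proof -
      have "fst (u ! k) = i" using u nth_mem[OF that] by blast
      then show ?thesis using that by (simp add: prod_eq_iff)
    qed
    have "\<phi> (el (i, b) * evm u) = \<phi> (prod_list (map (\<lambda>b. if b then star (x i) else x i) (b # map snd u)))"
      by (simp add: evm[OF u] letter_val_def)
    also have "\<dots> = (\<Sum>k<length u. if u ! k = (i, \<not> b) then \<phi> (evm (take k u)) * \<phi> (evm (drop (Suc k) u)) else 0)"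
      unfolding circular_moment_rec[where \<phi>=\<phi>, OF unital circ]
      by (intro sum.cong) (auto simp: nth evm sub take_map drop_map)
    finally show "\<phi> (el (i, b) * evm u) =
       (\<Sum>k<length u. if u ! k = (i, \<not> b) then \<phi> (evm (take k u)) * \<phi> (1 * evm (drop (Suc k) u)) else 0)"
      by (simp cong: if_cong)
  qed (use i in auto)
  show ?thesis using moment_rec[OF v] by (simp cong: if_cong)
qed

text \<open>A letter pairs with every letter of the same index, and one copy survives the cut, hence
  \<open>t = x i\<close>. By self-adjointness the flags \<open>b\<close> and \<open>b'\<close> are
  arbitrary.\<close>

lemma poisson_schwinger_dyson:
  assumes i: "i \<in> I" and poi: "free_poisson \<phi> star c (x i)" and v: "fst ` set v \<subseteq> I"
  shows "\<phi> (evm ((i, b) # v)) = c * \<phi> (evm v) +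
    (\<Sum>k<length v. if fst (v ! k) = i then \<phi> (evm (take k v)) * \<phi> (evm ((i, b') # drop (Suc k) v)) else 0)"
proof -
  have el: "el (i, d) = x i" for d using poi by (simp add: letter_val_def free_poisson_def)
  have evm: "evm u = x i ^ length u" if "fst ` set u \<subseteq> {i}" for u
    using that
  proof (induction u)
    case (Cons l u)
    then show ?case using el[of "snd l"] by (cases l) auto
  qed simp
  \<comment> \<open>Subtracting \<open>c\<close> absorbs the contribution of the singleton block, so
    that only cuts remain, as the general equation requires.\<close>
  let ?y = "x i - cscale c 1"
  have ymul: "\<phi> (?y * a) = \<phi> (x i * a) - c * \<phi> a" for a
    by (simp only: left_diff_distrib cscale_mult_left phi_diff phi_scale) simp
  interpret schwinger_dyson cscale \<phi> star I x i ?y "x i" "\<lambda>l. fst l = i"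
  proof
    show t: "x i \<in> B i" by (rule star_subalgebra.gen) simp
    then show "?y \<in> B i" by (rule star_subalgebra_centre)
    fix u :: "('i \<times> bool) list" assume u: "fst ` set u \<subseteq> {i}"
    have sub: "fst ` set (take k u) \<subseteq> {i}" "fst ` set (drop k u) \<subseteq> {i}" for k
      using u set_take_subset[of k u] set_drop_subset[of k u] by blast+
    have nth: "fst (u ! k) = i" if "k < length u" for k
      using u nth_mem[OF that] by blast
    have "\<phi> (?y * evm u) = (\<Sum>k<length u. \<phi> (x i ^ k) * \<phi> (x i ^ (length u - k)))"
      unfolding ymul evm[OF u] using free_poisson_moment_rec[where \<phi>=\<phi>, OF unital poi, of "length u"] by simp
    also have "\<dots> = (\<Sum>k<length u. if fst (u ! k) = i then \<phi> (evm (take k u)) * \<phi> (x i * evm (drop (Suc k) u)) else 0)"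
    proof (rule sum.cong[OF refl])
      fix k assume "k \<in> {..<length u}"
      then have "x i ^ (length u - k) = x i * x i ^ (length u - Suc k)"
        by (simp add: Suc_diff_Suc flip: power_Suc)
      then show "\<phi> (x i ^ k) * \<phi> (x i ^ (length u - k)) =
         (if fst (u ! k) = i then \<phi> (evm (take k u)) * \<phi> (x i * evm (drop (Suc k) u)) else 0)"
        using \<open>k \<in> _\<close> by (simp add: nth evm[OF sub(1)] evm[OF sub(2)])
    qed
    finally show "\<phi> (?y * evm u) =
       (\<Sum>k<length u. if fst (u ! k) = i then \<phi> (evm (take k u)) * \<phi> (x i * evm (drop (Suc k) u)) else 0)" .
  qed (use i in auto)
  show ?thesis using moment_rec[OF v] unfolding ymul by (simp add: el diff_eq_eq add.commute cong: if_cong)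
qed

lemma evm_cancel:
  assumes "haar_unitary \<phi> star (x (fst l))" "cancels l l'"
  shows "evm (u @ l # l' # v) = evm (u @ v)"
proof -
  have "el l * el l' = 1" using assms by (auto simp: letter_val_def haar_unitary_def cancels_def)
  then have "el l * (el l' * evm v) = evm v" by (simp flip: mult.assoc)
  then show ?thesis by simp
qed

text \<open>Reads the word as a product of maximal powers. In a reduced word the next letter either
  equals the current one and raises the exponent, or has another index and opens a new factor.
  Positive powers of a Haar unitary or of its adjoint are centred, so the factors alternate as
  freeness demands.\<close>

lemma haar_power_free:
  assumes "alt (ps @ [(fst l, el l ^ n)])" "n > 0" "reduced (l # w)"
    and "fst ` set (l # w) \<subseteq> J" "J \<subseteq> I" "\<And>i. i \<in> J \<Longrightarrow> haar_unitary \<phi> star (x i)"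
  shows "\<phi> (prod_list (map snd ps) * el l ^ n * evm w) = 0"
  using assms(1-4)
proof (induction w arbitrary: ps l n)
  case Nil
  then show ?case using alt_zero[OF Nil(1)] by simp
next
  case (Cons l' w)
  have haar0: "\<phi> (el m ^ k) = 0" if "k > 0" "fst m \<in> J" for m k
    using assms(6)[OF that(2)] that(1) by (auto simp: haar_unitary_def letter_val_def)
  have powB: "el m ^ k \<in> B (fst m)" for m k
    by (induction k) (auto intro: star_subalgebra.intros el_in)
  have J': "fst l' \<in> J" "fst l' \<in> I" using Cons.prems assms(5) by auto
  show ?case
  proof (cases "fst l' = fst l")
    case True
    then have "l' = l" using Cons.prems(3) by (auto simp: reduced_Cons cancels_def prod_eq_iff)
    have "alt (ps @ [(fst l, el l ^ Suc n)])"
      using Cons.prems(1) haar0[of "Suc n" l] J' True powB[of l "Suc n"]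
      by (auto simp: alternating_def distinct_adj_append_iff)
    from Cons.IH[OF this] have "\<phi> (prod_list (map snd ps) * el l ^ Suc n * evm w) = 0"
      using Cons.prems \<open>l' = l\<close> by (simp add: reduced_Cons)
    moreover have "prod_list (map snd ps) * el l ^ n * evm (l' # w) = prod_list (map snd ps) * el l ^ Suc n * evm w"
      unfolding power_Suc2 using \<open>l' = l\<close> by (simp add: mult.assoc)
    ultimately show ?thesis by simp
  next
    case False
    have "alt ((ps @ [(fst l, el l ^ n)]) @ [(fst l', el l' ^ 1)])"
      using Cons.prems(1) haar0[of 1 l'] J' False powB[of l' 1]
      by (auto simp: alternating_def distinct_adj_append_iff)
    from Cons.IH[OF this] have "\<phi> (prod_list (map snd (ps @ [(fst l, el l ^ n)])) * el l' ^ 1 * evm w) = 0"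
      using Cons.prems by (simp add: reduced_Cons)
    then show ?thesis by (simp add: mult.assoc)
  qed
qed

lemma haar_reduced_zero:
  assumes "w \<noteq> []" "reduced w" "fst ` set w \<subseteq> J" "J \<subseteq> I" "\<And>i. i \<in> J \<Longrightarrow> haar_unitary \<phi> star (x i)"
  shows "\<phi> (evm w) = 0"
proof -
  obtain l v where w: "w = l # v" using assms(1) by (cases w) auto
  have l: "fst l \<in> J" "fst l \<in> I" using assms w by auto
  have "\<phi> (el l ^ k) = 0" if "k > 0" for k
    using assms(5)[OF l(1)] that by (auto simp: haar_unitary_def letter_val_def)
  from this[of 1] have "alt ([] @ [(fst l, el l ^ 1)])" using l el_in[of l] by (simp add: alternating_def)
  from haar_power_free[OF this _ _ _ assms(4,5), of v] assms show ?thesis by (simp add: w)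
qed

end

section \<open>Uniformly random permutations\<close>

definition act :: "('i \<Rightarrow> nat \<Rightarrow> nat) \<Rightarrow> 'i \<times> bool \<Rightarrow> nat \<Rightarrow> nat" where
  "act p l = (if snd l then inv_into UNIV (p (fst l)) else p (fst l))"

text \<open>The latest point comes first, because words act from the right; the list has one entry
  more than the word.\<close>

fun traj :: "('i \<Rightarrow> nat \<Rightarrow> nat) \<Rightarrow> ('i \<times> bool) list \<Rightarrow> nat \<Rightarrow> nat list" where
  "traj p [] j = [j]"
| "traj p (l # w) j = act p l (hd (traj p w j)) # traj p w j"

definition pact :: "('i \<Rightarrow> nat \<Rightarrow> nat) \<Rightarrow> ('i \<times> bool) list \<Rightarrow> nat \<Rightarrow> nat" where
  "pact p w j = foldr (act p) w j"

lemma hd_traj: "hd (traj p w j) = pact p w j"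
  by (induction w) (auto simp: pact_def)

lemma length_traj [simp]: "length (traj p w j) = Suc (length w)"
  by (induction w) auto

lemma traj_ne [simp]: "traj p w j \<noteq> []"
  by (cases w) auto

lemma last_traj: "last (traj p w j) = j"
  by (induction w) auto

lemma traj_append: "\<exists>A. traj p (v @ w) j = A @ traj p w j \<and> length A = length v"
proof (induction v)
  case (Cons l v)
  then obtain A where "traj p (v @ w) j = A @ traj p w j" "length A = length v" by auto
  then show ?case by (intro exI[of _ "act p l (hd (traj p (v @ w) j)) # A"]) simp
qed auto

lemma fixed_not_distinct: "w \<noteq> [] \<Longrightarrow> pact p w j = j \<Longrightarrow> \<not> distinct (traj p w j)"
proof (cases w)
  case (Cons l v)
  assume "pact p w j = j"
  moreover have "j \<in> set (traj p v j)" using last_in_set[OF traj_ne, of p v j] by (simp add: last_traj)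
  ultimately show ?thesis using hd_traj[of p w j] by (simp add: Cons)
qed simp

text \<open>The transposition is composed on the output side of the letter \<open>l\<close>, so that
  a step with \<open>l\<close> that led to \<open>y\<close> now leads to \<open>z\<close>, whether
  \<open>l\<close> denotes a permutation or an inverse.\<close>

definition swap_letter :: "('i \<Rightarrow> nat \<Rightarrow> nat) \<Rightarrow> 'i \<times> bool \<Rightarrow> nat \<Rightarrow> nat \<Rightarrow> 'i \<Rightarrow> nat \<Rightarrow> nat" where
  "swap_letter p l y z = p(fst l := if snd l then p (fst l) \<circ> Transposition.transpose y z else Transposition.transpose y z \<circ> p (fst l))"

lemma swap_letter_twice: "swap_letter (swap_letter p l y z) l y z = p"
  by (rule ext) (auto simp: swap_letter_def fun_upd_def o_def)

lemma act_swap_same: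
  assumes "bij (p (fst l))"
  shows "act (swap_letter p l y z) l x = Transposition.transpose y z (act p l x)"
proof (cases "snd l")
  case True
  have "inv_into UNIV (p (fst l) \<circ> Transposition.transpose y z) = Transposition.transpose y z \<circ> inv_into UNIV (p (fst l))"
    by (subst o_inv_distrib) (use assms in auto)
  then show ?thesis using True by (simp add: act_def swap_letter_def)
qed (simp add: act_def swap_letter_def)

lemma act_swap_cancel:
  assumes "bij (p (fst l))" "cancels l l'"
  shows "act (swap_letter p l y z) l' x = act p l' (Transposition.transpose y z x)"
proof (cases "snd l")
  case True
  then show ?thesis using assms by (auto simp: act_def swap_letter_def cancels_def)
next
  case False
  have "inv_into UNIV (Transposition.transpose y z \<circ> p (fst l)) = inv_into UNIV (p (fst l)) \<circ> Transposition.transpose y z"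
    by (subst o_inv_distrib) (use assms in auto)
  then show ?thesis using False assms by (auto simp: act_def swap_letter_def cancels_def)
qed

lemma act_inverse:
  assumes "bij (p (fst l))" "cancels l l'"
  shows "act p l' (act p l x) = x" "act p l (act p l' x) = x"
  using assms by (auto simp: act_def cancels_def bij_is_inj bij_is_surj surj_f_inv_f)

lemma inj_act: "bij (p (fst l)) \<Longrightarrow> inj (act p l)"
  by (auto simp: act_def bij_is_inj bij_imp_bij_inv)

text \<open>
  Switching: if the path closes up at its next step, sending that step to an unvisited point \<open>z\<close>
  instead leaves the earlier part of the path unchanged, because the word is reduced.
\<close>

lemma traj_swap:
  assumes bij: "\<And>l. l \<in> set (l0 # w) \<Longrightarrow> bij (p (fst l))" and red: "reduced (l0 # w)"
    and dist: "distinct (traj p w j)" and z: "z \<notin> set (traj p w j)"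
    and y: "act p l0 (hd (traj p w j)) = y"
    and w: "w = wa @ wb"
  shows "traj (swap_letter p l0 y z) wb j = traj p wb j"
  using w
proof (induction wb arbitrary: wa)
  case (Cons l wb)
  let ?p = "swap_letter p l0 y z"
  define u where "u = hd (traj p wb j)"
  define v where "v = act p l u"
  define h where "h = hd (traj p w j)"
  have IH: "traj ?p wb j = traj p wb j" using Cons.IH[of "wa @ [l]"] Cons.prems by simp
  obtain A where A: "traj p w j = A @ v # traj p wb j" "length A = length wa"
    using traj_append[of p wa "l # wb" j] Cons.prems by (auto simp: u_def v_def)
  have uT: "u \<in> set (traj p wb j)" by (simp add: u_def)
  have hu: "h \<noteq> u" using dist A uT unfolding h_def by (cases A) auto
  have uz: "u \<noteq> z" "v \<noteq> z" using z A uT by auto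
  have bl0: "bij (p (fst l0))" and bl: "bij (p (fst l))" using bij Cons.prems by auto
  have "act ?p l u = v"
  proof (cases "fst l = fst l0")
    case False then show ?thesis by (simp add: v_def act_def swap_letter_def)
  next
    case same: True
    show ?thesis
    proof (cases "snd l = snd l0")
      case True
      then have l: "l = l0" using same by (simp add: prod_eq_iff)
      \<comment> \<open>The closing step sends \<open>h\<close> to \<open>y\<close>; an earlier step
        with the same letter starts at another point and hence ends at another one.\<close>
      have "v \<noteq> y"
        using y hu injD[OF inj_act[of p l0]] bl0 unfolding h_def[symmetric] v_def l by metis
      then show ?thesis using act_swap_same[of p l0 y z u, OF bl0] uz by (simp add: l v_def transpose_apply_other)
    next
      case False
      then have c: "cancels l0 l" using same by (simp add: cancels_def)
      \<comment> \<open>Otherwise this step inverts the closing one and arrives at \<open>h\<close>.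
        As the path has no repetitions, it is the step right before, and the two letters
        cancel.\<close>
      have "u \<noteq> y"
      proof
        assume "u = y"
        then have "v = h" using act_inverse(1)[of p l0 l h, OF bl0 c] y by (simp add: v_def h_def)
        then have "A = []" using dist A unfolding h_def by (cases A) auto
        then have "w = l # wb" using A Cons.prems by simp
        then show False using red c by (simp add: reduced_Cons)
      qed
      then show ?thesis using act_swap_cancel[of p l0 l y z u, OF bl0 c] uz by (simp add: v_def transpose_apply_other)
    qed
  qed
  then show ?case by (simp add: IH u_def v_def)
qed simp

section \<open>Counting permutation tuples whose path revisits a point\<close>

definition perm_tuples :: "nat \<Rightarrow> 'i set \<Rightarrow> ('i \<Rightarrow> nat \<Rightarrow> nat) set" where
  "perm_tuples N R = (\<Pi>\<^sub>E i\<in>R. {p. p permutes {..<N}})"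

lemma finite_perm_tuples [intro]: "finite R \<Longrightarrow> finite (perm_tuples N R)"
  unfolding perm_tuples_def by (intro finite_PiE finite_permutations) auto

lemma perm_tuples_permutes: "p \<in> perm_tuples N R \<Longrightarrow> i \<in> R \<Longrightarrow> p i permutes {..<N}"
  by (auto simp: perm_tuples_def)

lemma card_perm_tuples_pos: "finite R \<Longrightarrow> card (perm_tuples N R) > 0"
proof -
  assume "finite R"
  moreover have "(\<lambda>i\<in>R. id) \<in> perm_tuples N R" by (auto simp: perm_tuples_def permutes_id)
  ultimately show ?thesis using finite_perm_tuples[of R N] by (auto simp: card_gt_0_iff)
qed

lemma act_lt:
  assumes "p \<in> perm_tuples N R" "fst l \<in> R" "x < N"
  shows "act p l x < N"
proof -
  have "act p l permutes {..<N}"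
    using perm_tuples_permutes[OF assms(1,2)] by (auto simp: act_def permutes_inv)
  then show ?thesis using permutes_in_image[of "act p l" "{..<N}" x] assms by simp
qed

lemma traj_subset:
  assumes "p \<in> perm_tuples N R" "fst ` set w \<subseteq> R" "j < N"
  shows "set (traj p w j) \<subseteq> {..<N}"
  using assms(2)
proof (induction w)
  case (Cons l w)
  then have "set (traj p w j) \<subseteq> {..<N}" by simp
  moreover from this have "hd (traj p w j) < N" using hd_in_set[OF traj_ne, of p w j] by blast
  ultimately show ?case using act_lt[OF assms(1), of l] Cons.prems by auto
qed (use assms in auto)

lemma swap_letter_perm_tuples:
  assumes "p \<in> perm_tuples N R" "fst l \<in> R" "y < N" "z < N"
  shows "swap_letter p l y z \<in> perm_tuples N R"
proof -
  have "Transposition.transpose y z permutes {..<N}" using assms by (intro permutes_swap_id) auto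
  then have "(if snd l then p (fst l) \<circ> Transposition.transpose y z else Transposition.transpose y z \<circ> p (fst l)) permutes {..<N}"
    using perm_tuples_permutes[OF assms(1,2)] by (auto intro: permutes_compose)
  then show ?thesis using assms(1,2)
    by (auto simp: perm_tuples_def swap_letter_def PiE_def extensional_def)
qed

text \<open>Double counting: a tuple whose path closes up at position \<open>t\<close> can be
  switched to end at any of the \<open>N - Suc (length w)\<close> unvisited points \<open>z\<close>.
  The new tuple determines both data: its path along \<open>w\<close> is the old one, its last step
  leads to \<open>z\<close>, and switching again restores the old tuple.\<close>

lemma card_closing_step:
  assumes R: "finite R" "fst ` set (l # w) \<subseteq> R" and red: "reduced (l # w)" and j: "j < N"
    and t: "t \<le> length w"
  shows "card {p \<in> perm_tuples N R. distinct (traj p w j) \<and> act p l (hd (traj p w j)) = traj p w j ! t}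
     * (N - Suc (length w)) \<le> card (perm_tuples N R)" (is "card ?A * _ \<le> _")
proof -
  let ?S = "SIGMA p:?A. {..<N} - set (traj p w j)"
  let ?f = "\<lambda>(p, z). swap_letter p l (traj p w j ! t) z"
  have swap: "traj (swap_letter p l (traj p w j ! t) z) w j = traj p w j"
     "act (swap_letter p l (traj p w j ! t) z) l (hd (traj p w j)) = z"
     "swap_letter p l (traj p w j ! t) z \<in> perm_tuples N R"
    if p: "p \<in> ?A" and z: "z \<in> {..<N} - set (traj p w j)" for p z
  proof -
    have bij: "bij (p (fst m))" if "m \<in> set (l # w)" for m
      using perm_tuples_permutes[of p N R "fst m"] p R that permutes_bij by blast
    show "traj (swap_letter p l (traj p w j ! t) z) w j = traj p w j"
      by (rule traj_swap[where w=w and wa="[]"]) (use p z red bij in auto)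
    show "act (swap_letter p l (traj p w j ! t) z) l (hd (traj p w j)) = z"
      using p bij[of l] by (simp add: act_swap_same)
    have "traj p w j ! t \<in> set (traj p w j)" using t by (intro nth_mem) simp
    then have "traj p w j ! t < N" using traj_subset[of p N R w j] p R j by auto
    then show "swap_letter p l (traj p w j ! t) z \<in> perm_tuples N R"
      using p z R by (intro swap_letter_perm_tuples) auto
  qed
  have "inj_on ?f ?S"
  proof (rule inj_onI)
    fix a b assume a: "a \<in> ?S" and b: "b \<in> ?S" and fab: "?f a = ?f b"
    obtain p z where az: "a = (p, z)" by (cases a)
    obtain q z' where bz: "b = (q, z')" by (cases b)
    have p: "p \<in> perm_tuples N R" "distinct (traj p w j)" "act p l (hd (traj p w j)) = traj p w j ! t"
      and z: "z \<in> {..<N}" "z \<notin> set (traj p w j)"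
      and q: "q \<in> perm_tuples N R" "distinct (traj q w j)" "act q l (hd (traj q w j)) = traj q w j ! t"
      and z': "z' \<in> {..<N}" "z' \<notin> set (traj q w j)"
      and eq: "swap_letter p l (traj p w j ! t) z = swap_letter q l (traj q w j ! t) z'"
      using a b fab by (auto simp: az bz)
    have T: "traj p w j = traj q w j" using swap(1)[of p z] swap(1)[of q z'] p q z z' eq by simp
    then have "z = z'" using swap(2)[of p z] swap(2)[of q z'] p q z z' eq by simp
    then have "p = q" using eq T swap_letter_twice by metis
    then show "a = b" using \<open>z = z'\<close> by (simp add: az bz)
  qed
  then have "card ?S \<le> card (perm_tuples N R)"
    by (rule card_inj_on_le) (use swap(3) finite_perm_tuples[OF R(1)] in auto)
  moreover have "card ?S = (\<Sum>p\<in>?A. card ({..<N} - set (traj p w j)))"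
    by (rule card_SigmaI) (use finite_perm_tuples[OF R(1)] in auto)
  moreover have "(\<Sum>p\<in>?A. card ({..<N} - set (traj p w j))) = (\<Sum>p\<in>?A. N - Suc (length w))"
  proof (rule sum.cong[OF refl])
    fix p assume p: "p \<in> ?A"
    have "card ({..<N} - set (traj p w j)) = N - card (set (traj p w j))"
      using traj_subset[of p N R w j] p R j by (subst card_Diff_subset) auto
    then show "card ({..<N} - set (traj p w j)) = N - Suc (length w)"
      using p by (simp add: distinct_card)
  qed
  ultimately show ?thesis by simp
qed

text \<open>A path of \<open>n + 1\<close> steps that revisits a point does so within the first
  \<open>n\<close> steps or closes up at one of \<open>n + 1\<close> positions, and
  \<open>n\<^sup>2 + (n + 1) \<le> (n + 1)\<^sup>2\<close>.\<close>

lemma card_not_distinct: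
  assumes R: "finite R" "fst ` set w \<subseteq> R" and red: "reduced w" and j: "j < N"
  shows "card {p \<in> perm_tuples N R. \<not> distinct (traj p w j)} * (N - length w)
     \<le> length w ^ 2 * card (perm_tuples N R)"
  using R(2) red
proof (induction w)
  case (Cons l w)
  let ?K = "card (perm_tuples N R)" and ?n = "length w"
  let ?A = "\<lambda>t. {p \<in> perm_tuples N R. distinct (traj p w j) \<and> act p l (hd (traj p w j)) = traj p w j ! t}"
  let ?D = "{p \<in> perm_tuples N R. \<not> distinct (traj p w j)}"
  have fin: "finite (perm_tuples N R)" using R by auto
  have "{p \<in> perm_tuples N R. \<not> distinct (traj p (l # w) j)} \<subseteq> ?D \<union> (\<Union>t\<le>?n. ?A t)"
    by (auto simp: in_set_conv_nth less_Suc_eq_le)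
  then have "card {p \<in> perm_tuples N R. \<not> distinct (traj p (l # w) j)} \<le> card (?D \<union> (\<Union>t\<le>?n. ?A t))"
    using fin by (intro card_mono) auto
  also have "\<dots> \<le> card ?D + card (\<Union>t\<le>?n. ?A t)" by (rule card_Un_le)
  also have "card (\<Union>t\<le>?n. ?A t) \<le> (\<Sum>t\<le>?n. card (?A t))" by (rule card_UN_le) auto
  finally have "card {p \<in> perm_tuples N R. \<not> distinct (traj p (l # w) j)} * (N - Suc ?n)
      \<le> (card ?D + (\<Sum>t\<le>?n. card (?A t))) * (N - Suc ?n)" by simp
  also have "\<dots> = card ?D * (N - Suc ?n) + (\<Sum>t\<le>?n. card (?A t) * (N - Suc ?n))"
    by (simp add: add_mult_distrib sum_distrib_right)
  also have "card ?D * (N - Suc ?n) \<le> card ?D * (N - ?n)" by (intro mult_le_mono) auto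
  also have "\<dots> \<le> ?n ^ 2 * ?K" using Cons by (simp add: reduced_Cons)
  also have "(\<Sum>t\<le>?n. card (?A t) * (N - Suc ?n)) \<le> (\<Sum>t\<le>?n. ?K)"
    using Cons.prems by (intro sum_mono card_closing_step R j) auto
  finally show ?case by (simp add: power2_eq_square algebra_simps)
qed simp

lemma pact_cancel:
  assumes "p \<in> perm_tuples N R" "fst l \<in> R" "cancels l l'"
  shows "pact p (u @ l # l' # v) = pact p (u @ v)"
proof -
  have "bij (p (fst l'))" "cancels l' l"
    using perm_tuples_permutes[OF assms(1,2)] permutes_bij assms(3) by (auto simp: cancels_def)
  then have "act p l (act p l' x) = x" for x by (rule act_inverse(1))
  then show ?thesis by (simp add: pact_def fun_eq_iff)
qed

text \<open>One reduced word has to serve for permutations of every size and for the limit algebra.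
  The quantification over all \<open>h\<close> that are invariant under cancellation allows
  \<open>evm\<close> to be inserted later.\<close>

lemma pact_reduce:
  assumes "fst ` set w \<subseteq> R"
  shows "\<exists>w'. reduced w' \<and> fst ` set w' \<subseteq> R \<and> (\<forall>N. \<forall>p\<in>perm_tuples N R. pact p w = pact p w') \<and>
    (\<forall>(h :: ('i \<times> bool) list \<Rightarrow> 'b). (\<forall>u l l' v. fst l \<in> R \<longrightarrow> cancels l l' \<longrightarrow> h (u @ l # l' # v) = h (u @ v)) \<longrightarrow> h w = h w')"
  using assms
proof (induction "length w" arbitrary: w rule: less_induct)
  case less
  show ?case
  proof (cases "reduced w")
    case True then show ?thesis using less.prems by blast
  next
    case False
    then obtain u l l' v where w: "w = u @ l # l' # v" "cancels l l'" using not_reduced_split by blast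
    have uv: "length (u @ v) < length w" "fst ` set (u @ v) \<subseteq> R" "fst l \<in> R" using w less.prems by auto
    from less.hyps[OF uv(1,2)] obtain w' where w': "reduced w'" "fst ` set w' \<subseteq> R"
      "\<And>N p. p\<in>perm_tuples N R \<Longrightarrow> pact p (u @ v) = pact p w'"
      "\<And>h :: ('i \<times> bool) list \<Rightarrow> 'b. (\<forall>u l l' v. fst l \<in> R \<longrightarrow> cancels l l' \<longrightarrow> h (u @ l # l' # v) = h (u @ v)) \<Longrightarrow> h (u @ v) = h w'"
      by metis
    have "pact p w = pact p w'" if "p \<in> perm_tuples N R" for N p
      using pact_cancel[OF that uv(3) w(2)] w'(3)[OF that] w by simp
    moreover have "h w = h w'" if "\<forall>u l l' v. fst l \<in> R \<longrightarrow> cancels l l' \<longrightarrow> h (u @ l # l' # v) = h (u @ v)" for h :: "('i \<times> bool) list \<Rightarrow> 'b"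
    proof -
      have "h w = h (u @ v)" using that uv(3) w by blast
      then show ?thesis using w'(4)[OF that] by simp
    qed
    ultimately show ?thesis using w'(1,2) by blast
  qed
qed

section \<open>Traces of words of matrices\<close>

text \<open>Matrices are plain functions of two indices, read below \<open>N\<close>, which avoids
  dimension conditions; \<open>normalized_trace_eval\<close> connects them with the matrices of the
  theorem.\<close>

primrec wd :: "nat \<Rightarrow> ('l \<Rightarrow> nat \<Rightarrow> nat \<Rightarrow> complex) \<Rightarrow> 'l list \<Rightarrow> nat \<Rightarrow> nat \<Rightarrow> complex" where
  "wd N A [] i j = (if i = j then 1 else 0)"
| "wd N A (l # w) i j = (\<Sum>k<N. A l i k * wd N A w k j)"

definition trw :: "nat \<Rightarrow> ('l \<Rightarrow> nat \<Rightarrow> nat \<Rightarrow> complex) \<Rightarrow> 'l list \<Rightarrow> complex" where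
  "trw N A w = (\<Sum>i<N. wd N A w i i) / of_nat N"

lemma wd_append: "i < N \<Longrightarrow> wd N A (v @ w) i j = (\<Sum>k<N. wd N A v i k * wd N A w k j)"
proof (induction v arbitrary: i)
  case Nil
  then have "(\<Sum>k<N. (if i = k then 1 else 0) * wd N A w k j) = (\<Sum>k<N. if i = k then wd N A w k j else 0)"
    by (intro sum.cong) auto
  then show ?case using Nil by simp
next
  case (Cons l v)
  have "wd N A ((l # v) @ w) i j = (\<Sum>k<N. \<Sum>m<N. A l i k * wd N A v k m * wd N A w m j)"
    using Cons.IH by (simp add: sum_distrib_left mult.assoc)
  also have "\<dots> = (\<Sum>m<N. \<Sum>k<N. A l i k * wd N A v k m * wd N A w m j)" by (rule sum.swap)
  finally show ?case by (simp add: sum_distrib_right)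
qed

lemma trw_rotate: "trw N A (v @ w) = trw N A (w @ v)"
proof -
  have "(\<Sum>i<N. wd N A (v @ w) i i) = (\<Sum>i<N. \<Sum>k<N. wd N A v i k * wd N A w k i)"
    by (simp add: wd_append)
  also have "\<dots> = (\<Sum>k<N. \<Sum>i<N. wd N A w k i * wd N A v i k)"
    by (subst sum.swap) (simp add: mult.commute)
  also have "\<dots> = (\<Sum>k<N. wd N A (w @ v) k k)" by (simp add: wd_append)
  finally show ?thesis by (simp add: trw_def)
qed

lemma wd_cong:
  "(\<And>l x y. l \<in> set w \<Longrightarrow> x < N \<Longrightarrow> y < N \<Longrightarrow> A l x y = A' l x y) \<Longrightarrow> i < N \<Longrightarrow> j < N \<Longrightarrow> wd N A w i j = wd N A' w i j"
  by (induction w arbitrary: i) auto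

lemma trw_cong:
  "(\<And>l x y. l \<in> set w \<Longrightarrow> x < N \<Longrightarrow> y < N \<Longrightarrow> A l x y = A' l x y) \<Longrightarrow> trw N A w = trw N A' w"
  unfolding trw_def by (intro arg_cong2[where f="(/)"] sum.cong refl wd_cong) auto

lemma sum_if_card: "finite A \<Longrightarrow> (\<Sum>i\<in>A. if P i then 1 else 0) = of_nat (card {i \<in> A. P i})"
  by (simp add: sum.inter_filter[symmetric])

lemma sum_if_card_less: "(\<Sum>i<(N::nat). if P i then 1 else 0) = of_nat (card {i. i < N \<and> P i})"
  by (subst sum_if_card) simp_all

lemma pact_lt:
  assumes "p \<in> perm_tuples N R" "fst ` set w \<subseteq> R" "j < N"
  shows "pact p w j < N"
  using traj_subset[OF assms] hd_in_set[OF traj_ne, of p w j] by (auto simp: hd_traj)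

lemma wd_perm:
  assumes p: "p \<in> perm_tuples N R" and "fst ` set w \<subseteq> R" and j: "j < N" and "i < N"
    and "\<And>l x y. l \<in> set w \<Longrightarrow> x < N \<Longrightarrow> y < N \<Longrightarrow> A l x y = (if x = act p l y then 1 else 0)"
  shows "wd N A w i j = (if i = pact p w j then 1 else 0)"
  using assms(2,4,5)
proof (induction w arbitrary: i)
  case Nil then show ?case by (simp add: pact_def)
next
  case (Cons l w)
  have "wd N A (l # w) i j = (\<Sum>k<N. (if i = act p l k then 1 else 0) * (if k = pact p w j then 1 else 0))"
    using Cons by (auto intro!: sum.cong)
  also have "\<dots> = (\<Sum>k<N. if k = pact p w j then (if i = act p l k then 1 else 0) else 0)"
    by (intro sum.cong) auto
  also have "\<dots> = (if i = act p l (pact p w j) then 1 else 0)"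
    using pact_lt[OF p _ j, of w] Cons.prems by simp
  finally show ?case by (simp add: pact_def)
qed

section \<open>Fixed points of words in random permutations\<close>

definition fixed_frac :: "nat \<Rightarrow> ('i \<Rightarrow> nat \<Rightarrow> nat) \<Rightarrow> ('i \<times> bool) list \<Rightarrow> real" where
  "fixed_frac N p w = real (card {j. j < N \<and> pact p w j = j}) / real N"

lemma trw_perm:
  assumes "p \<in> perm_tuples N R" "fst ` set w \<subseteq> R"
    and "\<And>l x y. l \<in> set w \<Longrightarrow> x < N \<Longrightarrow> y < N \<Longrightarrow> A l x y = (if x = act p l y then 1 else 0)"
  shows "trw N A w = of_real (fixed_frac N p w)"
proof -
  have "(\<Sum>i<N. wd N A w i i) = (\<Sum>i<N. if pact p w i = i then 1 else 0)"
    by (intro sum.cong refl) (subst wd_perm[OF assms(1,2) _ _ assms(3)], auto)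
  also have "\<dots> = of_nat (card {j. j < N \<and> pact p w j = j})"
    by (rule sum_if_card_less)
  finally show ?thesis by (simp add: trw_def fixed_frac_def)
qed

lemma fixed_frac_bounds: "0 \<le> fixed_frac N p w" "fixed_frac N p w \<le> 1"
proof -
  have "card {j. j < N \<and> pact p w j = j} \<le> card {..<N}" by (intro card_mono) auto
  then show "0 \<le> fixed_frac N p w" "fixed_frac N p w \<le> 1"
    by (auto simp: fixed_frac_def divide_le_eq_1)
qed

abbreviation fixed_prod :: "nat \<Rightarrow> ('i \<times> bool) list list \<Rightarrow> ('i \<Rightarrow> nat \<Rightarrow> nat) \<Rightarrow> complex" where
  "fixed_prod N ws p \<equiv> \<Prod>w\<leftarrow>ws. complex_of_real (fixed_frac N p w)"

definition perm_avg :: "nat \<Rightarrow> 'i set \<Rightarrow> (('i \<Rightarrow> nat \<Rightarrow> nat) \<Rightarrow> 'b::real_normed_field) \<Rightarrow> 'b" where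
  "perm_avg N R F = (\<Sum>p\<in>perm_tuples N R. F p) / of_nat (card (perm_tuples N R))"

text \<open>The mean is taken separately for each of the \<open>N\<close> starting points: a path
  that ends where it began revisits a point, so \<open>card_not_distinct\<close> bounds the
  probability of this event.\<close>

lemma fixed_frac_avg:
  assumes R: "finite R" "fst ` set w \<subseteq> R" and red: "reduced w" "w \<noteq> []" and N: "length w < N"
  shows "perm_avg N R (\<lambda>p. fixed_frac N p w) \<le> (real (length w))\<^sup>2 / (real N - real (length w))"
proof -
  let ?K = "card (perm_tuples N R)" and ?n = "length w"
  have K: "?K > 0" by (rule card_perm_tuples_pos[OF R(1)])
  have bound: "card {p \<in> perm_tuples N R. pact p w j = j} * (N - ?n) \<le> ?n ^ 2 * ?K" if "j < N" for j
  proof -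
    have "card {p \<in> perm_tuples N R. pact p w j = j} \<le> card {p \<in> perm_tuples N R. \<not> distinct (traj p w j)}"
      using finite_perm_tuples[OF R(1), of N] fixed_not_distinct[OF red(2)] by (intro card_mono) auto
    then have "card {p \<in> perm_tuples N R. pact p w j = j} * (N - ?n)
        \<le> card {p \<in> perm_tuples N R. \<not> distinct (traj p w j)} * (N - ?n)" by (rule mult_le_mono1)
    also have "\<dots> \<le> ?n ^ 2 * ?K" by (rule card_not_distinct[OF R red(1) that])
    finally show ?thesis .
  qed
  have "(\<Sum>p\<in>perm_tuples N R. card {j. j < N \<and> pact p w j = j})
      = (\<Sum>p\<in>perm_tuples N R. \<Sum>j<N. if pact p w j = j then 1 else 0)"
    by (simp add: sum_if_card_less)
  also have "\<dots> = (\<Sum>j<N. \<Sum>p\<in>perm_tuples N R. if pact p w j = j then 1 else 0)" by (rule sum.swap)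
  also have "\<dots> = (\<Sum>j<N. card {p \<in> perm_tuples N R. pact p w j = j})"
    using finite_perm_tuples[OF R(1), of N] by (simp add: sum_if_card)
  finally have "(\<Sum>p\<in>perm_tuples N R. card {j. j < N \<and> pact p w j = j}) * (N - ?n) =
      (\<Sum>j<N. card {p \<in> perm_tuples N R. pact p w j = j} * (N - ?n))"
    by (simp add: sum_distrib_right)
  also have "\<dots> \<le> (\<Sum>j<N. ?n ^ 2 * ?K)" by (intro sum_mono bound) auto
  finally have "(\<Sum>p\<in>perm_tuples N R. card {j. j < N \<and> pact p w j = j}) * (N - ?n) \<le> N * (?n ^ 2 * ?K)" by simp
  then have "real ((\<Sum>p\<in>perm_tuples N R. card {j. j < N \<and> pact p w j = j}) * (N - ?n)) \<le> real (N * (?n ^ 2 * ?K))"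
    by (rule of_nat_mono)
  then have "(\<Sum>p\<in>perm_tuples N R. real (card {j. j < N \<and> pact p w j = j})) * (real N - real ?n)
      \<le> real N * ((real ?n)\<^sup>2 * real ?K)"
    using N by (simp add: of_nat_diff)
  moreover have "perm_avg N R (\<lambda>p. fixed_frac N p w) =
      (\<Sum>p\<in>perm_tuples N R. real (card {j. j < N \<and> pact p w j = j})) / (real N * real ?K)"
    by (simp add: perm_avg_def fixed_frac_def sum_divide_distrib[symmetric])
  moreover have "S / (real N * real ?K) \<le> (real ?n)\<^sup>2 / (real N - real ?n)"
    if "S * (real N - real ?n) \<le> real N * ((real ?n)\<^sup>2 * real ?K)" for S
    using that K N by (simp add: frac_le_eq divide_le_0_iff mult_ac)
  ultimately show ?thesis by simp
qed

lemma perm_avg_norm_le: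
  fixes F :: "('i \<Rightarrow> nat \<Rightarrow> nat) \<Rightarrow> complex"
  assumes "\<And>p. p \<in> perm_tuples N R \<Longrightarrow> norm (F p) \<le> G p"
  shows "norm (perm_avg N R F) \<le> perm_avg N R G"
proof -
  have "norm (perm_avg N R F) = norm (\<Sum>p\<in>perm_tuples N R. F p) / real (card (perm_tuples N R))"
    by (simp add: perm_avg_def norm_divide)
  also have "\<dots> \<le> (\<Sum>p\<in>perm_tuples N R. G p) / real (card (perm_tuples N R))"
    by (intro divide_right_mono sum_norm_le assms) auto
  finally show ?thesis by (simp add: perm_avg_def)
qed

text \<open>All factors lie between 0 and 1, so a product is bounded by any one of them; a single
  non-trivial word thus controls it.\<close>

lemma norm_prod_fixed_frac:
  assumes "w \<in> set ws"
  shows "norm (fixed_prod N ws p) \<le> fixed_frac N p w"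
proof -
  have 1: "norm (\<Prod>w\<leftarrow>vs. complex_of_real (fixed_frac N p w)) \<le> 1" for vs
    by (induction vs) (auto simp: norm_mult fixed_frac_bounds intro!: mult_le_one)
  obtain us vs where "ws = us @ w # vs" using assms by (meson split_list)
  then have "norm (fixed_prod N ws p) =
     norm (\<Prod>w\<leftarrow>us @ vs. complex_of_real (fixed_frac N p w)) * fixed_frac N p w"
    by (simp add: norm_mult fixed_frac_bounds)
  also have "\<dots> \<le> 1 * fixed_frac N p w" by (intro mult_right_mono 1 fixed_frac_bounds)
  finally show ?thesis by simp
qed

lemma perm_avg_tendsto_0:
  assumes R: "finite R" "fst ` set w' \<subseteq> R" and red: "reduced w'" "w' \<noteq> []" and w: "w \<in> set ws"
    and eq: "\<And>N p. p \<in> perm_tuples N R \<Longrightarrow> pact p w = pact p w'"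
  shows "(\<lambda>N. perm_avg N R (fixed_prod N ws)) \<longlonglongrightarrow> 0"
proof (rule Lim_null_comparison)
  let ?n = "length w'"
  have "norm (perm_avg N R (fixed_prod N ws)) \<le> (real ?n)\<^sup>2 / (real N - real ?n)"
    if N: "N > ?n" for N
  proof -
    have "norm (perm_avg N R (fixed_prod N ws))
        \<le> perm_avg N R (\<lambda>p. fixed_frac N p w')"
    proof (rule perm_avg_norm_le)
      fix p assume p: "p \<in> perm_tuples N R"
      show "norm (fixed_prod N ws p) \<le> fixed_frac N p w'"
        using norm_prod_fixed_frac[OF w, of N p] eq[OF p] by (simp add: fixed_frac_def)
    qed
    also have "\<dots> \<le> (real ?n)\<^sup>2 / (real N - real ?n)"
      by (rule fixed_frac_avg) (use R red N in auto)
    finally show ?thesis .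
  qed
  then show "\<forall>\<^sub>F N in sequentially. norm (perm_avg N R (fixed_prod N ws))
      \<le> (real ?n)\<^sup>2 / (real N - real ?n)"
    by (intro eventually_mono[OF eventually_gt_at_top[of ?n]])
  have "LIM N sequentially. - real ?n + real N :> at_top"
    by (rule filterlim_tendsto_add_at_top[OF tendsto_const filterlim_real_sequentially])
  then have "LIM N sequentially. real N - real ?n :> at_infinity"
    by (intro filterlim_at_top_imp_at_infinity) (simp add: algebra_simps)
  then show "(\<lambda>N. (real ?n)\<^sup>2 / (real N - real ?n)) \<longlonglongrightarrow> 0"
    by (rule tendsto_divide_0[OF tendsto_const])
qed

lemma perm_avg_tendsto_1:
  assumes R: "finite R" and eq: "\<And>w N p. w \<in> set ws \<Longrightarrow> p \<in> perm_tuples N R \<Longrightarrow> pact p w = pact p []"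
  shows "(\<lambda>N. perm_avg N R (fixed_prod N ws)) \<longlonglongrightarrow> 1"
proof (rule tendsto_eventually, rule eventually_mono[OF eventually_gt_at_top[of 0]])
  fix N :: nat assume N: "N > 0"
  have "fixed_prod N ws p = 1" if p: "p \<in> perm_tuples N R" for p
  proof -
    have "complex_of_real (fixed_frac N p w) = 1" if "w \<in> set ws" for w
      using eq[OF that p] N by (simp add: fixed_frac_def pact_def)
    then show ?thesis by (induction ws) auto
  qed
  then show "perm_avg N R (fixed_prod N ws) = 1"
    using card_perm_tuples_pos[OF R, of N] by (simp add: perm_avg_def)
qed

context star_free_family
begin

text \<open>\<open>pact_reduce\<close> supplies reduced words common to both sides. Either all of
  them are empty and both sides are 1 in the limit, or one is not, and then
  \<open>haar_reduced_zero\<close> matches \<open>perm_avg_tendsto_0\<close>.\<close>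

lemma permutation_limit:
  assumes R: "finite R" "R \<subseteq> I" "\<And>i. i \<in> R \<Longrightarrow> haar_unitary \<phi> star (x i)"
    and ws: "\<And>w. w \<in> set ws \<Longrightarrow> fst ` set w \<subseteq> R"
  shows "(\<lambda>N. perm_avg N R (fixed_prod N ws)) \<longlonglongrightarrow> (\<Prod>w\<leftarrow>ws. \<phi> (evm w))"
proof -
  have ex: "\<exists>w'. reduced w' \<and> fst ` set w' \<subseteq> R \<and> (\<forall>N. \<forall>p\<in>perm_tuples N R. pact p w = pact p w') \<and> evm w = evm w'"
    if w: "w \<in> set ws" for w
  proof -
    obtain w' where w': "reduced w'" "fst ` set w' \<subseteq> R" "\<forall>N. \<forall>p\<in>perm_tuples N R. pact p w = pact p w'"
      "\<forall>(h :: _ \<Rightarrow> 'a). (\<forall>u l l' v. fst l \<in> R \<longrightarrow> cancels l l' \<longrightarrow> h (u @ l # l' # v) = h (u @ v)) \<longrightarrow> h w = h w'"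
      using pact_reduce[OF ws[OF w], where 'b='a] by blast
    have "evm w = evm w'" using w'(4)[rule_format, of evm] evm_cancel[OF R(3)] by blast
    then show ?thesis using w' by blast
  qed
  then have "\<forall>w\<in>set ws. \<exists>w'. reduced w' \<and> fst ` set w' \<subseteq> R \<and>
      (\<forall>N. \<forall>p\<in>perm_tuples N R. pact p w = pact p w') \<and> evm w = evm w'" by blast
  from bchoice[OF this] obtain red where r: "\<forall>w\<in>set ws. reduced (red w) \<and> fst ` set (red w) \<subseteq> R \<and>
      (\<forall>N. \<forall>p\<in>perm_tuples N R. pact p w = pact p (red w)) \<and> evm w = evm (red w)" ..
  have red: "reduced (red w)" "fst ` set (red w) \<subseteq> R" "\<And>N p. p \<in> perm_tuples N R \<Longrightarrow> pact p w = pact p (red w)"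
     "evm w = evm (red w)" if "w \<in> set ws" for w
    using r that by blast+
  show ?thesis
  proof (cases "\<forall>w\<in>set ws. red w = []")
    case True
    have "\<phi> (evm w) = 1" if "w \<in> set ws" for w using True red(4)[OF that] that by (simp add: unital)
    then have "(\<Prod>w\<leftarrow>ws. \<phi> (evm w)) = 1" by (induction ws) auto
    moreover have "(\<lambda>N. perm_avg N R (fixed_prod N ws)) \<longlonglongrightarrow> 1"
    proof (intro perm_avg_tendsto_1 R)
      fix w N p assume w: "w \<in> set ws" "p \<in> perm_tuples N R"
      then have "red w = []" using True by blast
      then show "pact p w = pact p []" using red(3)[OF w] by simp
    qed
    ultimately show ?thesis by simp
  next
    case False
    then obtain w where w: "w \<in> set ws" "red w \<noteq> []" by blast
    have "\<phi> (evm w) = 0"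
      using haar_reduced_zero[OF w(2) red(1)[OF w(1)] red(2)[OF w(1)] R(2,3)] red(4)[OF w(1)] by simp
    then have z: "(\<Prod>w\<leftarrow>ws. \<phi> (evm w)) = 0" unfolding prod_list_zero_iff using w(1) by force
    show ?thesis unfolding z
      by (rule perm_avg_tendsto_0[OF R(1) red(2)[OF w(1)] red(1)[OF w(1)] w(2) w(1) red(3)[OF w(1)]])
  qed
qed

end

section \<open>Convergence from the Schwinger-Dyson equations\<close>

definition rcount :: "'i set \<Rightarrow> ('i \<times> bool) list \<Rightarrow> nat" where
  "rcount J w = length (filter (\<lambda>l. fst l \<in> J) w)"

lemma rcount_simps [simp]:
  "rcount J [] = 0" "rcount J (l # w) = (if fst l \<in> J then 1 else 0) + rcount J w"
  "rcount J (v @ w) = rcount J v + rcount J w"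
  by (simp_all add: rcount_def)

lemma rcount_split:
  assumes "k < length w"
  shows "rcount J w = rcount J (take k w) + (if fst (w ! k) \<in> J then 1 else 0) + rcount J (drop (Suc k) w)"
proof -
  have "rcount J w = rcount J (take k w @ w ! k # drop (Suc k) w)"
    using id_take_nth_drop[OF assms] by simp
  then show ?thesis by simp
qed

lemma rcount_zero: "rcount J w = 0 \<Longrightarrow> fst ` set w \<subseteq> R \<union> J \<Longrightarrow> fst ` set w \<subseteq> R"
  by (induction w) (auto split: if_splits)

lemma rcount_pos: "rcount J w \<noteq> 0 \<Longrightarrow> \<exists>u l v. w = u @ l # v \<and> fst l \<in> J"
proof (induction w)
  case (Cons l w)
  show ?case
  proof (cases "fst l \<in> J")
    case True
    then have "l # w = [] @ l # w \<and> fst l \<in> J" by simp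
    then show ?thesis by blast
  next
    case False
    then obtain u l' v where "w = u @ l' # v" "fst l' \<in> J" using Cons by auto
    then have "l # w = (l # u) @ l' # v \<and> fst l' \<in> J" by simp
    then show ?thesis by blast
  qed
qed simp

text \<open>
  The Schwinger-Dyson equations express a mixed moment by mixed moments with fewer random letters,
  up to terms of order \<open>1 / N\<^sup>2\<close>, so that the limits are determined by induction on the number of
  random letters. The induction needs products of several traces.
\<close>

lemma schwinger_dyson_limit:
  fixes e :: "nat \<Rightarrow> ('i \<times> bool) list list \<Rightarrow> complex" and m :: "('i \<times> bool) list \<Rightarrow> complex"
    and d \<epsilon> :: "nat \<Rightarrow> complex" and tw :: "'i \<Rightarrow> ('i \<times> bool) list"
  assumes permute: "\<And>q us w vs. e q (us @ w # vs) = e q (w # us @ vs)"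
    and rotate: "\<And>q u v ws. e q ((u @ v) # ws) = e q ((v @ u) # ws)"
    and base: "\<And>ws. (\<And>w. w \<in> set ws \<Longrightarrow> fst ` set w \<subseteq> R) \<Longrightarrow> (\<lambda>q. e q ws) \<longlonglongrightarrow> (\<Prod>w\<leftarrow>ws. m w)"
    and rec: "\<And>q l w ws. fst l \<in> J \<Longrightarrow> (\<And>w'. w' \<in> set (w # ws) \<Longrightarrow> fst ` set w' \<subseteq> R \<union> J) \<Longrightarrow>
       e q ((l # w) # ws) = d q * e q (w # ws)
         + (\<Sum>k<length w. if ok l (w ! k) then e q (take k w # (tw (fst l) @ drop (Suc k) w) # ws) else 0)
         + \<epsilon> q * (\<Sum>j<length ws. \<Sum>k<length (ws ! j). if ok l (ws ! j ! k)
             then e q ((w @ tw (fst l) @ drop (Suc k) (ws ! j) @ take k (ws ! j)) # take j ws @ drop (Suc j) ws) else 0)"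
    and m_rotate: "\<And>u v. m (u @ v) = m (v @ u)"
    and m_rec: "\<And>l w. fst l \<in> J \<Longrightarrow> fst ` set w \<subseteq> R \<union> J \<Longrightarrow> m (l # w) = d' * m w
         + (\<Sum>k<length w. if ok l (w ! k) then m (take k w) * m (tw (fst l) @ drop (Suc k) w) else 0)"
    and d: "d \<longlonglongrightarrow> d'" and \<epsilon>: "\<epsilon> \<longlonglongrightarrow> 0"
    and ok: "\<And>l l'. fst l \<in> J \<Longrightarrow> ok l l' \<Longrightarrow> fst l' = fst l"
    and tw: "\<And>i. i \<in> J \<Longrightarrow> length (tw i) \<le> 1 \<and> fst ` set (tw i) \<subseteq> {i}"
    and ws: "\<And>w. w \<in> set ws \<Longrightarrow> fst ` set w \<subseteq> R \<union> J"
  shows "(\<lambda>q. e q ws) \<longlonglongrightarrow> (\<Prod>w\<leftarrow>ws. m w)"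
  using ws
proof (induction "\<Sum>w\<leftarrow>ws. rcount J w" arbitrary: ws rule: less_induct)
  case less
  show ?case
  proof (cases "\<forall>w\<in>set ws. rcount J w = 0")
    case True
    then show ?thesis using less.prems rcount_zero[of J _ R] by (intro base) blast
  next
    case False
    then obtain w0 where w0: "w0 \<in> set ws" "rcount J w0 \<noteq> 0" by blast
    obtain us vs where ws: "ws = us @ w0 # vs" using w0(1) by (meson split_list)
    obtain u l v where u: "w0 = u @ l # v" "fst l \<in> J" using rcount_pos[OF w0(2)] by blast
    \<comment> \<open>By rotation and permutation a random letter may be assumed to open the first
      word, the place to which \<open>rec\<close> applies.\<close>
    define w where "w = v @ u"
    define xs where "xs = us @ vs"
    have e: "e q ws = e q ((l # w) # xs)" for q
      using permute[of q us w0 vs] rotate[of q u "l # v" xs] by (simp add: ws u w_def xs_def)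
    have mw0: "m w0 = m (l # w)" using m_rotate[of u "l # v"] by (simp add: u w_def)
    have mws: "(\<Prod>w\<leftarrow>ws. m w) = m (l # w) * (\<Prod>w\<leftarrow>xs. m w)"
      by (simp add: ws xs_def mw0)
    have sets: "fst ` set w' \<subseteq> R \<union> J" if "w' \<in> set (w # xs)" for w'
    proof -
      have "fst ` set w0 \<subseteq> R \<union> J" "\<And>w'. w' \<in> set xs \<Longrightarrow> fst ` set w' \<subseteq> R \<union> J"
        using less.prems by (auto simp: ws xs_def)
      then show ?thesis using that unfolding image_subset_iff by (auto simp: u w_def)
    qed
    have cnt: "(\<Sum>w\<leftarrow>ws. rcount J w) = Suc (rcount J w + (\<Sum>w\<leftarrow>xs. rcount J w))"
      using u by (simp add: ws w_def xs_def)
    \<comment> \<open>At most one random letter is inserted, whereas \<open>l\<close> and the letter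
      at the cut are removed, so the total number drops.\<close>
    have rtw: "rcount J (tw (fst l)) \<le> 1"
      unfolding rcount_def by (rule order_trans[OF length_filter_le]) (use tw[OF u(2)] in simp)
    have stw: "fst ` set (tw (fst l)) \<subseteq> R \<union> J" 
      by (rule order_trans[OF conjunct2[OF tw[OF u(2)]]]) (use u(2) in simp)
    have IH: "(\<lambda>q. e q ys) \<longlonglongrightarrow> (\<Prod>w\<leftarrow>ys. m w)"
      if "(\<Sum>w\<leftarrow>ys. rcount J w) \<le> rcount J w + (\<Sum>w\<leftarrow>xs. rcount J w)"
        and "\<And>w. w \<in> set ys \<Longrightarrow> fst ` set w \<subseteq> R \<union> J" for ys
      by (rule less.hyps) (use that cnt in auto)
    have sub: "fst ` set (take k w') \<subseteq> R \<union> J" "fst ` set (drop k w') \<subseteq> R \<union> J"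
      if "fst ` set w' \<subseteq> R \<union> J" for k w'
      using that set_take_subset[of k w'] set_drop_subset[of k w'] by blast+
    have sw: "fst ` set w \<subseteq> R \<union> J" and sxs: "\<And>v. v \<in> set xs \<Longrightarrow> fst ` set v \<subseteq> R \<union> J"
      using sets by simp_all
    have 1: "(\<lambda>q. e q (w # xs)) \<longlonglongrightarrow> m w * (\<Prod>w\<leftarrow>xs. m w)"
      using IH[of "w # xs"] sets by auto
    have 2: "(\<lambda>q. if ok l (w ! k) then e q (take k w # (tw (fst l) @ drop (Suc k) w) # xs) else 0) \<longlonglongrightarrow>
        (if ok l (w ! k) then m (take k w) * m (tw (fst l) @ drop (Suc k) w) else 0) * (\<Prod>w\<leftarrow>xs. m w)"
      if k: "k < length w" for k
    proof (cases "ok l (w ! k)")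
      case True
      then have "fst (w ! k) \<in> J" using ok[OF u(2)] u(2) by simp
      then have "(\<lambda>q. e q (take k w # (tw (fst l) @ drop (Suc k) w) # xs)) \<longlonglongrightarrow>
          (\<Prod>w\<leftarrow>take k w # (tw (fst l) @ drop (Suc k) w) # xs. m w)"
      proof (intro IH)
        assume "fst (w ! k) \<in> J"
        then show "(\<Sum>w\<leftarrow>take k w # (tw (fst l) @ drop (Suc k) w) # xs. rcount J w)
           \<le> rcount J w + (\<Sum>w\<leftarrow>xs. rcount J w)"
          using rcount_split[OF k, of J] rtw by simp
        fix w' assume "w' \<in> set (take k w # (tw (fst l) @ drop (Suc k) w) # xs)"
        then consider "w' = take k w" | "w' = tw (fst l) @ drop (Suc k) w" | "w' \<in> set xs" by auto
        then show "fst ` set w' \<subseteq> R \<union> J"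
          by cases (use stw sub[OF sw] sxs in \<open>simp_all add: image_Un\<close>)
      qed
      then show ?thesis using True by (simp add: mult.assoc)
    qed simp
    \<comment> \<open>The merged terms carry the factor \<open>\<epsilon> q\<close>, so convergence
      is enough; the value of their limit does not matter.\<close>
    have 3: "convergent (\<lambda>q. if ok l (xs ! j ! k)
        then e q ((w @ tw (fst l) @ drop (Suc k) (xs ! j) @ take k (xs ! j)) # take j xs @ drop (Suc j) xs) else 0)"
      if j: "j < length xs" and k: "k < length (xs ! j)" for j k
    proof (cases "ok l (xs ! j ! k)")
      case True
      then have kJ: "fst (xs ! j ! k) \<in> J" using ok[OF u(2)] u(2) by simp
      let ?ys = "(w @ tw (fst l) @ drop (Suc k) (xs ! j) @ take k (xs ! j)) # take j xs @ drop (Suc j) xs"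
      have xsj: "xs ! j \<in> set xs" using j by simp
      have "(\<lambda>q. e q ?ys) \<longlonglongrightarrow> (\<Prod>w\<leftarrow>?ys. m w)"
      proof (rule IH)
        have "(\<Sum>w\<leftarrow>xs. rcount J w) = (\<Sum>w\<leftarrow>take j xs @ xs ! j # drop (Suc j) xs. rcount J w)"
          using id_take_nth_drop[OF j] by simp
        then show "(\<Sum>w\<leftarrow>?ys. rcount J w) \<le> rcount J w + (\<Sum>w\<leftarrow>xs. rcount J w)"
          using rcount_split[OF k, of J] rtw kJ by simp
        fix w' assume "w' \<in> set ?ys"
        then consider "w' = w @ tw (fst l) @ drop (Suc k) (xs ! j) @ take k (xs ! j)" | "w' \<in> set xs"
          using set_take_subset[of j xs] set_drop_subset[of "Suc j" xs] by auto
        then show "fst ` set w' \<subseteq> R \<union> J"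
          by cases (use stw sw sub[OF sxs[OF xsj]] sxs in \<open>simp_all add: image_Un\<close>)
      qed
      then show ?thesis using True by (auto simp: convergent_def)
    qed (simp add: convergent_const)
    have 4: "(\<lambda>q. \<epsilon> q * (\<Sum>j<length xs. \<Sum>k<length (xs ! j). if ok l (xs ! j ! k)
             then e q ((w @ tw (fst l) @ drop (Suc k) (xs ! j) @ take k (xs ! j)) # take j xs @ drop (Suc j) xs) else 0)) \<longlonglongrightarrow> 0"
    proof -
      have "convergent (\<lambda>q. \<Sum>j<length xs. \<Sum>k<length (xs ! j). if ok l (xs ! j ! k)
             then e q ((w @ tw (fst l) @ drop (Suc k) (xs ! j) @ take k (xs ! j)) # take j xs @ drop (Suc j) xs) else 0)"
        using 3 by (intro convergent_sum) auto
      then obtain L where "(\<lambda>q. \<Sum>j<length xs. \<Sum>k<length (xs ! j). if ok l (xs ! j ! k)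
             then e q ((w @ tw (fst l) @ drop (Suc k) (xs ! j) @ take k (xs ! j)) # take j xs @ drop (Suc j) xs) else 0) \<longlonglongrightarrow> L"
        by (auto simp: convergent_def)
      from tendsto_mult[OF \<epsilon> this] show ?thesis by simp
    qed
    have lim: "(\<lambda>q. d q * e q (w # xs)
         + (\<Sum>k<length w. if ok l (w ! k) then e q (take k w # (tw (fst l) @ drop (Suc k) w) # xs) else 0)
         + \<epsilon> q * (\<Sum>j<length xs. \<Sum>k<length (xs ! j). if ok l (xs ! j ! k)
             then e q ((w @ tw (fst l) @ drop (Suc k) (xs ! j) @ take k (xs ! j)) # take j xs @ drop (Suc j) xs) else 0))
       \<longlonglongrightarrow> d' * (m w * (\<Prod>w\<leftarrow>xs. m w))
         + (\<Sum>k<length w. (if ok l (w ! k) then m (take k w) * m (tw (fst l) @ drop (Suc k) w) else 0) * (\<Prod>w\<leftarrow>xs. m w)) + 0"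
      by (intro tendsto_add tendsto_mult d 1 tendsto_sum 2 4) auto
    have eq: "e q ws = d q * e q (w # xs)
         + (\<Sum>k<length w. if ok l (w ! k) then e q (take k w # (tw (fst l) @ drop (Suc k) w) # xs) else 0)
         + \<epsilon> q * (\<Sum>j<length xs. \<Sum>k<length (xs ! j). if ok l (xs ! j ! k)
             then e q ((w @ tw (fst l) @ drop (Suc k) (xs ! j) @ take k (xs ! j)) # take j xs @ drop (Suc j) xs) else 0)" for q
      unfolding e by (rule rec[OF u(2) sets])
    have "m (l # w) * (\<Prod>w\<leftarrow>xs. m w) = d' * (m w * (\<Prod>w\<leftarrow>xs. m w))
         + (\<Sum>k<length w. (if ok l (w ! k) then m (take k w) * m (tw (fst l) @ drop (Suc k) w) else 0) * (\<Prod>w\<leftarrow>xs. m w)) + 0"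
      unfolding m_rec[OF u(2) sw] by (simp add: distrib_right sum_distrib_right mult.assoc)
    then show ?thesis using lim unfolding mws eq[symmetric] by simp
  qed
qed

lemma sum_swap3:
  "(\<Sum>b\<in>B. \<Sum>j\<in>J. \<Sum>k\<in>K j. h b j k) = (\<Sum>j\<in>J. \<Sum>k\<in>K j. \<Sum>b\<in>B. h b j k)"
  by (rule trans[OF sum.swap]) (intro sum.cong refl sum.swap)

lemma sum_swap_if:
  fixes f :: "'x \<Rightarrow> 'y \<Rightarrow> complex"
  shows "(\<Sum>a\<in>A. \<Sum>b\<in>B. f a b * (\<Sum>j\<in>J. \<Sum>k\<in>K j. if c j k then u a b j k else 0)) =
    (\<Sum>j\<in>J. \<Sum>k\<in>K j. if c j k then \<Sum>a\<in>A. \<Sum>b\<in>B. f a b * u a b j k else 0)"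
proof -
  have "(\<Sum>a\<in>A. \<Sum>b\<in>B. f a b * (\<Sum>j\<in>J. \<Sum>k\<in>K j. if c j k then u a b j k else 0)) =
     (\<Sum>a\<in>A. \<Sum>b\<in>B. \<Sum>j\<in>J. \<Sum>k\<in>K j. if c j k then f a b * u a b j k else 0)"
    unfolding sum_distrib_left by (intro sum.cong refl) simp
  also have "\<dots> = (\<Sum>j\<in>J. \<Sum>k\<in>K j. \<Sum>a\<in>A. \<Sum>b\<in>B. if c j k then f a b * u a b j k else 0)"
    by (rule trans[OF sum.cong[OF refl sum_swap3] sum_swap3])
  also have "\<dots> = (\<Sum>j\<in>J. \<Sum>k\<in>K j. if c j k then \<Sum>a\<in>A. \<Sum>b\<in>B. f a b * u a b j k else 0)"
    by (intro sum.cong refl) simp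
  finally show ?thesis .
qed

text \<open>
  Integration by parts for a random matrix: \<open>E (A\<^bsub>ab\<^esub> F) = \<delta>\<^bsub>ab\<^esub> d E F + E (D\<^bsub>ab\<^esub> F) / N\<close>, where \<open>D\<^bsub>ab\<^esub>\<close> is a
  derivation, given by the relation \<open>Dr a b\<close>, with \<open>D\<^bsub>ab\<^esub> A\<^bsub>xy\<^esub> = \<delta>\<^bsub>xb\<^esub> T\<^bsub>ay\<^esub>\<close> for the admissible letters.
\<close>

locale matrix_ibp =
  fixes E :: "('z \<Rightarrow> complex) \<Rightarrow> complex" and pol :: "('z \<Rightarrow> complex) \<Rightarrow> bool"
    and Dr :: "nat \<Rightarrow> nat \<Rightarrow> ('z \<Rightarrow> complex) \<Rightarrow> ('z \<Rightarrow> complex) \<Rightarrow> bool"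
    and A :: "'z \<Rightarrow> 'l \<Rightarrow> nat \<Rightarrow> nat \<Rightarrow> complex" and N :: nat and S :: "'l set"
    and l0 :: 'l and ok :: "'l \<Rightarrow> bool" and d :: complex and T :: "'l list"
  assumes pol_const: "pol (\<lambda>z. c)"
    and pol_add: "pol F \<Longrightarrow> pol G \<Longrightarrow> pol (\<lambda>z. F z + G z)"
    and pol_mult: "pol F \<Longrightarrow> pol G \<Longrightarrow> pol (\<lambda>z. F z * G z)"
    and pol_A: "l \<in> S \<Longrightarrow> x < N \<Longrightarrow> y < N \<Longrightarrow> pol (\<lambda>z. A z l x y)"
    and E_add: "pol F \<Longrightarrow> pol G \<Longrightarrow> E (\<lambda>z. F z + G z) = E F + E G"
    and E_scale: "pol F \<Longrightarrow> E (\<lambda>z. c * F z) = c * E F"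
    and Dr_const: "Dr a b (\<lambda>z. c) (\<lambda>z. 0)"
    and Dr_add: "Dr a b F F' \<Longrightarrow> Dr a b G G' \<Longrightarrow> Dr a b (\<lambda>z. F z + G z) (\<lambda>z. F' z + G' z)"
    and Dr_mult: "Dr a b F F' \<Longrightarrow> Dr a b G G' \<Longrightarrow> Dr a b (\<lambda>z. F z * G z) (\<lambda>z. F' z * G z + F z * G' z)"
    and Dr_A: "l \<in> S \<Longrightarrow> a < N \<Longrightarrow> b < N \<Longrightarrow> x < N \<Longrightarrow> y < N \<Longrightarrow>
      Dr a b (\<lambda>z. A z l x y) (\<lambda>z. if ok l \<and> x = b then wd N (A z) T a y else 0)"
    and ibp: "a < N \<Longrightarrow> b < N \<Longrightarrow> pol F \<Longrightarrow> Dr a b F F' \<Longrightarrow>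
      E (\<lambda>z. A z l0 a b * F z) = (if a = b then d * E F else 0) + E F' / of_nat N"
    and l0: "l0 \<in> S" and T: "set T \<subseteq> S"
begin

abbreviation "entA z \<equiv> wd N (A z)"
abbreviation "trA z \<equiv> trw N (A z)"

lemma pol_sum: "finite K \<Longrightarrow> (\<And>k. k \<in> K \<Longrightarrow> pol (F k)) \<Longrightarrow> pol (\<lambda>z. \<Sum>k\<in>K. F k z)"
  by (induction K rule: finite_induct) (auto intro: pol_const pol_add)

lemma pol_if: "(c \<Longrightarrow> pol F) \<Longrightarrow> pol (\<lambda>z. if c then F z else 0)"
  by (cases c) (auto intro: pol_const)

lemma E_0: "E (\<lambda>z. 0) = 0"
  using E_scale[OF pol_const, of 0 0] by simp

lemma E_sum: "finite K \<Longrightarrow> (\<And>k. k \<in> K \<Longrightarrow> pol (F k)) \<Longrightarrow> E (\<lambda>z. \<Sum>k\<in>K. F k z) = (\<Sum>k\<in>K. E (F k))"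
  by (induction K rule: finite_induct) (auto simp: E_0 E_add pol_sum)

lemma E_if: "E (\<lambda>z. if c then F z else 0) = (if c then E F else 0)"
  by (simp add: E_0)

lemma E_divide: "pol F \<Longrightarrow> E (\<lambda>z. F z / c) = E F / c"
  using E_scale[of F "1 / c"] by simp

lemma Dr_sum: "finite K \<Longrightarrow> (\<And>k. k \<in> K \<Longrightarrow> Dr a b (F k) (F' k)) \<Longrightarrow> Dr a b (\<lambda>z. \<Sum>k\<in>K. F k z) (\<lambda>z. \<Sum>k\<in>K. F' k z)"
  by (induction K rule: finite_induct) (auto intro: Dr_const Dr_add)

lemma Dr_scale: "Dr a b F F' \<Longrightarrow> Dr a b (\<lambda>z. c * F z) (\<lambda>z. c * F' z)"
  using Dr_mult[OF Dr_const, of a b F F' c] by simp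

lemma pol_wd: "set w \<subseteq> S \<Longrightarrow> x < N \<Longrightarrow> y < N \<Longrightarrow> pol (\<lambda>z. entA z w x y)"
  by (induction w arbitrary: x) (auto intro!: pol_const pol_sum pol_mult pol_A)

lemma pol_divide: "pol F \<Longrightarrow> pol (\<lambda>z. F z / c)"
  using pol_mult[OF pol_const[of "1 / c"], of F] by simp

lemma pol_trw: "set w \<subseteq> S \<Longrightarrow> pol (\<lambda>z. trA z w)"
  unfolding trw_def by (intro pol_divide pol_sum pol_wd) auto

lemma pol_prod: "(\<And>w. w \<in> set ws \<Longrightarrow> set w \<subseteq> S) \<Longrightarrow> pol (\<lambda>z. \<Prod>w\<leftarrow>ws. trA z w)"
  by (induction ws) (auto intro!: pol_const pol_mult pol_trw)

text \<open>Leibniz rule: differentiating the letter at position \<open>k\<close> cuts the word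
  there. The part before it ends in column \<open>b\<close>, and the part after it, headed by
  \<open>T\<close>, starts in row \<open>a\<close>.\<close>

lemma Dr_wd:
  assumes "a < N" "b < N" "y < N" "set w \<subseteq> S" "x < N"
  shows "Dr a b (\<lambda>z. entA z w x y)
    (\<lambda>z. \<Sum>k<length w. if ok (w ! k) then entA z (take k w) x b * entA z (T @ drop (Suc k) w) a y else 0)"
  using assms(4,5)
proof (induction w arbitrary: x)
  case Nil
  then show ?case by (simp add: Dr_const)
next
  case (Cons l w)
  let ?D = "\<lambda>z j. \<Sum>k<length w. if ok (w ! k) then entA z (take k w) j b * entA z (T @ drop (Suc k) w) a y else 0"
  have "Dr a b (\<lambda>z. \<Sum>j<N. A z l x j * entA z w j y)
     (\<lambda>z. \<Sum>j<N. (if ok l \<and> x = b then entA z T a j else 0) * entA z w j y + A z l x j * ?D z j)"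
    by (intro Dr_sum Dr_mult Dr_A Cons.IH) (use Cons.prems assms in auto)
  also have "(\<lambda>z. \<Sum>j<N. (if ok l \<and> x = b then entA z T a j else 0) * entA z w j y + A z l x j * ?D z j) =
    (\<lambda>z. \<Sum>k<length (l # w). if ok ((l # w) ! k) then entA z (take k (l # w)) x b * entA z (T @ drop (Suc k) (l # w)) a y else 0)"
  proof (rule ext)
    fix z
    have "(\<Sum>j<N. A z l x j * ?D z j) = (\<Sum>k<length w. \<Sum>j<N. if ok (w ! k) then A z l x j * entA z (take k w) j b * entA z (T @ drop (Suc k) w) a y else 0)"
      unfolding sum_distrib_left by (subst sum.swap) (auto intro!: sum.cong simp: mult.assoc)
    also have "\<dots> = (\<Sum>k<length w. if ok (w ! k) then entA z (l # take k w) x b * entA z (T @ drop (Suc k) w) a y else 0)"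
      by (intro sum.cong refl) (simp add: sum_distrib_right)
    finally have 2: "(\<Sum>j<N. A z l x j * ?D z j) = \<dots>" .
    have 1: "(\<Sum>j<N. (if ok l \<and> x = b then entA z T a j else 0) * entA z w j y) =
       (if ok l then entA z [] x b * entA z (T @ w) a y else 0)"
      using wd_append[OF assms(1), of "A z" T w y] by auto
    show "(\<Sum>j<N. (if ok l \<and> x = b then entA z T a j else 0) * entA z w j y + A z l x j * ?D z j) =
      (\<Sum>k<length (l # w). if ok ((l # w) ! k) then entA z (take k (l # w)) x b * entA z (T @ drop (Suc k) (l # w)) a y else 0)"
      unfolding sum.distrib 1 2 by (simp only: length_Cons sum.lessThan_Suc_shift) (simp cong: if_cong)
  qed
  finally show ?case by simp
qed

text \<open>The sum over the diagonal index joins the parts after and before the cut into one word,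
  in cyclic order.\<close>

lemma Dr_trw:
  assumes "a < N" "b < N" "set w \<subseteq> S"
  shows "Dr a b (\<lambda>z. trA z w)
    (\<lambda>z. \<Sum>k<length w. if ok (w ! k) then entA z (T @ drop (Suc k) w @ take k w) a b / of_nat N else 0)"
proof -
  have "Dr a b (\<lambda>z. (1 / of_nat N) * (\<Sum>x<N. entA z w x x)) (\<lambda>z. (1 / of_nat N) * (\<Sum>x<N. \<Sum>k<length w.
      if ok (w ! k) then entA z (take k w) x b * entA z (T @ drop (Suc k) w) a x else 0))"
    by (intro Dr_scale Dr_sum Dr_wd assms) auto
  also have "(\<lambda>z. (1 / of_nat N) * (\<Sum>x<N. \<Sum>k<length w.
      if ok (w ! k) then entA z (take k w) x b * entA z (T @ drop (Suc k) w) a x else 0)) =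
    (\<lambda>z. \<Sum>k<length w. if ok (w ! k) then entA z (T @ drop (Suc k) w @ take k w) a b / of_nat N else 0)"
  proof (rule ext)
    fix z
    have "entA z (T @ drop (Suc k) w @ take k w) a b =
       (\<Sum>x<N. entA z (take k w) x b * entA z (T @ drop (Suc k) w) a x)" for k
      using wd_append[OF assms(1), of "A z" "T @ drop (Suc k) w" "take k w" b] by (simp add: mult.commute)
    then show "(1 / of_nat N) * (\<Sum>x<N. \<Sum>k<length w.
      if ok (w ! k) then entA z (take k w) x b * entA z (T @ drop (Suc k) w) a x else 0) =
      (\<Sum>k<length w. if ok (w ! k) then entA z (T @ drop (Suc k) w @ take k w) a b / of_nat N else 0)"
      unfolding sum_distrib_left
      by (subst sum.swap) (auto intro!: sum.cong simp: sum_distrib_left sum_divide_distrib)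
  qed
  finally show ?thesis by (simp add: trw_def)
qed

lemma Dr_prod:
  assumes "a < N" "b < N" "\<And>w. w \<in> set ws \<Longrightarrow> set w \<subseteq> S"
  shows "Dr a b (\<lambda>z. \<Prod>w\<leftarrow>ws. trA z w)
    (\<lambda>z. \<Sum>j<length ws. \<Sum>k<length (ws ! j). if ok (ws ! j ! k)
      then entA z (T @ drop (Suc k) (ws ! j) @ take k (ws ! j)) a b / of_nat N *
        (\<Prod>w\<leftarrow>take j ws @ drop (Suc j) ws. trA z w) else 0)"
  using assms(3)
proof (induction ws)
  case Nil
  then show ?case by (simp add: Dr_const)
next
  case (Cons w ws)
  let ?F = "\<lambda>z j. \<Sum>k<length (ws ! j). if ok (ws ! j ! k)
      then entA z (T @ drop (Suc k) (ws ! j) @ take k (ws ! j)) a b / of_nat N *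
        (\<Prod>w\<leftarrow>take j ws @ drop (Suc j) ws. trA z w) else 0"
  have "Dr a b (\<lambda>z. trA z w * (\<Prod>w\<leftarrow>ws. trA z w))
    (\<lambda>z. (\<Sum>k<length w. if ok (w ! k) then entA z (T @ drop (Suc k) w @ take k w) a b / of_nat N else 0)
       * (\<Prod>w\<leftarrow>ws. trA z w) + trA z w * (\<Sum>j<length ws. ?F z j))"
    by (intro Dr_mult Dr_trw assms(1,2) Cons.IH) (use Cons.prems in auto)
  also have "(\<lambda>z. (\<Sum>k<length w. if ok (w ! k) then entA z (T @ drop (Suc k) w @ take k w) a b / of_nat N else 0)
       * (\<Prod>w\<leftarrow>ws. trA z w) + trA z w * (\<Sum>j<length ws. ?F z j)) =
    (\<lambda>z. \<Sum>j<length (w # ws). \<Sum>k<length ((w # ws) ! j). if ok ((w # ws) ! j ! k)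
      then entA z (T @ drop (Suc k) ((w # ws) ! j) @ take k ((w # ws) ! j)) a b / of_nat N *
        (\<Prod>w\<leftarrow>take j (w # ws) @ drop (Suc j) (w # ws). trA z w) else 0)"
    by (rule ext, simp only: length_Cons sum.lessThan_Suc_shift sum_distrib_left sum_distrib_right,
        intro arg_cong2[where f="(+)"] sum.cong) (auto simp: mult_ac)
  finally show ?case by simp
qed

text \<open>The first trace and \<open>ibp\<close> each supply a factor \<open>1 / N\<close>. A cut
  inside \<open>w\<close> produces two traces, which these factors normalize. A cut in another word
  merges it with \<open>w\<close>; the merged trace is normalized by the factor of that word, and
  the two others remain as \<open>1 / N\<^sup>2\<close>.\<close>

theorem trace_recursion:
  assumes w: "set w \<subseteq> S" and ws: "\<And>v. v \<in> set ws \<Longrightarrow> set v \<subseteq> S"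
  shows "E (\<lambda>z. \<Prod>v\<leftarrow>(l0 # w) # ws. trA z v) = d * E (\<lambda>z. \<Prod>v\<leftarrow>w # ws. trA z v)
    + (\<Sum>k<length w. if ok (w ! k) then E (\<lambda>z. \<Prod>v\<leftarrow>take k w # (T @ drop (Suc k) w) # ws. trA z v) else 0)
    + 1 / (of_nat N)\<^sup>2 * (\<Sum>j<length ws. \<Sum>k<length (ws ! j). if ok (ws ! j ! k)
        then E (\<lambda>z. \<Prod>v\<leftarrow>(w @ T @ drop (Suc k) (ws ! j) @ take k (ws ! j)) # take j ws @ drop (Suc j) ws. trA z v) else 0)"
proof -
  define P where "P z = (\<Prod>v\<leftarrow>ws. trA z v)" for z
  define Q where "Q j z = (\<Prod>v\<leftarrow>take j ws @ drop (Suc j) ws. trA z v)" for j z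
  define X where "X j k = T @ drop (Suc k) (ws ! j) @ take k (ws ! j)" for j k
  let ?n = "of_nat N :: complex"
  have wk: "set (take k w) \<subseteq> S" "set (T @ drop k w) \<subseteq> S" for k
    using w T set_take_subset[of k w] set_drop_subset[of k w] by auto
  have wsj: "set (ws ! j) \<subseteq> S" if "j < length ws" for j using ws that by simp
  have Xjk: "set (X j k) \<subseteq> S" if "j < length ws" for j k
    using T wsj[OF that] set_take_subset[of k "ws ! j"] set_drop_subset[of "Suc k" "ws ! j"] by (auto simp: X_def)
  have polP: "pol P" unfolding P_def by (rule pol_prod) (use ws in auto)
  have polQ: "pol (Q j)" for j unfolding Q_def
    by (rule pol_prod) (use ws set_take_subset[of j ws] set_drop_subset[of "Suc j" ws] in auto)
  define D where "D a b z = (\<Sum>k<length w. if ok (w ! k) then entA z (take k w) b b * entA z (T @ drop (Suc k) w) a a else 0) * P z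
     + entA z w b a * (\<Sum>j<length ws. \<Sum>k<length (ws ! j). if ok (ws ! j ! k) then entA z (X j k) a b / ?n * Q j z else 0)" for a b z
  have polD: "pol (D a b)" if "a < N" "b < N" for a b
    unfolding D_def
    by (intro pol_add pol_mult pol_sum pol_if pol_wd polP polQ pol_divide) (use w wk Xjk that in auto)
  have DD: "Dr a b (\<lambda>z. entA z w b a * P z) (D a b)" if "a < N" "b < N" for a b
    unfolding D_def P_def Q_def X_def by (intro Dr_mult Dr_wd Dr_prod) (use that w ws in auto)
  have polF: "pol (\<lambda>z. entA z w b a * P z)" if "a < N" "b < N" for a b
    using that w polP by (intro pol_mult pol_wd)
  have polAF: "pol (\<lambda>z. A z l0 a b * (entA z w b a * P z))" if "a < N" "b < N" for a b
    by (rule pol_mult[OF pol_A polF]) (use that l0 in auto)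
  have "(\<lambda>z. \<Prod>v\<leftarrow>(l0 # w) # ws. trA z v) =
      (\<lambda>z. (\<Sum>a<N. \<Sum>b<N. A z l0 a b * (entA z w b a * P z)) / ?n)"
    by (simp add: trw_def P_def sum_distrib_right mult.assoc)
  then have "E (\<lambda>z. \<Prod>v\<leftarrow>(l0 # w) # ws. trA z v) =
      E (\<lambda>z. (\<Sum>a<N. \<Sum>b<N. A z l0 a b * (entA z w b a * P z)) / ?n)" by simp
  also have "\<dots> = E (\<lambda>z. \<Sum>a<N. \<Sum>b<N. A z l0 a b * (entA z w b a * P z)) / ?n"
    by (intro E_divide pol_sum polAF) auto
  also have "E (\<lambda>z. \<Sum>a<N. \<Sum>b<N. A z l0 a b * (entA z w b a * P z)) =
      (\<Sum>a<N. \<Sum>b<N. E (\<lambda>z. A z l0 a b * (entA z w b a * P z)))"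
    using polAF by (subst E_sum; (intro sum.cong refl E_sum pol_sum)?) auto
  also have "\<dots> = (\<Sum>a<N. \<Sum>b<N. (if a = b then d * E (\<lambda>z. entA z w b a * P z) else 0) + E (D a b) / ?n)"
    by (intro sum.cong refl ibp polF DD) auto
  also have "\<dots> = d * (\<Sum>a<N. E (\<lambda>z. entA z w a a * P z)) + (\<Sum>a<N. \<Sum>b<N. E (D a b)) / ?n"
    by (simp add: sum.distrib sum_distrib_left sum_divide_distrib)
  also have "(\<Sum>a<N. E (\<lambda>z. entA z w a a * P z)) = E (\<lambda>z. \<Sum>a<N. entA z w a a * P z)"
    using polF by (intro E_sum[symmetric]) auto
  also have "(\<Sum>a<N. \<Sum>b<N. E (D a b)) = E (\<lambda>z. \<Sum>a<N. \<Sum>b<N. D a b z)"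
    using polD by (subst E_sum; (intro sum.cong refl E_sum[symmetric] pol_sum)?) auto
  also have "(d * E (\<lambda>z. \<Sum>a<N. entA z w a a * P z) + E (\<lambda>z. \<Sum>a<N. \<Sum>b<N. D a b z) / ?n) / ?n =
      d * (E (\<lambda>z. \<Sum>a<N. entA z w a a * P z) / ?n) + E (\<lambda>z. \<Sum>a<N. \<Sum>b<N. D a b z) / (?n * ?n)"
    by (simp add: add_divide_distrib)
  also have "E (\<lambda>z. \<Sum>a<N. entA z w a a * P z) / ?n = E (\<lambda>z. (\<Sum>a<N. entA z w a a * P z) / ?n)"
    using polF by (intro E_divide[symmetric] pol_sum) auto
  also have "(\<lambda>z. (\<Sum>a<N. entA z w a a * P z) / ?n) = (\<lambda>z. \<Prod>v\<leftarrow>w # ws. trA z v)"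
    by (simp add: trw_def P_def sum_distrib_right)
  also have "E (\<lambda>z. \<Sum>a<N. \<Sum>b<N. D a b z) / (?n * ?n) = E (\<lambda>z. (\<Sum>a<N. \<Sum>b<N. D a b z) / (?n * ?n))"
    using polD by (intro E_divide[symmetric] pol_sum) auto
  also have "(\<lambda>z. (\<Sum>a<N. \<Sum>b<N. D a b z) / (?n * ?n)) =
     (\<lambda>z. (\<Sum>k<length w. if ok (w ! k) then trA z (take k w) * (trA z (T @ drop (Suc k) w) * P z) else 0)
       + 1 / ?n\<^sup>2 * (\<Sum>j<length ws. \<Sum>k<length (ws ! j). if ok (ws ! j ! k) then trA z (w @ X j k) * Q j z else 0))"
  proof (rule ext)
    fix z
    \<comment> \<open>The two entries depend on \<open>b\<close> alone and on \<open>a\<close>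
      alone, so the double sum splits into two unnormalized traces.\<close>
    have a: "(\<Sum>a<N. \<Sum>b<N. (\<Sum>k<length w. if ok (w ! k) then entA z (take k w) b b * entA z (T @ drop (Suc k) w) a a else 0) * P z)
        = (\<Sum>k<length w. if ok (w ! k) then (\<Sum>b<N. entA z (take k w) b b) * ((\<Sum>a<N. entA z (T @ drop (Suc k) w) a a) * P z) else 0)"
    proof -
      have "(\<Sum>a<N. \<Sum>b<N. (\<Sum>k<length w. if ok (w ! k) then entA z (take k w) b b * entA z (T @ drop (Suc k) w) a a else 0) * P z)
         = (\<Sum>a<N. \<Sum>k<length w. \<Sum>b<N. if ok (w ! k) then entA z (take k w) b b * (entA z (T @ drop (Suc k) w) a a * P z) else 0)"
        unfolding sum_distrib_right by (subst sum.swap) (auto intro!: sum.cong simp: mult.assoc)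
      also have "\<dots> = (\<Sum>k<length w. \<Sum>a<N. \<Sum>b<N. if ok (w ! k) then entA z (take k w) b b * (entA z (T @ drop (Suc k) w) a a * P z) else 0)"
        by (rule sum.swap)
      also have "\<dots> = (\<Sum>k<length w. if ok (w ! k) then (\<Sum>b<N. entA z (take k w) b b) * ((\<Sum>a<N. entA z (T @ drop (Suc k) w) a a) * P z) else 0)"
        unfolding sum_distrib_right sum_distrib_left
        by (intro sum.cong refl) (auto simp: sum_distrib_left sum_distrib_right intro: sum.swap)
      finally show ?thesis .
    qed
    \<comment> \<open>Here both entries involve both indices, and the double sum is the trace of a
      matrix product.\<close>
    have b: "(\<Sum>a<N. \<Sum>b<N. entA z w b a * (\<Sum>j<length ws. \<Sum>k<length (ws ! j). if ok (ws ! j ! k) then entA z (X j k) a b / ?n * Q j z else 0))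
        = (\<Sum>j<length ws. \<Sum>k<length (ws ! j). if ok (ws ! j ! k) then trA z (w @ X j k) * Q j z else 0)"
    proof -
      have t: "(\<Sum>a<N. \<Sum>b<N. entA z w b a * (entA z (X j k) a b / ?n * Q j z)) = trA z (w @ X j k) * Q j z" for j k
      proof -
        have "(\<Sum>a<N. \<Sum>b<N. entA z w b a * (entA z (X j k) a b / ?n * Q j z)) =
           (\<Sum>b<N. \<Sum>a<N. entA z w b a * entA z (X j k) a b) / ?n * Q j z"
          unfolding sum_divide_distrib sum_distrib_right by (subst sum.swap) (simp add: mult.assoc)
        then show ?thesis by (simp add: trw_def wd_append)
      qed
      show ?thesis unfolding sum_swap_if t ..
    qed
    have c: "(\<Sum>k<length w. if ok (w ! k) then F k * (G k * P z) else 0) / (?n * ?n) =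
        (\<Sum>k<length w. if ok (w ! k) then F k / ?n * (G k / ?n * P z) else 0)" for F G
      unfolding sum_divide_distrib by (intro sum.cong refl) auto
    show "(\<Sum>a<N. \<Sum>b<N. D a b z) / (?n * ?n) =
      (\<Sum>k<length w. if ok (w ! k) then trA z (take k w) * (trA z (T @ drop (Suc k) w) * P z) else 0)
       + 1 / ?n\<^sup>2 * (\<Sum>j<length ws. \<Sum>k<length (ws ! j). if ok (ws ! j ! k) then trA z (w @ X j k) * Q j z else 0)"
      unfolding D_def sum.distrib a b add_divide_distrib c
      by (simp add: trw_def[symmetric] power2_eq_square cong: if_cong)
  qed
  also have "E \<dots> = (\<Sum>k<length w. if ok (w ! k) then E (\<lambda>z. trA z (take k w) * (trA z (T @ drop (Suc k) w) * P z)) else 0)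
       + 1 / ?n\<^sup>2 * (\<Sum>j<length ws. \<Sum>k<length (ws ! j). if ok (ws ! j ! k) then E (\<lambda>z. trA z (w @ X j k) * Q j z) else 0)"
  proof -
    have p1: "pol (\<lambda>z. if ok (w ! k) then trA z (take k w) * (trA z (T @ drop (Suc k) w) * P z) else 0)" for k
      by (intro pol_if pol_mult pol_trw wk polP)
    have p2: "pol (\<lambda>z. if ok (ws ! j ! k) then trA z (w @ X j k) * Q j z else 0)" if "j < length ws" for j k
      by (intro pol_if pol_mult pol_trw polQ) (use w Xjk[OF that] in auto)
    have s1: "pol (\<lambda>z. \<Sum>k<length w. if ok (w ! k) then trA z (take k w) * (trA z (T @ drop (Suc k) w) * P z) else 0)"
      by (intro pol_sum p1) auto
    have s2: "pol (\<lambda>z. \<Sum>j<length ws. \<Sum>k<length (ws ! j). if ok (ws ! j ! k) then trA z (w @ X j k) * Q j z else 0)"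
      by (intro pol_sum p2) auto
    have e2: "E (\<lambda>z. \<Sum>j<length ws. \<Sum>k<length (ws ! j). if ok (ws ! j ! k) then trA z (w @ X j k) * Q j z else 0)
      = (\<Sum>j<length ws. \<Sum>k<length (ws ! j). if ok (ws ! j ! k) then E (\<lambda>z. trA z (w @ X j k) * Q j z) else 0)"
    proof -
      have "E (\<lambda>z. \<Sum>j<length ws. \<Sum>k<length (ws ! j). if ok (ws ! j ! k) then trA z (w @ X j k) * Q j z else 0)
        = (\<Sum>j<length ws. E (\<lambda>z. \<Sum>k<length (ws ! j). if ok (ws ! j ! k) then trA z (w @ X j k) * Q j z else 0))"
        by (rule E_sum) (auto intro!: pol_sum p2)
      also have "\<dots> = (\<Sum>j<length ws. \<Sum>k<length (ws ! j). E (\<lambda>z. if ok (ws ! j ! k) then trA z (w @ X j k) * Q j z else 0))"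
        by (intro sum.cong refl E_sum) (auto intro!: p2)
      finally show ?thesis by (simp only: E_if)
    qed
    have e1: "E (\<lambda>z. \<Sum>k<length w. if ok (w ! k) then trA z (take k w) * (trA z (T @ drop (Suc k) w) * P z) else 0) =
      (\<Sum>k<length w. if ok (w ! k) then E (\<lambda>z. trA z (take k w) * (trA z (T @ drop (Suc k) w) * P z)) else 0)"
      by (subst E_sum) (auto intro!: p1 simp: E_if)
    show ?thesis
      by (subst E_add, rule s1, rule pol_mult[OF pol_const s2]) (simp only: e1 e2 E_scale[OF s2])
  qed
  finally show ?thesis by (simp add: P_def Q_def X_def add.assoc cong: if_cong)
qed

end

section \<open>Gaussian integration by parts\<close>

text \<open>Polynomials are generated by real and imaginary parts rather than by variables and
  conjugates, since these are the independent real Gaussians whose moments are known.\<close>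

definition gen :: "'v \<times> bool \<Rightarrow> ('v \<Rightarrow> complex) \<Rightarrow> complex" where
  "gen g z = complex_of_real (if snd g then Im (z (fst g)) else Re (z (fst g)))"

definition gen_prod :: "('v \<times> bool) list \<Rightarrow> ('v \<Rightarrow> complex) \<Rightarrow> complex" where
  "gen_prod L z = (\<Prod>g\<leftarrow>L. gen g z)"

definition gen_prod_deriv :: "('v \<times> bool \<Rightarrow> complex) \<Rightarrow> ('v \<times> bool) list \<Rightarrow> ('v \<Rightarrow> complex) \<Rightarrow> complex" where
  "gen_prod_deriv D L z = (\<Sum>k<length L. D (L ! k) * gen_prod (take k L @ drop (Suc k) L) z)"

lemma gen_prod_simps [simp]: "gen_prod [] z = 1" "gen_prod (g # L) z = gen g z * gen_prod L z" "gen_prod (L @ L') z = gen_prod L z * gen_prod L' z"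
  by (simp_all add: gen_prod_def)

lemma gen_prod_deriv_Nil [simp]: "gen_prod_deriv D [] z = 0"
  by (simp add: gen_prod_deriv_def)

lemma gen_prod_deriv_Cons: "gen_prod_deriv D (g # L) z = D g * gen_prod L z + gen g z * gen_prod_deriv D L z"
  unfolding gen_prod_deriv_def length_Cons sum.lessThan_Suc_shift
  by (simp add: sum_distrib_left mult_ac)

lemma gen_prod_deriv_append: "gen_prod_deriv D (L @ L') z = gen_prod_deriv D L z * gen_prod L' z + gen_prod L z * gen_prod_deriv D L' z"
  by (induction L) (simp_all add: gen_prod_deriv_Cons algebra_simps)

text \<open>
  A polynomial function together with its image under the derivation that maps a generator \<open>g\<close>
  to the constant \<open>D g\<close>.
\<close>

inductive Deriv :: "'v set \<Rightarrow> ('v \<times> bool \<Rightarrow> complex) \<Rightarrow> (('v \<Rightarrow> complex) \<Rightarrow> complex) \<Rightarrow> (('v \<Rightarrow> complex) \<Rightarrow> complex) \<Rightarrow> bool"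
  for S D where
  Deriv_gen_prod: "fst ` set L \<subseteq> S \<Longrightarrow> Deriv S D (\<lambda>z. c * gen_prod L z) (\<lambda>z. c * gen_prod_deriv D L z)"
| Deriv_add: "Deriv S D F F' \<Longrightarrow> Deriv S D G G' \<Longrightarrow> Deriv S D (\<lambda>z. F z + G z) (\<lambda>z. F' z + G' z)"

lemma Deriv_const: "Deriv S D (\<lambda>z. c) (\<lambda>z. 0)"
  using Deriv_gen_prod[of "[]" S D c] by simp

lemma Deriv_scale: "Deriv S D F F' \<Longrightarrow> Deriv S D (\<lambda>z. c * F z) (\<lambda>z. c * F' z)"
proof (induction rule: Deriv.induct)
  case (Deriv_gen_prod L b)
  then show ?case using Deriv.Deriv_gen_prod[of L S D "c * b"] by (simp add: mult.assoc)
next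
  case (Deriv_add F F' G G')
  then show ?case using Deriv.Deriv_add[OF Deriv_add.IH] by (simp add: distrib_left)
qed

lemma Deriv_mult_gen_prod:
  assumes "Deriv S D G G'" "fst ` set L \<subseteq> S"
  shows "Deriv S D (\<lambda>z. c * gen_prod L z * G z) (\<lambda>z. c * gen_prod_deriv D L z * G z + c * gen_prod L z * G' z)"
  using assms(1)
proof (induction rule: Deriv.induct)
  case (Deriv_gen_prod L' c')
  have "(\<lambda>z. c * gen_prod L z * (c' * gen_prod L' z)) = (\<lambda>z. (c * c') * gen_prod (L @ L') z)"
    by (simp add: mult_ac)
  moreover have "(\<lambda>z. c * gen_prod_deriv D L z * (c' * gen_prod L' z) + c * gen_prod L z * (c' * gen_prod_deriv D L' z)) =
     (\<lambda>z. (c * c') * gen_prod_deriv D (L @ L') z)"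
    by (simp add: gen_prod_deriv_append algebra_simps)
  ultimately show ?case
    using Deriv.Deriv_gen_prod[of "L @ L'" S D "c * c'"] assms(2) Deriv_gen_prod by (simp add: image_Un)
next
  case (Deriv_add F F' G G')
  then show ?case using Deriv.Deriv_add[OF Deriv_add.IH] by (simp add: algebra_simps)
qed

lemma Deriv_mult:
  assumes "Deriv S D F F'" "Deriv S D G G'"
  shows "Deriv S D (\<lambda>z. F z * G z) (\<lambda>z. F' z * G z + F z * G' z)"
  using assms(1)
proof (induction rule: Deriv.induct)
  case (Deriv_gen_prod L c)
  then show ?case using Deriv_mult_gen_prod[OF assms(2)] by simp
next
  case (Deriv_add F F' H H')
  then show ?case using Deriv.Deriv_add[OF Deriv_add.IH] by (simp add: algebra_simps)
qed

lemma Deriv_gen: "fst g \<in> S \<Longrightarrow> Deriv S D (gen g) (\<lambda>z. D g)"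
  using Deriv_gen_prod[of "[g]" S D 1] by (simp add: gen_prod_deriv_Cons)

text \<open>With the zero derivation \<open>Deriv\<close> is a mere certificate that
  \<open>F\<close> is a polynomial function of the variables in \<open>S\<close>.\<close>

definition poly_fun :: "'v set \<Rightarrow> (('v \<Rightarrow> complex) \<Rightarrow> complex) \<Rightarrow> bool" where
  "poly_fun S F \<longleftrightarrow> (\<exists>F'. Deriv S (\<lambda>_. 0) F F')"

lemma poly_fun_const: "poly_fun S (\<lambda>z. c)"
  using Deriv_const by (auto simp: poly_fun_def)

lemma poly_fun_add: "poly_fun S F \<Longrightarrow> poly_fun S G \<Longrightarrow> poly_fun S (\<lambda>z. F z + G z)"
  using Deriv_add unfolding poly_fun_def by blast

lemma poly_fun_mult: "poly_fun S F \<Longrightarrow> poly_fun S G \<Longrightarrow> poly_fun S (\<lambda>z. F z * G z)"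
  using Deriv_mult unfolding poly_fun_def by blast

lemma poly_fun_sum: "finite K \<Longrightarrow> (\<And>k. k \<in> K \<Longrightarrow> poly_fun S (F k)) \<Longrightarrow> poly_fun S (\<lambda>z. \<Sum>k\<in>K. F k z)"
  by (induction K rule: finite_induct) (auto intro: poly_fun_const poly_fun_add)

lemma Deriv_sum:
  "finite K \<Longrightarrow> (\<And>k. k \<in> K \<Longrightarrow> Deriv S D (F k) (F' k)) \<Longrightarrow> Deriv S D (\<lambda>z. \<Sum>k\<in>K. F k z) (\<lambda>z. \<Sum>k\<in>K. F' k z)"
  by (induction K rule: finite_induct) (auto intro: Deriv_const Deriv_add)

lemma poly_fun_gen_prod: "fst ` set L \<subseteq> S \<Longrightarrow> poly_fun S (gen_prod L)"
  using Deriv_gen_prod[of L S "\<lambda>_. 0" 1] by (auto simp: poly_fun_def)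

lemma poly_fun_gen_prod_deriv: "fst ` set L \<subseteq> S \<Longrightarrow> poly_fun S (gen_prod_deriv D L)"
  unfolding gen_prod_deriv_def[abs_def]
  by (intro poly_fun_sum poly_fun_mult poly_fun_const poly_fun_gen_prod)
     (auto dest!: in_set_takeD in_set_dropD)

lemma Deriv_poly_fun:
  assumes "Deriv S D F F'"
  shows "poly_fun S F" "poly_fun S F'"
proof -
  have "poly_fun S F \<and> poly_fun S F'"
    using assms by (induction rule: Deriv.induct)
      (auto intro!: poly_fun_add poly_fun_mult poly_fun_const poly_fun_gen_prod poly_fun_gen_prod_deriv)
  then show "poly_fun S F" "poly_fun S F'" by auto
qed

definition lv :: "'v \<times> bool \<Rightarrow> ('v \<Rightarrow> complex) \<Rightarrow> complex" where
  "lv l z = (if snd l then cnj (z (fst l)) else z (fst l))"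

definition csign :: "bool \<Rightarrow> complex" where
  "csign b = (if b then - \<i> else \<i>)"

text \<open>The Wirtinger derivative with respect to the conjugate of the letter \<open>l\<close>.\<close>

definition wirt :: "'v \<times> bool \<Rightarrow> 'v \<times> bool \<Rightarrow> complex" where
  "wirt l g = (if fst g = fst l then (if snd g then csign (snd l) else 1) / 2 else 0)"

lemma lv_gen: "lv l z = gen (fst l, False) z + csign (snd l) * gen (fst l, True) z"
  by (auto simp: lv_def gen_def csign_def complex_eq_iff)

text \<open>The operator of \<open>l'\<close> kills \<open>l'\<close> itself and maps its conjugate
  to 1, mirroring \<open>E (z z) = 0\<close> and \<open>E (z cnj z) = 1\<close> for a complex
  standard Gaussian.\<close>

lemma Deriv_lv:
  assumes "fst l \<in> S"
  shows "Deriv S (wirt l') (lv l) (\<lambda>z. if l = (fst l', \<not> snd l') then 1 else 0)"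
proof -
  have "Deriv S (wirt l') (\<lambda>z. gen (fst l, False) z + csign (snd l) * gen (fst l, True) z)
    (\<lambda>z. wirt l' (fst l, False) + csign (snd l) * wirt l' (fst l, True))"
    by (intro Deriv_add Deriv_scale Deriv_gen) (use assms in auto)
  moreover have "wirt l' (fst l, False) + csign (snd l) * wirt l' (fst l, True) = (if l = (fst l', \<not> snd l') then 1 else 0)"
    by (cases l; cases l') (auto simp: wirt_def csign_def)
  moreover have "(\<lambda>z. gen (fst l, False) z + csign (snd l) * gen (fst l, True) z) = lv l"
    by (simp add: lv_gen fun_eq_iff)
  ultimately show ?thesis by simp
qed

lemma poly_fun_lv: "fst l \<in> S \<Longrightarrow> poly_fun S (lv l)"
  using Deriv_poly_fun(1)[OF Deriv_lv] by blast

section \<open>Moments of real Gaussians of variance 1/2\<close>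

definition nmom :: "nat \<Rightarrow> real" where
  "nmom k = (LBINT x. normal_density 0 (sqrt (1 / 2)) x * x ^ k)"

lemma nmom_even: "nmom (2 * k) = fact (2 * k) / (4 ^ k * fact k)"
  using integral_normal_moment_even[of "sqrt (1 / 2)" 0 k] by (simp add: nmom_def)

lemma nmom_odd: "nmom (2 * k + 1) = 0"
  using integral_normal_moment_odd[of "sqrt (1 / 2)" 0 k] by (simp add: nmom_def)

text \<open>Stein's identity for powers, with the variance \<open>1 / 2\<close>. For
  \<open>n = 0\<close> the truncated \<open>n - 1\<close> is harmless because of the factor
  \<open>n\<close>.\<close>

lemma nmom_Suc: "nmom (Suc n) = real n / 2 * nmom (n - 1)"
proof (cases "even n")
  case True
  then obtain k where k: "n = 2 * k" by auto
  show ?thesis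
  proof (cases k)
    case 0
    then show ?thesis using nmom_odd[of 0] k by simp
  next
    case (Suc j)
    then show ?thesis using nmom_odd[of k] nmom_odd[of j] k by simp
  qed
next
  case False
  then obtain k where k: "n = 2 * k + 1" using oddE by blast
  have "nmom (2 * Suc k) = real (2 * k + 1) / 2 * nmom (2 * k)"
  proof -
    have "(2 * a * b * F) / (4 * p * (a * q)) = b / 2 * (F / (p * q))"
      if "a \<noteq> 0" "p \<noteq> 0" "q \<noteq> 0" for a b p q F :: real
      using that by (simp add: field_simps)
    from this[of "real k + 1" "4 ^ k" "fact k" "2 * real k + 1" "fact (2 * k)"]
    show ?thesis unfolding nmom_even by (simp add: algebra_simps)
  qed
  then show ?thesis using k by simp
qed

definition wickm :: "('v \<times> bool) set \<Rightarrow> ('v \<times> bool) list \<Rightarrow> real" where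
  "wickm K L = (\<Prod>g\<in>K. nmom (count_list L g))"

text \<open>Stein's identity in the variable \<open>g\<close>: its factor is the number of
  occurrences of \<open>g\<close> in \<open>L\<close>, and deleting any one of them gives the same
  moment, since only multiplicities count.\<close>

lemma wickm_Cons:
  assumes "finite K" "g \<in> K"
  shows "wickm K (g # L) = (\<Sum>k<length L. if L ! k = g then wickm K (take k L @ drop (Suc k) L) else 0) / 2"
proof -
  let ?R = "\<Prod>h\<in>K - {g}. nmom (count_list L h)"
  have "wickm K (g # L) = nmom (Suc (count_list L g)) * ?R"
  proof -
    have "(\<Prod>h\<in>K - {g}. nmom (count_list (g # L) h)) = ?R" by (rule prod.cong) auto
    then show ?thesis unfolding wickm_def prod.remove[OF assms] by simp
  qed
  also have "\<dots> = real (count_list L g) * (nmom (count_list L g - 1) * ?R) / 2"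
    by (simp add: nmom_Suc)
  also have "real (count_list L g) * (nmom (count_list L g - 1) * ?R) =
     (\<Sum>k\<in>{k. k < length L \<and> L ! k = g}. nmom (count_list L g - 1) * ?R)"
  proof -
    have "{i. i < length L \<and> g = L ! i} = {k. k < length L \<and> L ! k = g}" by auto
    then have "count_list L g = card {k. k < length L \<and> L ! k = g}"
      by (simp add: count_list_eq_length_filter length_filter_conv_card)
    then show ?thesis by simp
  qed
  also have "\<dots> = (\<Sum>k\<in>{k. k < length L \<and> L ! k = g}. wickm K (take k L @ drop (Suc k) L))"
  proof (rule sum.cong[OF refl])
    fix k assume "k \<in> {k. k < length L \<and> L ! k = g}"
    then have k: "k < length L" "L ! k = g" by auto
    have c: "count_list L h = count_list (take k L @ drop (Suc k) L) h + (if h = g then 1 else 0)" for h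
    proof -
      have "count_list L h = count_list (take k L @ L ! k # drop (Suc k) L) h"
        using id_take_nth_drop[OF k(1)] by simp
      then show ?thesis using k(2) by auto
    qed
    show "nmom (count_list L g - 1) * ?R = wickm K (take k L @ drop (Suc k) L)"
    proof -
      let ?L = "take k L @ drop (Suc k) L"
      have "count_list ?L g = count_list L g - 1" using c[of g] by simp
      moreover have "(\<Prod>h\<in>K - {g}. nmom (count_list ?L h)) = ?R"
        by (rule prod.cong) (use c in auto)
      moreover have "wickm K ?L = nmom (count_list ?L g) * (\<Prod>h\<in>K - {g}. nmom (count_list ?L h))"
        unfolding wickm_def by (rule prod.remove[OF assms])
      ultimately show ?thesis by simp
    qed
  qed
  also have "\<dots> = (\<Sum>k<length L. if L ! k = g then wickm K (take k L @ drop (Suc k) L) else 0)"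
    by (simp add: sum.inter_filter[symmetric])
  finally show ?thesis .
qed

section \<open>Wick's formula for independent complex Gaussians\<close>

locale gaussian_family = prob_space P for P :: "'w measure" +
  fixes f :: "'v \<Rightarrow> 'w \<Rightarrow> complex" and S :: "'v set"
  assumes indep: "indep_vars (\<lambda>_. borel) f S"
    and gauss: "\<And>v. v \<in> S \<Longrightarrow> complex_standard_gaussian P (f v)"
begin

definition Ex :: "(('v \<Rightarrow> complex) \<Rightarrow> complex) \<Rightarrow> complex" where
  "Ex F = expectation (\<lambda>\<omega>. F (\<lambda>v. f v \<omega>))"

lemma normal_power:
  assumes "distributed P lborel X (normal_density 0 (sqrt (1 / 2)))"
  shows "integrable P (\<lambda>\<omega>. X \<omega> ^ k)" "expectation (\<lambda>\<omega>. X \<omega> ^ k) = nmom k"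
proof -
  have "integrable lborel (\<lambda>x. normal_density 0 (sqrt (1 / 2)) x * x ^ k)"
    using integrable_normal_moment[of "sqrt (1 / 2)" 0 k] by simp
  then show "integrable P (\<lambda>\<omega>. X \<omega> ^ k)"
    using distributed_integrable[OF assms, of "\<lambda>x. x ^ k"] by simp
  show "expectation (\<lambda>\<omega>. X \<omega> ^ k) = nmom k"
    using distributed_integral[OF assms, of "\<lambda>x. x ^ k"] by (simp add: nmom_def)
qed

lemma gaussian_moment:
  assumes "v \<in> S"
  shows "integrable P (\<lambda>\<omega>. Re (f v \<omega>) ^ a * Im (f v \<omega>) ^ b)"
    "expectation (\<lambda>\<omega>. Re (f v \<omega>) ^ a * Im (f v \<omega>) ^ b) = nmom a * nmom b"
proof -
  note g = gauss[OF assms, unfolded complex_standard_gaussian_def]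
  have "indep_var borel ((\<lambda>x. x ^ a) \<circ> (\<lambda>\<omega>. Re (f v \<omega>))) borel ((\<lambda>x. x ^ b) \<circ> (\<lambda>\<omega>. Im (f v \<omega>)))"
    using g by (intro indep_var_compose[of borel _ borel]) auto
  then have i: "indep_var borel (\<lambda>\<omega>. Re (f v \<omega>) ^ a) borel (\<lambda>\<omega>. Im (f v \<omega>) ^ b)" by (simp add: o_def)
  show "integrable P (\<lambda>\<omega>. Re (f v \<omega>) ^ a * Im (f v \<omega>) ^ b)"
    using g normal_power by (intro indep_var_integrable[OF i]) auto
  show "expectation (\<lambda>\<omega>. Re (f v \<omega>) ^ a * Im (f v \<omega>) ^ b) = nmom a * nmom b"
    using g normal_power by (subst indep_var_lebesgue_integral[OF i]) auto
qed

lemma gen_prod_prod: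
  assumes "finite V" "fst ` set L \<subseteq> V"
  shows "gen_prod L z = complex_of_real (\<Prod>v\<in>V. Re (z v) ^ count_list L (v, False) * Im (z v) ^ count_list L (v, True))"
  using assms(2)
proof (induction L)
  case (Cons g L)
  obtain v b where g: "g = (v, b)" by (cases g)
  have v: "v \<in> V" using Cons.prems g by simp
  let ?t = "\<lambda>L v. Re (z v) ^ count_list L (v, False) * Im (z v) ^ count_list L (v, True)"
  have "(\<Prod>u\<in>V. ?t (g # L) u) = ?t (g # L) v * (\<Prod>u\<in>V - {v}. ?t (g # L) u)"
    by (rule prod.remove[OF assms(1) v])
  also have "(\<Prod>u\<in>V - {v}. ?t (g # L) u) = (\<Prod>u\<in>V - {v}. ?t L u)"
    by (rule prod.cong) (auto simp: g)
  also have "?t (g # L) v = (if b then Im (z v) else Re (z v)) * ?t L v"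
    by (simp add: g)
  finally have "(\<Prod>u\<in>V. ?t (g # L) u) = (if b then Im (z v) else Re (z v)) * (\<Prod>u\<in>V. ?t L u)"
    by (simp only: prod.remove[OF assms(1) v, of "?t L"] mult.assoc)
  then show ?case using Cons by (simp add: g gen_def)
qed simp

text \<open>\<open>V\<close> may contain more variables than \<open>L\<close>, the additional
  factors being moments of order 0; thus a monomial and its shortened versions can be compared over
  one index set.\<close>

lemma gen_prod_moment:
  assumes "finite V" "V \<subseteq> S" "fst ` set L \<subseteq> V"
  shows "integrable P (\<lambda>\<omega>. gen_prod L (\<lambda>v. f v \<omega>))" "Ex (gen_prod L) = complex_of_real (wickm (V \<times> UNIV) L)"
proof -
  let ?X = "\<lambda>v \<omega>. Re (f v \<omega>) ^ count_list L (v, False) * Im (f v \<omega>) ^ count_list L (v, True)"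
  have ind: "indep_vars (\<lambda>_. borel) ?X V"
    by (rule indep_vars_compose2[OF indep_vars_subset[OF indep assms(2)]]) auto
  have m: "gen_prod L (\<lambda>v. f v \<omega>) = complex_of_real (\<Prod>v\<in>V. ?X v \<omega>)" for \<omega>
    using gen_prod_prod[OF assms(1,3)] by simp
  have int: "integrable P (\<lambda>\<omega>. \<Prod>v\<in>V. ?X v \<omega>)"
    using assms gaussian_moment(1) by (intro indep_vars_integrable[OF assms(1) ind]) auto
  show "integrable P (\<lambda>\<omega>. gen_prod L (\<lambda>v. f v \<omega>))" unfolding m by (rule integrable_of_real[OF int])
  have "expectation (\<lambda>\<omega>. \<Prod>v\<in>V. ?X v \<omega>) = (\<Prod>v\<in>V. expectation (?X v))"
    using assms gaussian_moment(1) by (intro indep_vars_lebesgue_integral[OF assms(1) ind]) auto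
  also have "\<dots> = (\<Prod>v\<in>V. nmom (count_list L (v, False)) * nmom (count_list L (v, True)))"
    using assms gaussian_moment(2) by (intro prod.cong) auto
  also have "\<dots> = (\<Prod>v\<in>V. \<Prod>b\<in>UNIV. nmom (count_list L (v, b)))"
    by (simp add: UNIV_bool mult.commute)
  also have "\<dots> = wickm (V \<times> UNIV) L"
    by (simp add: wickm_def prod.cartesian_product)
  finally show "Ex (gen_prod L) = complex_of_real (wickm (V \<times> UNIV) L)"
    unfolding Ex_def m by (simp only: integral_complex_of_real)
qed

lemma integrable_gen_prod: "fst ` set L \<subseteq> S \<Longrightarrow> integrable P (\<lambda>\<omega>. gen_prod L (\<lambda>v. f v \<omega>))"
  by (rule gen_prod_moment(1)[of "fst ` set L"]) auto

lemma integrable_poly_fun: "poly_fun S F \<Longrightarrow> integrable P (\<lambda>\<omega>. F (\<lambda>v. f v \<omega>))"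
proof -
  assume "poly_fun S F"
  then obtain F' where "Deriv S (\<lambda>_. 0) F F'" by (auto simp: poly_fun_def)
  then show ?thesis
    by (induction rule: Deriv.induct) (auto intro: integrable_gen_prod)
qed

lemma Ex_add: "poly_fun S F \<Longrightarrow> poly_fun S G \<Longrightarrow> Ex (\<lambda>z. F z + G z) = Ex F + Ex G"
  unfolding Ex_def by (intro Bochner_Integration.integral_add integrable_poly_fun)

lemma Ex_scale: "Ex (\<lambda>z. c * F z) = c * Ex F"
  unfolding Ex_def by simp

lemma Ex_sum: "finite K \<Longrightarrow> (\<And>k. k \<in> K \<Longrightarrow> poly_fun S (F k)) \<Longrightarrow> Ex (\<lambda>z. \<Sum>k\<in>K. F k z) = (\<Sum>k\<in>K. Ex (F k))"
  unfolding Ex_def by (intro Bochner_Integration.integral_sum integrable_poly_fun) auto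

lemma wick_gen:
  assumes "fst g \<in> S" "fst ` set L \<subseteq> S"
  shows "Ex (\<lambda>z. gen g z * gen_prod L z) = (\<Sum>k<length L. if L ! k = g then Ex (gen_prod (take k L @ drop (Suc k) L)) / 2 else 0)"
proof -
  let ?V = "insert (fst g) (fst ` set L)"
  have V: "finite ?V" "?V \<subseteq> S" using assms by auto
  have sub: "fst ` set (take k L @ drop (Suc k) L) \<subseteq> ?V" for k
    by (auto dest!: in_set_takeD in_set_dropD)
  have gK: "g \<in> ?V \<times> UNIV" by (cases g) auto
  have "Ex (\<lambda>z. gen g z * gen_prod L z) = Ex (gen_prod (g # L))"
    by (rule arg_cong[where f=Ex]) (simp add: fun_eq_iff)
  also have "\<dots> = complex_of_real (wickm (?V \<times> UNIV) (g # L))"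
    by (rule gen_prod_moment(2)[OF V]) auto
  also have "\<dots> = (\<Sum>k<length L. if L ! k = g then complex_of_real (wickm (?V \<times> UNIV) (take k L @ drop (Suc k) L)) / 2 else 0)"
    by (subst wickm_Cons[OF _ gK]) (use V(1) in \<open>simp_all add: sum_divide_distrib if_distrib[where f=complex_of_real] if_distrib[where f="\<lambda>x. x / 2"] cong: if_cong\<close>)
  also have "\<dots> = (\<Sum>k<length L. if L ! k = g then Ex (gen_prod (take k L @ drop (Suc k) L)) / 2 else 0)"
    using gen_prod_moment(2)[OF V sub] by (simp cong: if_cong)
  finally show ?thesis .
qed

text \<open>Adds the identities for the real and the imaginary part with weights \<open>1\<close>
  and \<open>csign\<close>; together with the variance \<open>1 / 2\<close> these are the Wirtinger
  coefficients \<open>wirt\<close>.\<close>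

lemma wick_lv:
  assumes l: "fst l \<in> S" and L: "fst ` set L \<subseteq> S"
  shows "Ex (\<lambda>z. lv l z * gen_prod L z) = Ex (gen_prod_deriv (wirt l) L)"
proof -
  have pm: "poly_fun S (gen_prod (take k L @ drop (Suc k) L))" for k
    using L by (intro poly_fun_gen_prod) (auto dest!: in_set_takeD in_set_dropD)
  have pg: "poly_fun S (\<lambda>z. gen (fst l, b) z * gen_prod L z)" for b
    by (intro poly_fun_mult poly_fun_gen_prod L Deriv_poly_fun(1)[OF Deriv_gen]) (use l in auto)
  have "Ex (\<lambda>z. lv l z * gen_prod L z) =
      Ex (\<lambda>z. gen (fst l, False) z * gen_prod L z + csign (snd l) * (gen (fst l, True) z * gen_prod L z))"
    by (rule arg_cong[where f=Ex]) (simp add: fun_eq_iff lv_gen algebra_simps)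
  also have "\<dots> = Ex (\<lambda>z. gen (fst l, False) z * gen_prod L z) + csign (snd l) * Ex (\<lambda>z. gen (fst l, True) z * gen_prod L z)"
    using pg by (subst Ex_add) (auto intro: poly_fun_mult poly_fun_const simp: Ex_scale)
  also have "\<dots> = (\<Sum>k<length L. wirt l (L ! k) * Ex (gen_prod (take k L @ drop (Suc k) L)))"
  proof -
    have w: "Ex (\<lambda>z. gen (fst l, b) z * gen_prod L z) =
        (\<Sum>k<length L. if L ! k = (fst l, b) then Ex (gen_prod (take k L @ drop (Suc k) L)) / 2 else 0)" for b
      by (rule wick_gen) (use l L in auto)
    show ?thesis unfolding w sum_distrib_left sum.distrib[symmetric]
      by (intro sum.cong refl) (auto simp: wirt_def prod_eq_iff)
  qed
  also have "\<dots> = Ex (gen_prod_deriv (wirt l) L)"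
    unfolding gen_prod_deriv_def[abs_def] Ex_scale[symmetric]
    by (intro Ex_sum[symmetric] poly_fun_mult poly_fun_const pm) auto
  finally show ?thesis .
qed

theorem gaussian_ibp:
  assumes "fst l \<in> S" "Deriv S (wirt l) F F'"
  shows "Ex (\<lambda>z. lv l z * F z) = Ex F'"
  using assms(2)
proof (induction rule: Deriv.induct)
  case (Deriv_gen_prod L c)
  have "Ex (\<lambda>z. lv l z * (c * gen_prod L z)) = Ex (\<lambda>z. c * (lv l z * gen_prod L z))"
    by (simp add: mult_ac)
  then show ?case by (simp add: Ex_scale wick_lv[OF assms(1) Deriv_gen_prod])
next
  case (Deriv_add F F' G G')
  have "Ex (\<lambda>z. lv l z * (F z + G z)) = Ex (\<lambda>z. lv l z * F z) + Ex (\<lambda>z. lv l z * G z)"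
    unfolding distrib_left
    by (intro Ex_add poly_fun_mult poly_fun_lv assms(1) Deriv_poly_fun(1)[OF Deriv_add(1)] Deriv_poly_fun(1)[OF Deriv_add(2)])
  also have "\<dots> = Ex (\<lambda>z. F' z + G' z)"
    using Ex_add[OF Deriv_poly_fun(2)[OF Deriv_add(1)] Deriv_poly_fun(2)[OF Deriv_add(2)]] Deriv_add.IH by simp
  finally show ?case .
qed

end

section \<open>Ginibre and Wishart matrices\<close>

type_synonym letter = "(nat + nat) \<times> bool"

text \<open>The permutations \<open>p\<close> enter as fixed parameters behind the indices
  \<open>Inl\<close>; the indices \<open>Inr\<close> belong to the Gaussian model
  \<open>X\<close>.\<close>

definition mixed_entries :: "(nat + nat \<Rightarrow> nat \<Rightarrow> nat) \<Rightarrow> (nat \<Rightarrow> nat \<Rightarrow> nat \<Rightarrow> complex) \<Rightarrow> letter \<Rightarrow> nat \<Rightarrow> nat \<Rightarrow> complex" where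
  "mixed_entries p X l x y = (case fst l of Inl r \<Rightarrow> (if x = act p l y then 1 else 0)
     | Inr r \<Rightarrow> (if snd l then cnj (X r y x) else X r x y))"

lemma mixed_entries_simps [simp]:
  "mixed_entries p X (Inl r, b) x y = (if x = act p (Inl r, b) y then 1 else 0)"
  "mixed_entries p X (Inr r, b) x y = (if b then cnj (X r y x) else X r x y)"
  by (simp_all add: mixed_entries_def)

definition ginibre_entry :: "nat \<Rightarrow> (nat \<times> nat \<times> nat \<Rightarrow> complex) \<Rightarrow> nat \<Rightarrow> nat \<Rightarrow> nat \<Rightarrow> complex" where
  "ginibre_entry N z r x y = complex_of_real (1 / sqrt (real N)) * z (r, x, y)"

definition wishart_entry :: "nat \<Rightarrow> nat \<Rightarrow> (nat \<times> nat \<times> nat \<Rightarrow> complex) \<Rightarrow> nat \<Rightarrow> nat \<Rightarrow> nat \<Rightarrow> complex" where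
  "wishart_entry M N z r x y = complex_of_real (1 / real N) * (\<Sum>m<M. cnj (z (r, m, x)) * z (r, m, y))"

lemma cnj_wishart_entry: "cnj (wishart_entry M N z r y x) = wishart_entry M N z r x y"
  by (simp add: wishart_entry_def mult.commute)


locale gaussian_matrices = gaussian_family P "\<lambda>(r, i, j). f r i j" "{1..s} \<times> UNIV"
  for P :: "'w measure" and f :: "nat \<Rightarrow> nat \<Rightarrow> nat \<Rightarrow> 'w \<Rightarrow> complex" and s :: nat
begin

abbreviation "V \<equiv> {1..s} \<times> (UNIV :: (nat \<times> nat) set)"
abbreviation "letters \<equiv> {l :: letter. fst l \<in> {1..s} <+> {1..s}}"

lemma poly_fun_divide: "poly_fun V F \<Longrightarrow> poly_fun V (\<lambda>z. F z / c)"
  using poly_fun_mult[OF _ poly_fun_const[of V "1 / c"]] by simp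

lemma poly_fun_z: "r \<in> {1..s} \<Longrightarrow> poly_fun V (\<lambda>z. z (r, i, j))"
  using poly_fun_lv[of "((r, i, j), False)" V] by (simp add: lv_def[abs_def])

lemma poly_fun_cnj_z: "r \<in> {1..s} \<Longrightarrow> poly_fun V (\<lambda>z. cnj (z (r, i, j)))"
  using poly_fun_lv[of "((r, i, j), True)" V] by (simp add: lv_def[abs_def])

text \<open>An entry \<open>(a, c)\<close> of an adjoint comes from the entry \<open>(c, a)\<close>,
  hence the exchange of indices. The factor \<open>sqrt N\<close> makes the derivative of the
  matching entry equal to 1 and turns the \<open>1 / sqrt N\<close> from integration by parts into
  the \<open>1 / N\<close> of \<open>matrix_ibp\<close>.\<close>

abbreviation ginibre_deriv where
  "ginibre_deriv N r b a c F F' \<equiv>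
    \<exists>F1. Deriv V (wirt ((r, if b then (c, a) else (a, c)), b)) F F1 \<and> F' = (\<lambda>z. complex_of_real (sqrt (real N)) * F1 z)"

text \<open>Integration by parts is done in the unconjugated factor \<open>z (r, m, c)\<close> of
  the entry, and its partner \<open>cnj (z (r, m, a))\<close> stays in front. The sum over
  \<open>m\<close> is a derivation that maps row \<open>c\<close> of the same Wishart matrix to row
  \<open>a\<close> and kills the other rows, so the equations never leave words in Wishart
  matrices.\<close>

abbreviation wishart_deriv where
  "wishart_deriv M r a c F F' \<equiv>
    \<exists>Fm. (\<forall>m. Deriv V (wirt ((r, m, c), False)) F (Fm m)) \<and> F' = (\<lambda>z. \<Sum>m<M. cnj (z (r, m, a)) * Fm m z)"

lemma poly_fun_ginibre: "l \<in> letters \<Longrightarrow> poly_fun V (\<lambda>z. mixed_entries p (ginibre_entry N z) l x y)"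
  by (cases l; cases "fst l"; cases "snd l") (auto simp: ginibre_entry_def simp del: One_nat_def intro!: poly_fun_const poly_fun_divide poly_fun_mult poly_fun_z poly_fun_cnj_z)

lemma poly_fun_wishart: "l \<in> letters \<Longrightarrow> poly_fun V (\<lambda>z. mixed_entries p (wishart_entry M N z) l x y)"
  by (cases l; cases "fst l"; cases "snd l")
     (auto simp: cnj_wishart_entry wishart_entry_def simp del: One_nat_def intro!: poly_fun_const poly_fun_divide poly_fun_mult poly_fun_sum poly_fun_z poly_fun_cnj_z)

lemma ginibre_ibp:
  assumes r: "r \<in> {1..s}" and N: "N \<ge> 1"
  shows "matrix_ibp Ex (poly_fun V)
    (ginibre_deriv N r b)
    (\<lambda>z. mixed_entries p (ginibre_entry N z)) N letters (Inr r, b) (\<lambda>l. l = (Inr r, \<not> b)) 0 []"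
proof
  let ?n = "complex_of_real (sqrt (real N))"
  have nn: "?n * ?n = of_nat N" "?n \<noteq> 0"
    using N by (simp_all flip: of_real_mult)
  have lv: "mixed_entries p (ginibre_entry N z) (Inr q, d) x y = 1 / ?n * lv ((q, if d then (y, x) else (x, y)), d) z" for q d x y z
    by (simp add: ginibre_entry_def lv_def)
  {
    fix l :: letter and a c x y :: nat assume l: "l \<in> letters"
    show "ginibre_deriv N r b a c (\<lambda>z. mixed_entries p (ginibre_entry N z) l x y) (\<lambda>z. if l = (Inr r, \<not> b) \<and> x = c then wd N (mixed_entries p (ginibre_entry N z)) [] a y else 0)"
    proof (cases "fst l")
      case (Inl q)
      then have "l = (Inl q, snd l)" by (simp add: prod_eq_iff)
      then have "mixed_entries p X l x y = (if x = act p l y then 1 else 0)" for X by (metis mixed_entries_simps(1))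
      moreover have "l \<noteq> (Inr r, \<not> b)" using Inl by auto
      ultimately show ?thesis by (intro exI[of _ "\<lambda>z. 0"]) (simp add: Deriv_const)
    next
      case (Inr q)
      define d where "d = snd l"
      have l': "l = (Inr q, d)" using Inr by (simp add: prod_eq_iff d_def)
      have q: "q \<in> {1..s}" using l l' by auto
      let ?l = "((q, if d then (y, x) else (x, y)), d)" and ?lr = "((r, if b then (c, a) else (a, c)), b)"
      have "Deriv V (wirt ?lr) (\<lambda>z. 1 / ?n * lv ?l z) (\<lambda>z. 1 / ?n * (if ?l = (fst ?lr, \<not> snd ?lr) then 1 else 0))"
        by (intro Deriv_scale Deriv_lv[of ?l V ?lr]) (use q in auto)
      moreover have "(\<lambda>z. if (Inr q, d) = (Inr r, \<not> b) \<and> x = c then wd N (mixed_entries p (ginibre_entry N z)) [] a y else 0)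
          = (\<lambda>z. ?n * (1 / ?n * (if ?l = (fst ?lr, \<not> snd ?lr) then 1 else 0)))"
        using nn by (cases b; cases d) (auto simp: fun_eq_iff)
      ultimately show ?thesis unfolding l' lv by blast
    qed
  next
    fix a c :: nat and F F'
    assume F: "poly_fun V F" and D: "ginibre_deriv N r b a c F F'"
    then obtain F1 where F1: "Deriv V (wirt ((r, if b then (c, a) else (a, c)), b)) F F1" "F' = (\<lambda>z. ?n * F1 z)" by blast
    have "Ex (\<lambda>z. mixed_entries p (ginibre_entry N z) (Inr r, b) a c * F z) =
       1 / ?n * Ex (\<lambda>z. lv ((r, if b then (c, a) else (a, c)), b) z * F z)"
      unfolding lv Ex_scale[symmetric] by (simp add: mult.assoc)
    also have "\<dots> = 1 / ?n * Ex F1" using gaussian_ibp[OF _ F1(1)] r by simp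
    also have "\<dots> = Ex F' / of_nat N" unfolding F1(2) Ex_scale using nn by (simp add: field_simps)
    finally show "Ex (\<lambda>z. mixed_entries p (ginibre_entry N z) (Inr r, b) a c * F z) =
       (if a = c then 0 * Ex F else 0) + Ex F' / of_nat N" by simp
  next
    fix a c :: nat and F F' G G'
    let ?lr = "((r, if b then (c, a) else (a, c)), b)"
    assume "ginibre_deriv N r b a c F F'" "ginibre_deriv N r b a c G G'"
    then obtain F1 G1 where F1: "Deriv V (wirt ?lr) F F1" "F' = (\<lambda>z. ?n * F1 z)"
      and G1: "Deriv V (wirt ?lr) G G1" "G' = (\<lambda>z. ?n * G1 z)" by blast
    show "ginibre_deriv N r b a c (\<lambda>z. F z + G z) (\<lambda>z. F' z + G' z)"
      using Deriv_add[OF F1(1) G1(1)] by (intro exI[of _ "\<lambda>z. F1 z + G1 z"]) (simp add: F1(2) G1(2) distrib_left)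
    show "ginibre_deriv N r b a c (\<lambda>z. F z * G z) (\<lambda>z. F' z * G z + F z * G' z)"
      using Deriv_mult[OF F1(1) G1(1)]
      by (intro exI[of _ "\<lambda>z. F1 z * G z + F z * G1 z"]) (simp add: F1(2) G1(2) algebra_simps)
  next
    fix a c :: nat and k
    show "ginibre_deriv N r b a c (\<lambda>z. k) (\<lambda>z. 0)"
      by (intro exI[of _ "\<lambda>z. 0"]) (simp add: Deriv_const)
  }
qed (use r poly_fun_ginibre in \<open>auto intro: poly_fun_const poly_fun_add poly_fun_mult Ex_add simp: Ex_scale\<close>)

lemma wishart_ibp:
  assumes r: "r \<in> {1..s}" and N: "N \<ge> 1"
  shows "matrix_ibp Ex (poly_fun V)
    (wishart_deriv M r)
    (\<lambda>z. mixed_entries p (wishart_entry M N z)) N letters (Inr r, b) (\<lambda>l. fst l = Inr r)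
    (complex_of_real (real M / real N)) [(Inr r, False)]"
proof
  let ?n = "complex_of_real (1 / real N)"
  have ent: "mixed_entries p (wishart_entry M N z) (Inr q, d) x y = ?n * (\<Sum>m<M. lv ((q, m, x), True) z * lv ((q, m, y), False) z)" for q d x y z
    by (simp add: cnj_wishart_entry) (simp add: wishart_entry_def lv_def)
  {
    fix l :: letter and a c x y :: nat assume l: "l \<in> letters" and y: "y < N"
    show "wishart_deriv M r a c (\<lambda>z. mixed_entries p (wishart_entry M N z) l x y) (\<lambda>z. if fst l = Inr r \<and> x = c then wd N (mixed_entries p (wishart_entry M N z)) [(Inr r, False)] a y else 0)"
    proof (cases "fst l")
      case (Inl q)
      then have "l = (Inl q, snd l)" by (simp add: prod_eq_iff)
      then have "mixed_entries p X l x y = (if x = act p l y then 1 else 0)" for X by (metis mixed_entries_simps(1))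
      then show ?thesis by (intro exI[of _ "\<lambda>m z. 0"]) (simp add: Inl Deriv_const)
    next
      case (Inr q)
      have l': "l = (Inr q, snd l)" using Inr by (simp add: prod_eq_iff)
      have q: "q \<in> {1..s}" using l Inr by auto
      \<comment> \<open>The Leibniz rule as delivered by \<open>Deriv_mult\<close>; of all its terms
        only the conjugated factor with \<open>k = m\<close> and matching indices survives.\<close>
      let ?F = "\<lambda>m z. ?n * (\<Sum>k<M. (if ((q, k, x), True) = (fst ((r, m, c), False), \<not> snd ((r, m, c), False)) then 1 else 0) * lv ((q, k, y), False) z
         + lv ((q, k, x), True) z * (if ((q, k, y), False) = (fst ((r, m, c), False), \<not> snd ((r, m, c), False)) then 1 else 0))"
      have D: "Deriv V (wirt ((r, m, c), False)) (\<lambda>z. ?n * (\<Sum>m<M. lv ((q, m, x), True) z * lv ((q, m, y), False) z)) (?F m)" for m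
        by (intro Deriv_scale Deriv_sum Deriv_mult Deriv_lv) (use q in auto)
      have F: "?F m z = (if q = r \<and> x = c \<and> m < M then ?n * z (r, m, y) else 0)" for m z
      proof -
        have "(\<Sum>k<M. (if ((q, k, x), True) = (fst ((r, m, c), False), \<not> snd ((r, m, c), False)) then 1 else 0) * lv ((q, k, y), False) z
         + lv ((q, k, x), True) z * (if ((q, k, y), False) = (fst ((r, m, c), False), \<not> snd ((r, m, c), False)) then 1 else 0))
         = (\<Sum>k<M. if k = m then (if q = r \<and> x = c then z (r, m, y) else 0) else 0)"
          by (intro sum.cong refl) (auto simp: lv_def)
        then show ?thesis by simp
      qed
      have W: "wd N (mixed_entries p (wishart_entry M N z)) [(Inr r, False)] a y = wishart_entry M N z r a y" for z
      proof -
        have "wd N (mixed_entries p (wishart_entry M N z)) [(Inr r, False)] a y =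
            (\<Sum>k<N. wishart_entry M N z r a k * (if k = y then 1 else 0))" by simp
        also have "\<dots> = (\<Sum>k<N. if k = y then wishart_entry M N z r a k else 0)"
          by (intro sum.cong refl) simp
        finally show ?thesis using y by simp
      qed
      have "(\<lambda>z. if fst l = Inr r \<and> x = c then wd N (mixed_entries p (wishart_entry M N z)) [(Inr r, False)] a y else 0) =
        (\<lambda>z. \<Sum>m<M. cnj (z (r, m, a)) * ?F m z)"
        unfolding F W by (auto simp: fun_eq_iff Inr wishart_entry_def sum_distrib_left intro!: sum.cong)
      moreover have "(\<lambda>z. mixed_entries p (wishart_entry M N z) l x y) = (\<lambda>z. ?n * (\<Sum>m<M. lv ((q, m, x), True) z * lv ((q, m, y), False) z))"
        by (subst l') (simp only: ent)
      ultimately show ?thesis using D by (intro exI[of _ ?F]) simp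
    qed
  next
    fix a c :: nat and F F'
    assume F: "poly_fun V F"
      and D: "wishart_deriv M r a c F F'"
    then obtain Fm where Fm: "\<And>m. Deriv V (wirt ((r, m, c), False)) F (Fm m)" "F' = (\<lambda>z. \<Sum>m<M. cnj (z (r, m, a)) * Fm m z)" by blast
    have pF: "poly_fun V (\<lambda>z. cnj (z (r, m, a)) * Fm m z)" for m
      by (intro poly_fun_mult poly_fun_cnj_z r Deriv_poly_fun(2)[OF Fm(1)])
    \<comment> \<open>Differentiating the partner \<open>cnj (z (r, m, a))\<close> gives the
      diagonal term; its \<open>M\<close> copies, scaled by \<open>1 / N\<close>, make up the
      coefficient \<open>M / N\<close>.\<close>
    have step: "Ex (\<lambda>z. lv ((r, m, c), False) z * (lv ((r, m, a), True) z * F z)) =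
       (if a = c then Ex F else 0) + Ex (\<lambda>z. cnj (z (r, m, a)) * Fm m z)" for m
    proof -
      have "Deriv V (wirt ((r, m, c), False)) (\<lambda>z. lv ((r, m, a), True) z * F z)
        (\<lambda>z. (if ((r, m, a), True) = (fst ((r, m, c), False), \<not> snd ((r, m, c), False)) then 1 else 0) * F z + lv ((r, m, a), True) z * Fm m z)"
        by (intro Deriv_mult Deriv_lv Fm) (use r in auto)
      then have "Ex (\<lambda>z. lv ((r, m, c), False) z * (lv ((r, m, a), True) z * F z)) =
        Ex (\<lambda>z. (if a = c then 1 else 0) * F z + cnj (z (r, m, a)) * Fm m z)"
        using gaussian_ibp[of "((r, m, c), False)"] r by (simp add: lv_def)
      also have "\<dots> = Ex (\<lambda>z. (if a = c then 1 else 0) * F z) + Ex (\<lambda>z. cnj (z (r, m, a)) * Fm m z)"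
        by (intro Ex_add poly_fun_mult poly_fun_const F pF)
      finally show ?thesis by (simp add: Ex_scale)
    qed
    have "Ex (\<lambda>z. mixed_entries p (wishart_entry M N z) (Inr r, b) a c * F z) =
       ?n * Ex (\<lambda>z. \<Sum>m<M. lv ((r, m, c), False) z * (lv ((r, m, a), True) z * F z))"
    proof -
      have e: "(\<Sum>m<M. lv ((r, m, a), True) z * lv ((r, m, c), False) z) * F z =
          (\<Sum>m<M. lv ((r, m, c), False) z * (lv ((r, m, a), True) z * F z))" for z
        unfolding sum_distrib_right by (intro sum.cong refl) (simp only: mult_ac)
      show ?thesis unfolding ent Ex_scale[symmetric] mult.assoc e ..
    qed
    also have "Ex (\<lambda>z. \<Sum>m<M. lv ((r, m, c), False) z * (lv ((r, m, a), True) z * F z)) =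
       (\<Sum>m<M. Ex (\<lambda>z. lv ((r, m, c), False) z * (lv ((r, m, a), True) z * F z)))"
      by (intro Ex_sum poly_fun_mult poly_fun_lv F) (use r in auto)
    also have "\<dots> = of_nat M * (if a = c then Ex F else 0) + Ex F'"
      unfolding step Fm(2) sum.distrib using pF by (simp add: Ex_sum)
    also have "?n * (of_nat M * (if a = c then Ex F else 0) + Ex F') =
       (if a = c then complex_of_real (real M / real N) * Ex F else 0) + Ex F' / of_nat N"
      by (simp add: add_divide_distrib)
    finally show "Ex (\<lambda>z. mixed_entries p (wishart_entry M N z) (Inr r, b) a c * F z) =
       (if a = c then complex_of_real (real M / real N) * Ex F else 0) + Ex F' / of_nat N" .
  next
    fix a c :: nat and F F' G G'
    assume "wishart_deriv M r a c F F'"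
      "wishart_deriv M r a c G G'"
    then obtain Fm Gm where Fm: "\<And>m. Deriv V (wirt ((r, m, c), False)) F (Fm m)" "F' = (\<lambda>z. \<Sum>m<M. cnj (z (r, m, a)) * Fm m z)"
      and Gm: "\<And>m. Deriv V (wirt ((r, m, c), False)) G (Gm m)" "G' = (\<lambda>z. \<Sum>m<M. cnj (z (r, m, a)) * Gm m z)" by blast
    show "wishart_deriv M r a c (\<lambda>z. F z + G z) (\<lambda>z. F' z + G' z)"
      using Deriv_add[OF Fm(1) Gm(1)]
      by (intro exI[of _ "\<lambda>m z. Fm m z + Gm m z"]) (simp add: Fm(2) Gm(2) distrib_left sum.distrib)
    show "wishart_deriv M r a c (\<lambda>z. F z * G z) (\<lambda>z. F' z * G z + F z * G' z)"
      using Deriv_mult[OF Fm(1) Gm(1)]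
      by (intro exI[of _ "\<lambda>m z. Fm m z * G z + F z * Gm m z"])
         (simp add: Fm(2) Gm(2) sum_distrib_left sum_distrib_right sum.distrib distrib_left mult_ac)
  next
    fix a c :: nat and k
    show "wishart_deriv M r a c (\<lambda>z. k) (\<lambda>z. 0)"
      by (intro exI[of _ "\<lambda>m z. 0"]) (simp add: Deriv_const)
  }
qed (use r poly_fun_wishart in \<open>auto intro: poly_fun_const poly_fun_add poly_fun_mult Ex_add simp: Ex_scale\<close>)

end

section \<open>Conditioning on the permutations\<close>

lemma mat_adjoint_index:
  assumes "i < dim_col A" "j < dim_row A"
  shows "mat_adjoint A $$ (i, j) = cnj (A $$ (j, i :: nat) :: complex)"
  using assms by (simp add: mat_adjoint_def mat_of_rows_def)

lemma mat_adjoint_dim: "mat_adjoint A \<in> carrier_mat (dim_col A) (dim_row A)"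
  by (simp add: mat_adjoint_def mat_of_rows_def)

lemma eval_monomial_mat_index:
  assumes "\<And>l. l \<in> set \<alpha> \<Longrightarrow> X (fst l) \<in> carrier_mat N N"
  shows "eval_monomial_mat N X \<alpha> \<in> carrier_mat N N \<and> (\<forall>i<N. \<forall>j<N. eval_monomial_mat N X \<alpha> $$ (i, j) =
    wd N (\<lambda>l x y. if snd l then cnj (X (fst l) $$ (y, x)) else X (fst l) $$ (x, y)) \<alpha> i j)"
  using assms
proof (induction \<alpha>)
  case Nil
  then show ?case by (simp add: eval_monomial_mat_def)
next
  case (Cons l \<alpha>)
  let ?A = "if snd l then mat_adjoint (X (fst l)) else X (fst l)"
  let ?E = "eval_monomial_mat N X \<alpha>"
  have X: "X (fst l) \<in> carrier_mat N N" using Cons.prems by simp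
  have A: "?A \<in> carrier_mat N N" using X mat_adjoint_dim[of "X (fst l)"] by auto
  have Aij: "?A $$ (i, j) = (if snd l then cnj (X (fst l) $$ (j, i)) else X (fst l) $$ (i, j))" if "i < N" "j < N" for i j
    using X that by (auto simp: mat_adjoint_index)
  have IH: "?E \<in> carrier_mat N N" "\<And>i j. i < N \<Longrightarrow> j < N \<Longrightarrow> ?E $$ (i, j) =
    wd N (\<lambda>l x y. if snd l then cnj (X (fst l) $$ (y, x)) else X (fst l) $$ (x, y)) \<alpha> i j"
    using Cons by auto
  have e: "eval_monomial_mat N X (l # \<alpha>) = ?A * ?E"
    by (simp add: eval_monomial_mat_def case_prod_unfold)
  have "(?A * ?E) $$ (i, j) = (\<Sum>k<N. ?A $$ (i, k) * ?E $$ (k, j))" if "i < N" "j < N" for i j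
    using that A IH(1) by (auto simp: scalar_prod_def atLeast0LessThan intro!: sum.cong)
  then show ?case unfolding e using A IH Aij by auto
qed

lemma normalized_trace_eval:
  assumes "\<And>l. l \<in> set \<alpha> \<Longrightarrow> X (fst l) \<in> carrier_mat N N"
  shows "normalized_trace (eval_monomial_mat N X \<alpha>) =
    trw N (\<lambda>l x y. if snd l then cnj (X (fst l) $$ (y, x)) else X (fst l) $$ (x, y)) \<alpha>"
  using eval_monomial_mat_index[of \<alpha> X N, OF assms] by (auto simp: normalized_trace_def trw_def)

section \<open>Measurability of matrix words, and permutation matrices\<close>

lemma space_mat_borel: "space (mat_borel m n) = carrier_mat m n"
  by (simp add: mat_borel_def)

lemma measurable_mat_entry:
  assumes "i < m" "j < n"
  shows "(\<lambda>A. A $$ (i, j)) \<in> borel_measurable (mat_borel m n)"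
proof -
  have "(\<lambda>A. \<lambda>ij \<in> {..<m} \<times> {..<n}. A $$ ij) \<in> measurable (mat_borel m n) (\<Pi>\<^sub>M ij \<in> {..<m} \<times> {..<n}. borel)"
    unfolding mat_borel_def by (rule measurable_vimage_algebra1) (auto simp: space_PiM)
  from measurable_compose[OF this measurable_component_singleton[of "(i, j)"]] assms
  show ?thesis by simp
qed

lemma borel_measurable_wd:
  assumes "\<And>l x y. l \<in> set w \<Longrightarrow> x < N \<Longrightarrow> y < N \<Longrightarrow> (\<lambda>Y. A Y l x y) \<in> borel_measurable Q"
    and "i < N" "j < N"
  shows "(\<lambda>Y. wd N (A Y) w i j) \<in> borel_measurable Q"
  using assms
proof (induction w arbitrary: i)
  case (Cons l w)
  show ?case unfolding wd.simps
    by (intro borel_measurable_sum borel_measurable_times Cons) (use Cons.prems in auto)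
qed simp

lemma borel_measurable_trw:
  assumes "\<And>l x y. l \<in> set w \<Longrightarrow> x < N \<Longrightarrow> y < N \<Longrightarrow> (\<lambda>Y. A Y l x y) \<in> borel_measurable Q"
  shows "(\<lambda>Y. trw N (A Y) w) \<in> borel_measurable Q"
  unfolding trw_def
  by (intro borel_measurable_divide borel_measurable_sum borel_measurable_wd assms) auto

text \<open>The sigma-algebra is generated by the entries, so the indicator of a single matrix is
  written as a finite product of indicators for entries.\<close>

lemma measurable_mat_eq:
  assumes "B \<in> carrier_mat m n"
  shows "(\<lambda>A. if A = B then 1 else 0 :: complex) \<in> borel_measurable (mat_borel m n)"
proof -
  have eq: "(if A = B then 1 else 0 :: complex) = (\<Prod>i<m. \<Prod>j<n. if A $$ (i, j) = B $$ (i, j) then 1 else 0)"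
    if A: "A \<in> carrier_mat m n" for A
  proof (cases "A = B")
    case False
    then obtain i j where ij: "i < m" "j < n" "A $$ (i, j) \<noteq> B $$ (i, j)"
      using A assms by (metis carrier_matD eq_matI)
    then have "(\<Prod>j<n. if A $$ (i, j) = B $$ (i, j) then 1 else 0 :: complex) = 0" by (intro prod_zero) auto
    then have "(\<Prod>i<m. \<Prod>j<n. if A $$ (i, j) = B $$ (i, j) then 1 else 0 :: complex) = 0" using ij by (intro prod_zero) auto
    then show ?thesis using False by simp
  qed simp
  have "(\<lambda>A. \<Prod>i<m. \<Prod>j<n. if A $$ (i, j) = B $$ (i, j) then 1 else 0 :: complex) \<in> borel_measurable (mat_borel m n)"
  proof (intro borel_measurable_prod)
    fix i j assume "i \<in> {..<m}" "j \<in> {..<n}"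
    then have "(\<lambda>A. A $$ (i, j)) \<in> borel_measurable (mat_borel m n)" by (intro measurable_mat_entry) auto
    then show "(\<lambda>A. if A $$ (i, j) = B $$ (i, j) then 1 else 0 :: complex) \<in> borel_measurable (mat_borel m n)"
      by (rule measurable_compose[where g="\<lambda>x. if x = B $$ (i, j) then 1 else 0"]) measurable
  qed
  then show ?thesis using eq by (subst measurable_cong) (auto simp: space_mat_borel)
qed

lemma permutation_mat_carrier: "permutation_mat N p \<in> carrier_mat N N"
  by (simp add: permutation_mat_def)

lemma permutation_mat_inj:
  assumes "p permutes {..<N}" "q permutes {..<N}" "permutation_mat N p = permutation_mat N q"
  shows "p = q"
proof
  fix j
  show "p j = q j"
  proof (cases "j < N")
    case True
    then have "p j < N" using permutes_in_image[OF assms(1), of j] by simp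
    have "permutation_mat N p $$ (p j, j) = permutation_mat N q $$ (p j, j)" using assms(3) by simp
    then show ?thesis using True \<open>p j < N\<close> by (simp add: permutation_mat_def split: if_splits)
  next
    case False
    then show ?thesis using assms(1,2) by (simp add: permutes_def)
  qed
qed

text \<open>The adjoint of a permutation matrix is the matrix of the inverse permutation.\<close>

lemma permutation_mat_entry:
  assumes "p i permutes {..<N}" "x < N" "y < N"
  shows "(if b then cnj (permutation_mat N (p i) $$ (y, x)) else permutation_mat N (p i) $$ (x, y)) =
    (if x = act p (i, b) y then 1 else 0)"
proof -
  have "y = p i x \<longleftrightarrow> x = inv_into UNIV (p i) y" using permutes_inverses[OF assms(1)] by metis
  then show ?thesis using assms by (auto simp: permutation_mat_def act_def)
qed

lemma card_permutation_mats: "card (permutation_mats N) = card {p. p permutes {..<N}}"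
  unfolding permutation_mats_def
  by (rule card_image) (auto intro!: inj_onI permutation_mat_inj)

lemma finite_permutation_mats: "finite (permutation_mats N)"
  unfolding permutation_mats_def by (intro finite_imageI finite_permutations) auto

lemma (in prob_space) uniform_permutation_mat_prob:
  assumes "uniform_permutation_mat M N X" "p permutes {..<N}"
  shows "prob {\<omega> \<in> space M. X \<omega> = permutation_mat N p} = 1 / card {p. p permutes {..<N}}"
proof -
  let ?S = "count_space (permutation_mats N)"
  have X: "X \<in> measurable M ?S" and d: "distr M ?S X = uniform_count_measure (permutation_mats N)"
    using assms(1) by (auto simp: uniform_permutation_mat_def)
  have p: "permutation_mat N p \<in> permutation_mats N" using assms(2) by (auto simp: permutation_mats_def)
  have "prob {\<omega> \<in> space M. X \<omega> = permutation_mat N p} = prob (X -` {permutation_mat N p} \<inter> space M)"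
    by (intro arg_cong[where f=prob]) auto
  also have "\<dots> = measure (distr M ?S X) {permutation_mat N p}"
    using p by (intro measure_distr[symmetric] X) auto
  also have "\<dots> = 1 / card (permutation_mats N)"
    unfolding d using p by (subst measure_uniform_count_measure) (auto simp: finite_permutation_mats)
  finally show ?thesis by (simp add: card_permutation_mats)
qed

text \<open>
  Only the joint independence of the \<open>U\<close>'s and of the matrices \<open>X r\<close> is used, so that this applies to
  Wishart matrices, which need not determine the underlying Gaussian variables.
\<close>

lemma (in prob_space) expectation_condition_permutations:
  fixes UM X :: "nat \<Rightarrow> 'a \<Rightarrow> complex mat" and \<alpha> :: "letter list" and s N :: nat
  defines "R \<equiv> Inl ` {1..s} :: (nat + nat) set"
  defines "h \<equiv> \<lambda>p \<omega>. trw N (mixed_entries p (\<lambda>r x y. X r \<omega> $$ (x, y))) \<alpha>"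
  assumes N: "N \<ge> 1"
    and U: "\<And>r. r \<in> {1..s} \<Longrightarrow> uniform_permutation_mat M N (UM r)"
    and indep: "indep_vars (\<lambda>_. mat_borel N N) (case_sum UM X) ({1..s} <+> {1..s})"
    and carrier: "\<And>r \<omega>. X r \<omega> \<in> carrier_mat N N"
    and \<alpha>: "fst ` set \<alpha> \<subseteq> {1..s} <+> {1..s}"
    and int: "\<And>p. integrable M (h p)"
  shows "integrable M (\<lambda>\<omega>. normalized_trace (eval_monomial_mat N (\<lambda>i. case_sum UM X i \<omega>) \<alpha>))"
    and "expectation (\<lambda>\<omega>. normalized_trace (eval_monomial_mat N (\<lambda>i. case_sum UM X i \<omega>) \<alpha>)) =
      perm_avg N R (\<lambda>p. expectation (h p))"
proof -
  let ?Q = "perm_tuples N R :: (nat + nat \<Rightarrow> nat \<Rightarrow> nat) set"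
  let ?Z = "case_sum UM X"
  let ?T = "\<lambda>\<omega>. normalized_trace (eval_monomial_mat N (\<lambda>i. ?Z i \<omega>) \<alpha>)"
  let ?BU = "Pi\<^sub>M R (\<lambda>_. mat_borel N N)" and ?BX = "Pi\<^sub>M (Inr ` {1..s}) (\<lambda>_. mat_borel N N)"
  \<comment> \<open>\<open>k p\<close> indicates that the random permutations form the tuple
    \<open>p\<close>. The maps \<open>j\<close> and \<open>g\<close> express \<open>k\<close> and
    \<open>h\<close> through the two groups of matrices, so that joint independence makes
    \<open>k p\<close> and \<open>h p\<close> independent.\<close>
  define k :: "(nat + nat \<Rightarrow> nat \<Rightarrow> nat) \<Rightarrow> 'a \<Rightarrow> complex"
    where "k p \<omega> = (\<Prod>i\<in>R. if ?Z i \<omega> = permutation_mat N (p i) then 1 else 0)" for p \<omega>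
  define g :: "(nat + nat \<Rightarrow> nat \<Rightarrow> nat) \<Rightarrow> (nat + nat \<Rightarrow> complex mat) \<Rightarrow> complex"
    where "g p Y = trw N (mixed_entries p (\<lambda>r x y. Y (Inr r) $$ (x, y))) \<alpha>" for p Y
  define j :: "(nat + nat \<Rightarrow> nat \<Rightarrow> nat) \<Rightarrow> (nat + nat \<Rightarrow> complex mat) \<Rightarrow> complex"
    where "j p Y = (\<Prod>i\<in>R. if Y i = permutation_mat N (p i) then 1 else 0)" for p Y
  have finR: "finite R" by (simp add: R_def)
  have finQ: "finite ?Q" using finR by auto
  have RI: "R \<subseteq> {1..s} <+> {1..s}" "Inr ` {1..s} \<subseteq> {1..s} <+> {1..s}" "R \<inter> Inr ` {1..s} = {}"
    by (auto simp: R_def)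
  have idx: "r \<in> {1..s}" if "l \<in> set \<alpha>" "fst l = Inr r" for l r
  proof -
    have "fst l \<in> {1..s} <+> {1..s}" using \<alpha> that(1) by blast
    then show ?thesis using that(2) by auto
  qed
  have gm: "g p \<in> borel_measurable ?BX" for p
    unfolding g_def
  proof (rule borel_measurable_trw)
    fix l x y assume l: "l \<in> set \<alpha>" "x < N" "y < N"
    show "(\<lambda>Y. mixed_entries p (\<lambda>r x y. Y (Inr r) $$ (x, y)) l x y) \<in> borel_measurable ?BX"
    proof (cases "fst l")
      case (Inl r)
      then show ?thesis by (simp add: mixed_entries_def)
    next
      case (Inr r)
      then have "Inr r \<in> Inr ` {1..s}" using idx l by auto
      then have c: "(\<lambda>Y. Y (Inr r)) \<in> measurable ?BX (mat_borel N N)"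
        by (rule measurable_component_singleton)
      have "(\<lambda>Y. Y (Inr r) $$ (x, y)) \<in> borel_measurable ?BX"
        "(\<lambda>Y. Y (Inr r) $$ (y, x)) \<in> borel_measurable ?BX"
        using measurable_compose[OF c measurable_mat_entry] l by auto
      moreover from this(2) have "(\<lambda>Y. cnj (Y (Inr r) $$ (y, x))) \<in> borel_measurable ?BX"
        by (rule measurable_compose) (intro borel_measurable_continuous_onI continuous_intros)
      ultimately show ?thesis using Inr by (cases "snd l") (simp_all add: mixed_entries_def)
    qed
  qed
  have jm: "j p \<in> borel_measurable ?BU" for p
    unfolding j_def
  proof (rule borel_measurable_prod)
    fix i assume "i \<in> R"
    then have "(\<lambda>Y. Y i) \<in> measurable ?BU (mat_borel N N)"
      by (rule measurable_component_singleton)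
    from measurable_compose[OF this measurable_mat_eq[OF permutation_mat_carrier]]
    show "(\<lambda>Y. if Y i = permutation_mat N (p i) then 1 else 0 :: complex) \<in> borel_measurable ?BU" .
  qed
  have kh: "indep_var borel (k p) borel (h p)" for p
  proof -
    have "indep_var borel (j p \<circ> (\<lambda>\<omega>. \<lambda>i\<in>R. ?Z i \<omega>)) borel (g p \<circ> (\<lambda>\<omega>. \<lambda>i\<in>Inr ` {1..s}. ?Z i \<omega>))"
      by (rule indep_var_compose[OF indep_var_restrict[OF indep RI(3,1,2)] jm gm])
    moreover have "j p \<circ> (\<lambda>\<omega>. \<lambda>i\<in>R. ?Z i \<omega>) = k p"
      by (auto simp: fun_eq_iff j_def k_def intro!: prod.cong)
    moreover have "g p \<circ> (\<lambda>\<omega>. \<lambda>i\<in>Inr ` {1..s}. ?Z i \<omega>) = h p"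
    proof (rule ext)
      fix \<omega>
      show "(g p \<circ> (\<lambda>\<omega>. \<lambda>i\<in>Inr ` {1..s}. ?Z i \<omega>)) \<omega> = h p \<omega>"
        unfolding o_def g_def h_def
      proof (rule trw_cong)
        fix l x y assume l: "l \<in> set \<alpha>"
        show "mixed_entries p (\<lambda>r x y. (\<lambda>i\<in>Inr ` {1..s}. ?Z i \<omega>) (Inr r) $$ (x, y)) l x y =
           mixed_entries p (\<lambda>r x y. X r \<omega> $$ (x, y)) l x y"
          using idx[OF l] by (cases "fst l") (auto simp: mixed_entries_def)
      qed
    qed
    ultimately show ?thesis by simp
  qed
  have ki: "indep_vars (\<lambda>_. borel) (\<lambda>i \<omega>. if ?Z i \<omega> = permutation_mat N (p i) then 1 else 0 :: complex) R" for p
    by (rule indep_vars_compose2[OF indep_vars_subset[OF indep RI(1)]]) (rule measurable_mat_eq[OF permutation_mat_carrier])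
  have Zm: "?Z i \<in> measurable M (mat_borel N N)" if "i \<in> R" for i
    using indep that RI(1) unfolding indep_vars_def by auto
  have Zset: "{\<omega> \<in> space M. ?Z i \<omega> = permutation_mat N q} \<in> events" if "i \<in> R" for i q
  proof -
    have "(\<lambda>\<omega>. if ?Z i \<omega> = permutation_mat N q then 1 else 0 :: complex) \<in> borel_measurable M"
      using measurable_compose[OF Zm[OF that] measurable_mat_eq[OF permutation_mat_carrier]] .
    from measurable_sets[OF this, of "{1}"]
    have "(\<lambda>\<omega>. if ?Z i \<omega> = permutation_mat N q then 1 else 0 :: complex) -` {1} \<inter> space M \<in> events" by simp
    moreover have "(\<lambda>\<omega>. if ?Z i \<omega> = permutation_mat N q then 1 else 0 :: complex) -` {1} \<inter> space M =
       {\<omega> \<in> space M. ?Z i \<omega> = permutation_mat N q}" by (auto split: if_splits)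
    ultimately show ?thesis by simp
  qed
  have k1i: "integrable M (\<lambda>\<omega>. if ?Z i \<omega> = permutation_mat N q then 1 else 0 :: complex)" if "i \<in> R" for i q
  proof (rule integrable_const_bound[where B=1])
    show "(\<lambda>\<omega>. if ?Z i \<omega> = permutation_mat N q then 1 else 0 :: complex) \<in> borel_measurable M"
      using measurable_compose[OF Zm[OF that] measurable_mat_eq[OF permutation_mat_carrier]] .
  qed auto
  have k1: "expectation (\<lambda>\<omega>. if ?Z i \<omega> = permutation_mat N (p i) then 1 else 0 :: complex) =
     1 / of_nat (card {q. q permutes {..<N}})" if i: "i \<in> R" and p: "p \<in> ?Q" for i p
  proof -
    let ?E = "{\<omega> \<in> space M. ?Z i \<omega> = permutation_mat N (p i)}"
    have "expectation (\<lambda>\<omega>. if ?Z i \<omega> = permutation_mat N (p i) then 1 else 0 :: complex) =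
       expectation (\<lambda>\<omega>. complex_of_real (indicator ?E \<omega>))"
      by (intro Bochner_Integration.integral_cong refl) (auto simp: indicator_def)
    also have "\<dots> = complex_of_real (prob ?E)"
      using Zset[OF i, of "p i"] by (simp only: integral_complex_of_real) (simp add: integral_indicator)
    also have "prob ?E = 1 / card {q. q permutes {..<N}}"
    proof -
      obtain r where r: "r \<in> {1..s}" "i = Inl r" using i by (auto simp: R_def)
      have "p i permutes {..<N}" using perm_tuples_permutes[OF p i] .
      then show ?thesis using uniform_permutation_mat_prob[OF U[OF r(1)]] r(2) by simp
    qed
    finally show ?thesis by simp
  qed
  have kint: "integrable M (k p)" for p
    unfolding k_def by (rule indep_vars_integrable[OF finR ki]) (rule k1i)
  have kE: "expectation (k p) = 1 / of_nat (card ?Q)" if p: "p \<in> ?Q" for p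
  proof -
    have "expectation (k p) = (\<Prod>i\<in>R. expectation (\<lambda>\<omega>. if ?Z i \<omega> = permutation_mat N (p i) then 1 else 0 :: complex))"
      unfolding k_def by (rule indep_vars_lebesgue_integral[OF finR ki]) (rule k1i)
    also have "\<dots> = (\<Prod>i\<in>R. 1 / of_nat (card {q. q permutes {..<N}}))"
      using k1[OF _ p] by (intro prod.cong) auto
    also have "\<dots> = 1 / of_nat (card ?Q)"
      unfolding perm_tuples_def by (simp add: card_PiE[OF finR] power_one_over)
    finally show ?thesis .
  qed
  have khint: "integrable M (\<lambda>\<omega>. k p \<omega> * h p \<omega>)" for p
    by (rule indep_var_integrable[OF kh kint int])
  have khE: "expectation (\<lambda>\<omega>. k p \<omega> * h p \<omega>) = expectation (h p) / of_nat (card ?Q)" if "p \<in> ?Q" for p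
    unfolding indep_var_lebesgue_integral[OF kh kint int] kE[OF that] by simp
  \<comment> \<open>Exactly one tuple \<open>p\<close> has \<open>k p \<omega> = 1\<close>, and for
    it \<open>h p \<omega>\<close> is the trace of the actual matrices.\<close>
  have decomp: "?T \<omega> = (\<Sum>p\<in>?Q. k p \<omega> * h p \<omega>)"
    if \<omega>: "\<omega> \<in> space M" for \<omega>
  proof -
    have "\<exists>q. q permutes {..<N} \<and> ?Z i \<omega> = permutation_mat N q" if i: "i \<in> R" for i
    proof -
      obtain r where r: "r \<in> {1..s}" "i = Inl r" using i by (auto simp: R_def)
      have "UM r \<in> measurable M (count_space (permutation_mats N))" using U[OF r(1)] by (simp add: uniform_permutation_mat_def)
      from measurable_space[OF this \<omega>] show ?thesis using r by (auto simp: permutation_mats_def)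
    qed
    then have "\<forall>i\<in>R. \<exists>q. q permutes {..<N} \<and> ?Z i \<omega> = permutation_mat N q" by blast
    from bchoice[OF this] obtain q where q: "\<forall>i\<in>R. q i permutes {..<N} \<and> ?Z i \<omega> = permutation_mat N (q i)" ..
    define p where "p = restrict q R"
    have p: "p \<in> ?Q" using q by (auto simp: p_def perm_tuples_def)
    have Zp: "?Z i \<omega> = permutation_mat N (p i)" if "i \<in> R" for i using q that by (simp add: p_def)
    have kp: "k p' \<omega> = (if p' = p then 1 else 0)" if p': "p' \<in> ?Q" for p'
    proof (cases "p' = p")
      case True
      then show ?thesis using Zp by (simp add: k_def)
    next
      case False
      then obtain i where i: "i \<in> R" "p' i \<noteq> p i"
        using p p' unfolding perm_tuples_def by (metis PiE_ext)
      then have "?Z i \<omega> \<noteq> permutation_mat N (p' i)"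
        using permutation_mat_inj[OF perm_tuples_permutes[OF p' i(1)] perm_tuples_permutes[OF p i(1)]] Zp[OF i(1)] by auto
      then have "k p' \<omega> = 0" unfolding k_def by (intro prod_zero finR) (use i in auto)
      then show ?thesis using False by simp
    qed
    have "(\<Sum>p'\<in>?Q. k p' \<omega> * h p' \<omega>) = (\<Sum>p'\<in>?Q. if p' = p then h p' \<omega> else 0)"
      by (intro sum.cong refl) (simp add: kp)
    also have "\<dots> = h p \<omega>" using p finQ by simp
    also have "\<dots> = ?T \<omega>"
    proof (subst normalized_trace_eval)
      fix l assume l: "l \<in> set \<alpha>"
      show "?Z (fst l) \<omega> \<in> carrier_mat N N"
      proof (cases "fst l")
        case (Inl r)
        then have "fst l \<in> R" using \<alpha> l by (auto simp: R_def)
        then show ?thesis using Zp permutation_mat_carrier by simp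
      qed (simp add: carrier)
    next
      show "h p \<omega> = trw N (\<lambda>l x y. if snd l then cnj (?Z (fst l) \<omega> $$ (y, x)) else ?Z (fst l) \<omega> $$ (x, y)) \<alpha>"
        unfolding h_def
      proof (rule trw_cong)
        fix l x y assume l: "l \<in> set \<alpha>" "x < N" "y < N"
        show "mixed_entries p (\<lambda>r x y. X r \<omega> $$ (x, y)) l x y =
           (if snd l then cnj (?Z (fst l) \<omega> $$ (y, x)) else ?Z (fst l) \<omega> $$ (x, y))"
        proof (cases "fst l")
          case (Inl r)
          then have "fst l \<in> R" using \<alpha> l by (auto simp: R_def)
          then have z: "?Z (fst l) \<omega> = permutation_mat N (p (fst l))" "p (fst l) permutes {..<N}"
            using Zp perm_tuples_permutes[OF p] by blast+
          have "mixed_entries p (\<lambda>r x y. X r \<omega> $$ (x, y)) l x y = (if x = act p l y then 1 else 0)"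
            by (simp add: mixed_entries_def Inl)
          then show ?thesis unfolding z(1) permutation_mat_entry[of p "fst l", OF z(2) l(2,3)] by simp
        next
          case (Inr r)
          then show ?thesis by (simp add: mixed_entries_def)
        qed
      qed
    qed
    finally show ?thesis by simp
  qed
  show "integrable M ?T"
    by (subst Bochner_Integration.integrable_cong[OF refl decomp]) (auto intro: khint)
  have "expectation ?T = expectation (\<lambda>\<omega>. \<Sum>p\<in>?Q. k p \<omega> * h p \<omega>)"
    by (rule Bochner_Integration.integral_cong[OF refl decomp])
  also have "\<dots> = (\<Sum>p\<in>?Q. expectation (\<lambda>\<omega>. k p \<omega> * h p \<omega>))"
    by (rule Bochner_Integration.integral_sum) (rule khint)
  also have "\<dots> = perm_avg N R (\<lambda>p. expectation (h p))"
    by (simp add: khE perm_avg_def sum_divide_distrib)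
  finally show "expectation ?T = perm_avg N R (\<lambda>p. expectation (h p))" .
qed

section \<open>Limits of mixed moments\<close>

lemma perm_avg_cong: "(\<And>p. p \<in> perm_tuples N R \<Longrightarrow> F p = G p) \<Longrightarrow> perm_avg N R F = perm_avg N R G"
  by (simp add: perm_avg_def)

lemma perm_avg_add: "perm_avg N R (\<lambda>p. F p + G p) = perm_avg N R F + perm_avg N R G"
  by (simp add: perm_avg_def sum.distrib add_divide_distrib)

lemma perm_avg_scale: "perm_avg N R (\<lambda>p. c * F p) = c * perm_avg N R F"
  by (simp add: perm_avg_def sum_distrib_left[symmetric])

lemma perm_avg_sum: "perm_avg N R (\<lambda>p. \<Sum>k\<in>K. F k p) = (\<Sum>k\<in>K. perm_avg N R (F k))"
  by (simp add: perm_avg_def sum_divide_distrib[symmetric] sum.swap[of _ "perm_tuples N R"])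

lemma perm_avg_if: "perm_avg N R (\<lambda>p. if c then F p else 0) = (if c then perm_avg N R F else 0)"
  by (simp add: perm_avg_def)

lemmas perm_avg_linear = perm_avg_add perm_avg_scale perm_avg_sum perm_avg_if

lemma letters_eq: "{1..s} <+> {1..s} = Inl ` {1..s} \<union> (Inr ` {1..s} :: (nat + nat) set)"
  by auto

context gaussian_matrices
begin

text \<open>The equations hold for each fixed tuple of permutations, with coefficients that do not
  depend on the tuple, and are linear in the moments; hence they survive the average over all
  tuples.\<close>

lemma mixed_limit:
  fixes X :: "nat \<Rightarrow> (nat \<times> nat \<times> nat \<Rightarrow> complex) \<Rightarrow> nat \<Rightarrow> nat \<Rightarrow> nat \<Rightarrow> complex"
    and m :: "letter list \<Rightarrow> complex" and d :: "nat \<Rightarrow> complex" and Nq :: "nat \<Rightarrow> nat"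
    and ok :: "letter \<Rightarrow> letter \<Rightarrow> bool" and tw :: "nat + nat \<Rightarrow> letter list"
  defines "R \<equiv> Inl ` {1..s}" and "J \<equiv> Inr ` {1..s}"
  assumes ibp: "\<And>q p l. fst l \<in> J \<Longrightarrow>
      \<exists>Dr. matrix_ibp Ex (poly_fun V) Dr (\<lambda>z. mixed_entries p (X q z)) (Nq q) letters l (ok l) (d q) (tw (fst l))"
    and Nq: "filterlim Nq at_top sequentially"
    and base: "\<And>ws. (\<And>w. w \<in> set ws \<Longrightarrow> fst ` set w \<subseteq> R) \<Longrightarrow>
      (\<lambda>N. perm_avg N R (fixed_prod N ws)) \<longlonglongrightarrow> (\<Prod>w\<leftarrow>ws. m w)"
    and m_rotate: "\<And>u v. m (u @ v) = m (v @ u)"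
    and m_rec: "\<And>l w. fst l \<in> J \<Longrightarrow> fst ` set w \<subseteq> R \<union> J \<Longrightarrow> m (l # w) = d' * m w
         + (\<Sum>k<length w. if ok l (w ! k) then m (take k w) * m (tw (fst l) @ drop (Suc k) w) else 0)"
    and d: "d \<longlonglongrightarrow> d'"
    and ok: "\<And>l l'. fst l \<in> J \<Longrightarrow> ok l l' \<Longrightarrow> fst l' = fst l"
    and tw: "\<And>i. i \<in> J \<Longrightarrow> length (tw i) \<le> 1 \<and> fst ` set (tw i) \<subseteq> {i}"
    and \<alpha>: "fst ` set \<alpha> \<subseteq> R \<union> J"
  shows "(\<lambda>q. perm_avg (Nq q) R (\<lambda>p. Ex (\<lambda>z. trw (Nq q) (mixed_entries p (X q z)) \<alpha>))) \<longlonglongrightarrow> m \<alpha>"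
proof -
  let ?tr = "\<lambda>q p z. trw (Nq q) (mixed_entries p (X q z))"
  define e where "e q ws = perm_avg (Nq q) R (\<lambda>p. Ex (\<lambda>z. \<Prod>w\<leftarrow>ws. ?tr q p z w))" for q ws
  have lets: "{1..s} <+> {1..s} = R \<union> J" unfolding R_def J_def by (rule letters_eq)
  have "(\<lambda>q. e q [\<alpha>]) \<longlonglongrightarrow> (\<Prod>w\<leftarrow>[\<alpha>]. m w)"
  proof (rule schwinger_dyson_limit[where e=e and m=m and d=d and d'=d' and ok=ok and tw=tw and R=R and J=J
        and \<epsilon>="\<lambda>q. 1 / (of_nat (Nq q))\<^sup>2"])
    show "e q (us @ w # vs) = e q (w # us @ vs)" for q us w vs
      unfolding e_def by (simp add: mult.left_commute)
    show "e q ((u @ v) # ws) = e q ((v @ u) # ws)" for q u v ws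
      unfolding e_def by (simp add: trw_rotate)
    show "(\<lambda>q. e q ws) \<longlonglongrightarrow> (\<Prod>w\<leftarrow>ws. m w)" if ws: "\<And>w. w \<in> set ws \<Longrightarrow> fst ` set w \<subseteq> R" for ws
    proof -
      have "e q ws = perm_avg (Nq q) R (fixed_prod (Nq q) ws)" for q
        unfolding e_def
      proof (rule perm_avg_cong)
        fix p assume p: "p \<in> perm_tuples (Nq q) R"
        have "?tr q p z w = complex_of_real (fixed_frac (Nq q) p w)" if "w \<in> set ws" for w z
        proof (rule trw_perm[OF p ws[OF that]])
          fix l x y assume "l \<in> set w"
          then have "fst l \<in> R" using ws[OF that] by auto
          then show "mixed_entries p (X q z) l x y = (if x = act p l y then 1 else 0)"
            by (auto simp: R_def mixed_entries_def)
        qed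
        then have eq: "(\<Prod>w\<leftarrow>ws. ?tr q p z w) = fixed_prod (Nq q) ws p" for z
          by (intro arg_cong[where f=prod_list] map_cong refl)
        show "Ex (\<lambda>z. \<Prod>w\<leftarrow>ws. ?tr q p z w) = fixed_prod (Nq q) ws p"
          unfolding eq Ex_def by (simp add: prob_space)
      qed
      then show ?thesis using filterlim_compose[OF base[OF ws] Nq] by simp
    qed
    show "e q ((l # w) # ws) = d q * e q (w # ws)
         + (\<Sum>k<length w. if ok l (w ! k) then e q (take k w # (tw (fst l) @ drop (Suc k) w) # ws) else 0)
         + 1 / (of_nat (Nq q))\<^sup>2 * (\<Sum>j<length ws. \<Sum>k<length (ws ! j). if ok l (ws ! j ! k)
             then e q ((w @ tw (fst l) @ drop (Suc k) (ws ! j) @ take k (ws ! j)) # take j ws @ drop (Suc j) ws) else 0)"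
      if l: "fst l \<in> J" and ws: "\<And>w'. w' \<in> set (w # ws) \<Longrightarrow> fst ` set w' \<subseteq> R \<union> J" for q l w ws
      unfolding e_def perm_avg_linear[symmetric]
    proof (rule perm_avg_cong)
      fix p
      obtain Dr where "matrix_ibp Ex (poly_fun V) Dr (\<lambda>z. mixed_entries p (X q z)) (Nq q) letters l (ok l) (d q) (tw (fst l))"
        using ibp[OF l] by blast
      then interpret matrix_ibp Ex "poly_fun V" Dr "\<lambda>z. mixed_entries p (X q z)" "Nq q" letters l "ok l" "d q" "tw (fst l)" .
      have "set w' \<subseteq> letters" if "w' \<in> set (w # ws)" for w'
        using ws[OF that] lets by auto
      then show "Ex (\<lambda>z. \<Prod>w\<leftarrow>(l # w) # ws. ?tr q p z w) =
         d q * Ex (\<lambda>z. \<Prod>w\<leftarrow>w # ws. ?tr q p z w)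
         + (\<Sum>k<length w. if ok l (w ! k) then Ex (\<lambda>z. \<Prod>w\<leftarrow>take k w # (tw (fst l) @ drop (Suc k) w) # ws. ?tr q p z w) else 0)
         + 1 / (of_nat (Nq q))\<^sup>2 * (\<Sum>j<length ws. \<Sum>k<length (ws ! j). if ok l (ws ! j ! k)
             then Ex (\<lambda>z. \<Prod>w\<leftarrow>(w @ tw (fst l) @ drop (Suc k) (ws ! j) @ take k (ws ! j)) # take j ws @ drop (Suc j) ws.
               ?tr q p z w) else 0)"
        by (intro trace_recursion) auto
    qed
    show "(\<lambda>q. 1 / (of_nat (Nq q))\<^sup>2 :: complex) \<longlonglongrightarrow> 0"
    proof -
      have "(\<lambda>q. complex_of_real (1 / (real (Nq q))\<^sup>2)) \<longlonglongrightarrow> complex_of_real 0"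
      proof (intro tendsto_of_real)
        have "filterlim (\<lambda>q. real (Nq q)) at_top sequentially"
          by (rule filterlim_compose[OF filterlim_real_sequentially Nq])
        then have "(\<lambda>q. inverse (real (Nq q))) \<longlonglongrightarrow> 0"
          by (rule tendsto_inverse_0_at_top)
        from tendsto_power[OF this, of 2] show "(\<lambda>q. 1 / (real (Nq q))\<^sup>2) \<longlonglongrightarrow> 0"
          by (simp add: inverse_eq_divide power_one_over)
      qed
      then show ?thesis by simp
    qed
  qed (use m_rotate m_rec d ok tw \<alpha> in auto)
  then show ?thesis by (simp add: e_def)
qed

lemma integrable_trw:
  assumes "\<And>l x y. l \<in> letters \<Longrightarrow> poly_fun V (\<lambda>z. A z l x y)" "fst ` set \<alpha> \<subseteq> {1..s} <+> {1..s}"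
  shows "integrable P (\<lambda>\<omega>. trw N (A (\<lambda>(r, i, j). f r i j \<omega>)) \<alpha>)"
proof -
  have "poly_fun V (\<lambda>z. wd N (A z) w x y)" if "set w \<subseteq> letters" for w x y
    using that
    by (induction w arbitrary: x) (auto intro!: poly_fun_const poly_fun_sum poly_fun_mult assms(1) simp del: One_nat_def)
  moreover have "set \<alpha> \<subseteq> letters" using assms(2) by auto
  ultimately have "poly_fun V (\<lambda>z. trw N (A z) \<alpha>)"
    unfolding trw_def by (intro poly_fun_divide poly_fun_sum) auto
  from integrable_poly_fun[OF this] show ?thesis by (simp add: case_prod_unfold)
qed

lemma ginibre_mat_carrier: "ginibre_mat f N r \<omega> \<in> carrier_mat N N"
  by (simp add: ginibre_mat_def gaussian_mat_def)

lemma ginibre_mat_entry: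
  "x < N \<Longrightarrow> y < N \<Longrightarrow> ginibre_mat f N r \<omega> $$ (x, y) = ginibre_entry N (\<lambda>(r, i, j). f r i j \<omega>) r x y"
  by (simp add: ginibre_mat_def gaussian_mat_def ginibre_entry_def)

lemma wishart_mat_carrier: "wishart_mat f M N r \<omega> \<in> carrier_mat N N"
  using mat_adjoint_dim[of "gaussian_mat f M N r \<omega>"] by (auto simp: wishart_mat_def gaussian_mat_def)

lemma wishart_mat_entry:
  assumes "x < N" "y < N"
  shows "wishart_mat f M N r \<omega> $$ (x, y) = wishart_entry M N (\<lambda>(r, i, j). f r i j \<omega>) r x y"
proof -
  let ?G = "gaussian_mat f M N r \<omega>"
  have G: "?G \<in> carrier_mat M N" by (simp add: gaussian_mat_def)
  have A: "mat_adjoint ?G \<in> carrier_mat N M" using mat_adjoint_dim[of ?G] G by auto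
  have "(mat_adjoint ?G * ?G) $$ (x, y) = (\<Sum>m<M. mat_adjoint ?G $$ (x, m) * ?G $$ (m, y))"
    using assms A G by (auto simp: scalar_prod_def atLeast0LessThan intro!: sum.cong)
  also have "\<dots> = (\<Sum>m<M. cnj (f r m x \<omega>) * f r m y \<omega>)"
    using assms G by (intro sum.cong refl) (simp add: mat_adjoint_index, simp add: gaussian_mat_def)
  finally have "(mat_adjoint ?G * ?G) $$ (x, y) = (\<Sum>m<M. cnj (f r m x \<omega>) * f r m y \<omega>)" .
  then show ?thesis using assms A G by (simp add: wishart_mat_def wishart_entry_def)
qed

text \<open>Common to both models: polynomial entries give integrability for fixed permutations, and
  conditioning identifies the expected trace with the averaged moment whose limit is supplied by
  \<open>lim\<close>.\<close>

lemma matrix_model_limit: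
  fixes X :: "nat \<Rightarrow> nat \<Rightarrow> nat \<Rightarrow> 'w \<Rightarrow> complex mat"
    and XE :: "nat \<Rightarrow> nat \<Rightarrow> (nat \<times> nat \<times> nat \<Rightarrow> complex) \<Rightarrow> nat \<Rightarrow> nat \<Rightarrow> nat \<Rightarrow> complex"
    and UM :: "nat \<Rightarrow> nat \<Rightarrow> 'w \<Rightarrow> complex mat"
  assumes U: "\<And>N r. N \<ge> 1 \<Longrightarrow> r \<in> {1..s} \<Longrightarrow> uniform_permutation_mat P N (UM N r)"
    and indep: "\<And>M N. M \<ge> 1 \<Longrightarrow> N \<ge> 1 \<Longrightarrow> indep_vars (\<lambda>_. mat_borel N N) (case_sum (UM N) (X M N)) ({1..s} <+> {1..s})"
    and carrier: "\<And>M N r \<omega>. X M N r \<omega> \<in> carrier_mat N N"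
    and entry: "\<And>M N r \<omega> x y. x < N \<Longrightarrow> y < N \<Longrightarrow> X M N r \<omega> $$ (x, y) = XE M N (\<lambda>(r, i, j). f r i j \<omega>) r x y"
    and pol: "\<And>M N p l x y. l \<in> letters \<Longrightarrow> poly_fun V (\<lambda>z. mixed_entries p (XE M N z) l x y)"
    and lim: "\<And>Mq Nq \<alpha>. strict_mono Mq \<Longrightarrow> strict_mono Nq \<Longrightarrow> (\<And>q. Nq q \<ge> 1) \<Longrightarrow>
      (\<lambda>q. real (Mq q) / real (Nq q)) \<longlonglongrightarrow> c \<Longrightarrow> fst ` set \<alpha> \<subseteq> Inl ` {1..s} \<union> Inr ` {1..s} \<Longrightarrow>
      (\<lambda>q. perm_avg (Nq q) (Inl ` {1..s}) (\<lambda>p. Ex (\<lambda>z. trw (Nq q) (mixed_entries p (XE (Mq q) (Nq q) z)) \<alpha>))) \<longlonglongrightarrow> \<phi> (eval_monomial star x \<alpha>)"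
  shows "converges_in_star_distribution P c ({1..s} <+> {1..s}) (\<lambda>M N. case_sum (UM N) (X M N)) \<phi> star x"
  unfolding converges_in_star_distribution_def
proof (intro allI impI)
  fix Mq Nq :: "nat \<Rightarrow> nat" and \<alpha> :: "letter list"
  assume h: "strict_mono Mq \<and> strict_mono Nq \<and> (\<forall>q. 1 \<le> Mq q) \<and> (\<forall>q. 1 \<le> Nq q) \<and> (\<lambda>q. real (Mq q) / real (Nq q)) \<longlonglongrightarrow> c"
    and \<alpha>: "fst ` set \<alpha> \<subseteq> {1..s} <+> {1..s}"
  let ?T = "\<lambda>q \<omega>. normalized_trace (eval_monomial_mat (Nq q) (\<lambda>i. case_sum (UM (Nq q)) (X (Mq q) (Nq q)) i \<omega>) \<alpha>)"
  have eq: "trw N (mixed_entries p (\<lambda>r x y. X M N r \<omega> $$ (x, y))) \<alpha> = trw N (mixed_entries p (XE M N (\<lambda>(r, i, j). f r i j \<omega>))) \<alpha>"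
    for M N p \<omega>
    by (rule trw_cong) (auto simp: mixed_entries_def entry split: sum.split)
  have int: "integrable P (\<lambda>\<omega>. trw N (mixed_entries p (\<lambda>r x y. X M N r \<omega> $$ (x, y))) \<alpha>)" for M N p
    unfolding eq by (rule integrable_trw[OF pol \<alpha>])
  note ec = expectation_condition_permutations[OF _ U indep carrier \<alpha> int]
  have 1: "integrable P (?T q)" for q
    by (rule ec(1)) (use h in auto)
  have 2: "expectation (?T q) =
     perm_avg (Nq q) (Inl ` {1..s}) (\<lambda>p. Ex (\<lambda>z. trw (Nq q) (mixed_entries p (XE (Mq q) (Nq q) z)) \<alpha>))" for q
  proof -
    have "expectation (?T q) =
      perm_avg (Nq q) (Inl ` {1..s}) (\<lambda>p. expectation (\<lambda>\<omega>. trw (Nq q) (mixed_entries p (\<lambda>r x y. X (Mq q) (Nq q) r \<omega> $$ (x, y))) \<alpha>))"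
      by (rule ec(2)) (use h in auto)
    then show ?thesis unfolding eq Ex_def by (simp add: case_prod_unfold)
  qed
  show "(\<forall>q. integrable P (?T q)) \<and>
     (\<lambda>q. expectation (?T q))
       \<longlonglongrightarrow> \<phi> (eval_monomial star x \<alpha>)"
    using 1 unfolding 2 by (intro conjI allI lim) (use h \<alpha> letters_eq in auto)
qed

end

theorem theorem3p1:
  fixes P :: "'w measure" and s :: nat and c :: real
    and f :: "nat \<Rightarrow> nat \<Rightarrow> nat \<Rightarrow> 'w \<Rightarrow> complex"
    and UM :: "nat \<Rightarrow> nat \<Rightarrow> 'w \<Rightarrow> complex Matrix.mat"
    and cscale :: "complex \<Rightarrow> 'a::ring_1 \<Rightarrow> 'a" and \<phi> :: "'a \<Rightarrow> complex" and star :: "'a \<Rightarrow> 'a"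
    and U G W :: "nat \<Rightarrow> 'a"
  assumes s: "s \<ge> 1" and c: "c > 0"
    and P: "prob_space P"
    and f_indep: "prob_space.indep_vars P (\<lambda>_. borel) (\<lambda>(r, i, j). f r i j) ({1..s} \<times> UNIV)"
    and f_gaussian: "\<And>r i j. r \<in> {1..s} \<Longrightarrow> complex_standard_gaussian P (f r i j)"
    and UM_uniform: "\<And>N r. N \<ge> 1 \<Longrightarrow> r \<in> {1..s} \<Longrightarrow> uniform_permutation_mat P N (UM N r)"
    and UG_indep: "\<And>N. N \<ge> 1 \<Longrightarrow> prob_space.indep_vars P (\<lambda>_. mat_borel N N)
          (case_sum (UM N) (ginibre_mat f N)) ({1..s} <+> {1..s})"
    and UW_indep: "\<And>M N. M \<ge> 1 \<Longrightarrow> N \<ge> 1 \<Longrightarrow> prob_space.indep_vars P (\<lambda>_. mat_borel N N)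
          (case_sum (UM N) (wishart_mat f M N)) ({1..s} <+> {1..s})"
    and space: "nc_star_probability_space cscale \<phi> star"
    and U: "\<And>r. r \<in> {1..s} \<Longrightarrow> haar_unitary \<phi> star (U r)"
    and G: "\<And>r. r \<in> {1..s} \<Longrightarrow> standard_circular \<phi> star (G r)"
    and W: "\<And>r. r \<in> {1..s} \<Longrightarrow> free_poisson \<phi> star c (W r)"
    and UG_free: "star_free cscale \<phi> star ({1..s} <+> {1..s}) (case_sum U G)"
    and UW_free: "star_free cscale \<phi> star ({1..s} <+> {1..s}) (case_sum U W)"
  shows "converges_in_star_distribution P c ({1..s} <+> {1..s})
           (\<lambda>M N. case_sum (UM N) (ginibre_mat f N)) \<phi> star (case_sum U G) \<and>
         converges_in_star_distribution P c ({1..s} <+> {1..s})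
           (\<lambda>M N. case_sum (UM N) (wishart_mat f M N)) \<phi> star (case_sum U W) \<and>
         asymptotically_star_free P c ({1..s} <+> {1..s})
           (\<lambda>M N. case_sum (UM N) (ginibre_mat f N)) cscale \<phi> star \<and>
         asymptotically_star_free P c ({1..s} <+> {1..s})
           (\<lambda>M N. case_sum (UM N) (wishart_mat f M N)) cscale \<phi> star"
proof -
  interpret prob_space P by (rule P)
  interpret gaussian_matrices P f s
  proof
    show "indep_vars (\<lambda>_. borel) (\<lambda>(r, i, j). f r i j) ({1..s} \<times> UNIV)" by (rule f_indep)
    show "complex_standard_gaussian P (case v of (r, i, j) \<Rightarrow> f r i j)" if "v \<in> {1..s} \<times> UNIV" for v
      using that f_gaussian by auto
  qed
  interpret nc_star_probability_space cscale \<phi> star by (rule space)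
  interpret UG: star_free_family cscale \<phi> star "{1..s} <+> {1..s}" "case_sum U G"
    by unfold_locales (rule UG_free)
  interpret UW: star_free_family cscale \<phi> star "{1..s} <+> {1..s}" "case_sum U W"
    by unfold_locales (rule UW_free)
  have rotate: "\<phi> (eval_monomial star x (u @ v)) = \<phi> (eval_monomial star x (v @ u))" for x :: "nat + nat \<Rightarrow> 'a" and u v
    by (simp add: tracial)
  have inf: "filterlim Nq at_top sequentially" if "strict_mono Nq" for Nq :: "nat \<Rightarrow> nat"
    using that by (rule filterlim_subseq)
  have haar: "haar_unitary \<phi> star (case_sum U Y i)" if "i \<in> Inl ` {1..s}" for i and Y :: "nat \<Rightarrow> 'a"
    using that U by auto
  have 1: "converges_in_star_distribution P c ({1..s} <+> {1..s})
           (\<lambda>M N. case_sum (UM N) (ginibre_mat f N)) \<phi> star (case_sum U G)"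
  proof (rule matrix_model_limit[where X="\<lambda>M. ginibre_mat f" and XE="\<lambda>M. ginibre_entry"])
    show "indep_vars (\<lambda>_. mat_borel N N) (case_sum (UM N) (ginibre_mat f N)) ({1..s} <+> {1..s})" if "N \<ge> 1" for N
      by (rule UG_indep[OF that])
    fix Mq Nq :: "nat \<Rightarrow> nat" and \<alpha> :: "letter list"
    assume N: "strict_mono Nq" "\<And>q. Nq q \<ge> 1" and \<alpha>: "fst ` set \<alpha> \<subseteq> Inl ` {1..s} \<union> Inr ` {1..s}"
    let ?m = "\<lambda>w :: letter list. \<phi> (eval_monomial star (case_sum U G) w)"
    show "(\<lambda>q. perm_avg (Nq q) (Inl ` {1..s}) (\<lambda>p. Ex (\<lambda>z. trw (Nq q) (mixed_entries p (ginibre_entry (Nq q) z)) \<alpha>)))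
       \<longlonglongrightarrow> ?m \<alpha>"
    \<comment> \<open>A Ginibre letter has no diagonal term and vanishes together with the adjoint
      it is paired with.\<close>
    proof (rule mixed_limit[where d="\<lambda>_. 0" and d'=0 and ok="\<lambda>l l'. l' = (fst l, \<not> snd l)" and tw="\<lambda>_. []"
          and m="?m", OF _ inf[OF N(1)] _ rotate])
      fix q p and l :: letter assume "fst l \<in> Inr ` {1..s}"
      then obtain r b where r: "r \<in> {1..s}" and l: "l = (Inr r, b)" by (cases l) auto
      show "\<exists>Dr. matrix_ibp Ex (poly_fun V) Dr (\<lambda>z. mixed_entries p (ginibre_entry (Nq q) z)) (Nq q) letters l
          (\<lambda>l'. l' = (fst l, \<not> snd l)) 0 []"
        unfolding l fst_conv snd_conv by (rule exI) (rule ginibre_ibp[OF r N(2)])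
    next
      fix ws :: "letter list list" assume ws: "\<And>w. w \<in> set ws \<Longrightarrow> fst ` set w \<subseteq> Inl ` {1..s}"
      show "(\<lambda>N. perm_avg N (Inl ` {1..s}) (fixed_prod N ws)) \<longlonglongrightarrow> (\<Prod>w\<leftarrow>ws. ?m w)"
        by (rule UG.permutation_limit[OF _ _ haar ws]) auto
    next
      fix l :: letter and w :: "letter list"
      assume "fst l \<in> Inr ` {1..s}" and w: "fst ` set w \<subseteq> Inl ` {1..s} \<union> Inr ` {1..s}"
      then obtain r b where r: "r \<in> {1..s}" and l: "l = (Inr r, b)" by (cases l) auto
      have w': "fst ` set w \<subseteq> {1..s} <+> {1..s}" using w unfolding letters_eq .
      have I: "Inr r \<in> {1..s} <+> {1..s}" and circ: "standard_circular \<phi> star (case_sum U G (Inr r))" using r G by auto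
      show "?m (l # w) = 0 * ?m w +
        (\<Sum>k<length w. if w ! k = (fst l, \<not> snd l) then ?m (take k w) * ?m ([] @ drop (Suc k) w) else 0)"
        using UG.circular_schwinger_dyson[OF I circ w', of b] unfolding l fst_conv snd_conv append_Nil mult_zero_left add_0 .
    qed (use \<alpha> in auto)
  qed (fact UM_uniform ginibre_mat_carrier ginibre_mat_entry poly_fun_ginibre)+
  have 2: "converges_in_star_distribution P c ({1..s} <+> {1..s})
           (\<lambda>M N. case_sum (UM N) (wishart_mat f M N)) \<phi> star (case_sum U W)"
  proof (rule matrix_model_limit[where X="wishart_mat f" and XE=wishart_entry])
    fix Mq Nq :: "nat \<Rightarrow> nat" and \<alpha> :: "letter list"
    assume N: "strict_mono Nq" "\<And>q. Nq q \<ge> 1" and \<alpha>: "fst ` set \<alpha> \<subseteq> Inl ` {1..s} \<union> Inr ` {1..s}"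
      and MN: "(\<lambda>q. real (Mq q) / real (Nq q)) \<longlonglongrightarrow> c"
    let ?m = "\<lambda>w :: letter list. \<phi> (eval_monomial star (case_sum U W) w)"
    show "(\<lambda>q. perm_avg (Nq q) (Inl ` {1..s}) (\<lambda>p. Ex (\<lambda>z. trw (Nq q) (mixed_entries p (wishart_entry (Mq q) (Nq q) z)) \<alpha>)))
       \<longlonglongrightarrow> ?m \<alpha>"
    \<comment> \<open>A Wishart letter contributes the ratio \<open>M / N\<close> on the diagonal,
      which tends to \<open>c\<close>, and leaves one copy of itself when it is paired.\<close>
    proof (rule mixed_limit[where d="\<lambda>q. complex_of_real (real (Mq q) / real (Nq q))" and d'="complex_of_real c"
          and ok="\<lambda>l l'. fst l' = fst l" and tw="\<lambda>i. [(i, False)]" and m="?m", OF _ inf[OF N(1)] _ rotate])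
      fix q p and l :: letter assume "fst l \<in> Inr ` {1..s}"
      then obtain r b where r: "r \<in> {1..s}" and l: "l = (Inr r, b)" by (cases l) auto
      show "\<exists>Dr. matrix_ibp Ex (poly_fun V) Dr (\<lambda>z. mixed_entries p (wishart_entry (Mq q) (Nq q) z)) (Nq q) letters l
          (\<lambda>l'. fst l' = fst l) (complex_of_real (real (Mq q) / real (Nq q))) [(fst l, False)]"
        unfolding l fst_conv snd_conv by (rule exI) (rule wishart_ibp[OF r N(2)])
    next
      fix ws :: "letter list list" assume ws: "\<And>w. w \<in> set ws \<Longrightarrow> fst ` set w \<subseteq> Inl ` {1..s}"
      show "(\<lambda>N. perm_avg N (Inl ` {1..s}) (fixed_prod N ws)) \<longlonglongrightarrow> (\<Prod>w\<leftarrow>ws. ?m w)"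
        by (rule UW.permutation_limit[OF _ _ haar ws]) auto
    next
      fix l :: letter and w :: "letter list"
      assume "fst l \<in> Inr ` {1..s}" and w: "fst ` set w \<subseteq> Inl ` {1..s} \<union> Inr ` {1..s}"
      then obtain r b where r: "r \<in> {1..s}" and l: "l = (Inr r, b)" by (cases l) auto
      have w': "fst ` set w \<subseteq> {1..s} <+> {1..s}" using w unfolding letters_eq .
      have I: "Inr r \<in> {1..s} <+> {1..s}" and poi: "free_poisson \<phi> star c (case_sum U W (Inr r))" using r W by auto
      show "?m (l # w) = complex_of_real c * ?m w +
        (\<Sum>k<length w. if fst (w ! k) = fst l then ?m (take k w) * ?m ([(fst l, False)] @ drop (Suc k) w) else 0)"
        using UW.poisson_schwinger_dyson[OF I poi w', of b False] unfolding l fst_conv append_Cons append_Nil .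
    next
      show "(\<lambda>q. complex_of_real (real (Mq q) / real (Nq q))) \<longlonglongrightarrow> complex_of_real c"
        using MN by (rule tendsto_of_real)
    qed (use \<alpha> in auto)
  qed (fact UM_uniform UW_indep wishart_mat_carrier wishart_mat_entry poly_fun_wishart)+
  \<comment> \<open>The limit families themselves witness asymptotic freeness.\<close>
  show ?thesis using 1 2 UG_free UW_free unfolding asymptotically_star_free_def by blast
qed

end
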